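(* Let $(X_k)_{k\geq-1}$ be an INAR(2) process with autoregressive parameters $(\alpha,\beta)=(1,0)$ (hence it is unstable and decomposable). Suppose that $X_0=X_{-1}=0$, $\mathbb{E}(\varepsilon_1^4)<\infty$ and $\mu>0$. Let $(\widehat\alpha_n(\boldsymbol{X}_n),\widehat\beta_n(\boldsymbol{X}_n),\widehat\mu_n(\boldsymbol{X}_n))$ be a conditional least squares (CLS) estimator of $(\alpha,\beta,\mu)$ based on $\boldsymbol{X}_n=(X_1,\dots,X_n)$ and $\widehat\varrho_n(\boldsymbol{X}_n)=\widehat\alpha_n(\boldsymbol{X}_n)+\widehat\beta_n(\boldsymbol{X}_n)$. Then, as $n\to\infty$, $$n^{3/2}\bigl(\widehat\varrho_n(\boldsymbol{X}_n)-1\bigr)\xrightarrow{\mathcal{L}}\mathcal{N}_1\Big(0,\frac{12\sigma^2}{\mu^2}\Big),$$ $$\begin{bmatrix}n^{1/2}(\widehat\alpha_n(\boldsymbol{X}_n)-1)\\ n^{1/2}\widehat\beta_n(\boldsymbol{X}_n)\end{bmatrix}\xrightarrow{\mathcal{L}}Z\begin{bmatrix}-1\\ 1\end{bmatrix},$$ $$n^{1/2}\bigl(\widehat\mu_n(\boldsymbol{X}_n)-\mu\bigr)\xrightarrow{\mathcal{L}}\mathcal{N}_1(0,\mu^2+4\sigma^2),$$ where $Z$ is a standard normally distributed random variable.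
   Context: INAR(2) process: let $(\varepsilon_k)_{k\in\mathbb{N}}$ be i.i.d. non-negative integer-valued random variables and $(\alpha,\beta)\in[0,1]^2$. An INAR(2) process with autoregressive parameters $(\alpha,\beta)$ and innovations $(\varepsilon_k)$ is a process $(X_k)_{k\geq-1}$ with $$X_k=\sum_{j=1}^{X_{k-1}}\xi_{k,j}+\sum_{j=1}^{X_{k-2}}\eta_{k,j}+\varepsilon_k,\qquad k\in\mathbb{N},$$ where for each $k$, $(\xi_{k,j})_{j\in\mathbb{N}}$ and $(\eta_{k,j})_{j\in\mathbb{N}}$ are sequences of i.i.d. Bernoulli random variables with mean $\alpha$ and $\beta$ respectively, these sequences are mutually independent (over all $k$) and independent of $(\varepsilon_k)_{k\in\mathbb{N}}$, and $X_0,X_{-1}$ are non-negative integer-valued random variables independent of all of $(\xi_{k,j})$, $(\eta_{k,j})$, $(\varepsilon_k)$. The process is unstable if $\alpha+\beta=1$, and decomposable if $\beta=0$. Notation: $\mu:=\mathbb{E}(\varepsilon_1)$, $\sigma^2:=\operatorname{Var}(\varepsilon_1)$. CLS estimator: for $\boldsymbol{x}_n=(x_1,\dots,x_n)\in\mathbb{R}^n$ put $x_{-1}:=x_0:=0$ and $Q_n(\boldsymbol{x}_n;\alpha',\beta',\mu'):=\sum_{k=1}^n(x_k-\alpha'x_{k-1}-\beta'x_{k-2}-\mu')^2$. A CLS estimator of $(\alpha,\beta,\mu)$ is a measurable function $(\widehat\alpha_n,\widehat\beta_n,\widehat\mu_n):\mathbb{R}^n\to\mathbb{R}^3$ with $Q_n(\boldsymbol{x}_n;\widehat\alpha_n(\boldsymbol{x}_n),\widehat\beta_n(\boldsymbol{x}_n),\widehat\mu_n(\boldsymbol{x}_n))=\inf_{(\alpha',\beta',\mu')\in\mathbb{R}^3}Q_n(\boldsymbol{x}_n;\alpha',\beta',\mu')$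 for all $\boldsymbol{x}_n\in\mathbb{R}^n$. On the event $\{\sum_{k=1}^nX_{k-2}^2>0\}$ (whose probability tends to $1$) it is uniquely determined: $$\begin{bmatrix}\widehat\alpha_n(\boldsymbol{X}_n)\\ \widehat\beta_n(\boldsymbol{X}_n)\\ \widehat\mu_n(\boldsymbol{X}_n)\end{bmatrix}=\left(\sum_{k=1}^n\begin{bmatrix}X_{k-1}^2&X_{k-1}X_{k-2}&X_{k-1}\\ X_{k-1}X_{k-2}&X_{k-2}^2&X_{k-2}\\ X_{k-1}&X_{k-2}&1\end{bmatrix}\right)^{-1}\sum_{k=1}^n\begin{bmatrix}X_kX_{k-1}\\ X_kX_{k-2}\\ X_k\end{bmatrix}.$$ The stability parameter is $\varrho:=\alpha+\beta$, and its CLS estimator is $\widehat\varrho_n:=\widehat\alpha_n+\widehat\beta_n$. $\xrightarrow{\mathcal{L}}$ denotes convergence in distribution, and $\mathcal{N}_1(m,v)$ is the normal distribution with mean $m$ and variance $v$.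
   Formalization: The second and third limits are stated under the added assumption σ²>0: for constant innovations the CLS estimator equals (1,0,μ) exactly for n≥3, so these two limits fail; the first limit is proved without it. *)

theory Defs
  imports "HOL-Probability.Probability"
begin

datatype noise_index = Innovation nat | Thinning1 nat nat | Thinning2 nat nat

primrec noise ::
  "(nat \<Rightarrow> 'a \<Rightarrow> nat) \<Rightarrow> (nat \<Rightarrow> nat \<Rightarrow> 'a \<Rightarrow> nat) \<Rightarrow> (nat \<Rightarrow> nat \<Rightarrow> 'a \<Rightarrow> nat)
    \<Rightarrow> noise_index \<Rightarrow> 'a \<Rightarrow> nat"
where
  "noise \<epsilon> \<xi> \<eta> (Innovation k) = \<epsilon> k"
| "noise \<epsilon> \<xi> \<eta> (Thinning1 k j) = \<xi> k j"
| "noise \<epsilon> \<xi> \<eta> (Thinning2 k j) = \<eta> k j"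

definition noise_indices :: "noise_index set" where
  "noise_indices = {Innovation k | k. 1 \<le> k} \<union> {Thinning1 k j | k j. 1 \<le> k \<and> 1 \<le> j}
     \<union> {Thinning2 k j | k j. 1 \<le> k \<and> 1 \<le> j}"

text \<open>
  The noise variables are indexed from \<open>1\<close> and the process from \<open>-1\<close>; the values outside these
  ranges are irrelevant. The two initial values need not be independent of each other:
  \<open>indep_initial\<close> says that the pair is independent of the whole noise family, in terms of the
  generated sigma-algebras because \<^const>\<open>prob_space.indep_var\<close> needs equal value types. The recursion
  is an equality of random variables, i.e.\ it holds almost surely.
\<close>

locale inar2_process = prob_space M
  for M :: "'a measure" +
  fixes \<alpha> \<beta> :: real
    and \<epsilon> :: "nat \<Rightarrow> 'a \<Rightarrow> nat"
    and \<xi> \<eta> :: "nat \<Rightarrow> nat \<Rightarrow> 'a \<Rightarrow> nat"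
    and X :: "int \<Rightarrow> 'a \<Rightarrow> nat"
  assumes alpha_range: "\<alpha> \<in> {0..1}" and beta_range: "\<beta> \<in> {0..1}"
    and innovation_distr: "\<And>k. 1 \<le> k \<Longrightarrow>
      distr M (count_space UNIV) (\<epsilon> k) = distr M (count_space UNIV) (\<epsilon> 1)"
    and thinning1_distr: "\<And>k j. 1 \<le> k \<Longrightarrow> 1 \<le> j \<Longrightarrow>
      distr M (count_space UNIV) (\<xi> k j) = measure_pmf (map_pmf of_bool (bernoulli_pmf \<alpha>))"
    and thinning2_distr: "\<And>k j. 1 \<le> k \<Longrightarrow> 1 \<le> j \<Longrightarrow>
      distr M (count_space UNIV) (\<eta> k j) = measure_pmf (map_pmf of_bool (bernoulli_pmf \<beta>))"
    and indep_noise: "indep_vars (\<lambda>_. count_space UNIV) (noise \<epsilon> \<xi> \<eta>) noise_indices"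
    and indep_initial: "indep_set
      (sets (vimage_algebra (space M) (\<lambda>\<omega>. (X 0 \<omega>, X (- 1) \<omega>)) (count_space UNIV)))
      (sets (vimage_algebra (space M) (\<lambda>\<omega>. \<lambda>i\<in>noise_indices. noise \<epsilon> \<xi> \<eta> i \<omega>)
        (\<Pi>\<^sub>M i\<in>noise_indices. count_space UNIV)))"
    and random_variable_X: "\<And>k. - 1 \<le> k \<Longrightarrow> random_variable (count_space UNIV) (X k)"
    and recursion: "\<And>k. 1 \<le> k \<Longrightarrow> AE \<omega> in M.
      X (int k) \<omega> = (\<Sum>j = 1..X (int k - 1) \<omega>. \<xi> k j \<omega>) + (\<Sum>j = 1..X (int k - 2) \<omega>. \<eta> k j \<omega>) + \<epsilon> k \<omega>"

definition sample :: "(int \<Rightarrow> 'a \<Rightarrow> nat) \<Rightarrow> nat \<Rightarrow> 'a \<Rightarrow> nat \<Rightarrow> real" where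
  "sample X n \<omega> = (\<lambda>k\<in>{1..n}. real (X (int k) \<omega>))"

text \<open>The convention \<open>x\<^sub>-\<^sub>1 = x\<^sub>0 = 0\<close> for an observation vector \<open>(x\<^sub>1, \<dots>, x\<^sub>n)\<close>.\<close>

definition zero_start :: "(nat \<Rightarrow> real) \<Rightarrow> int \<Rightarrow> real" where
  "zero_start x k = (if 1 \<le> k then x (nat k) else 0)"

definition cls_objective :: "nat \<Rightarrow> (nat \<Rightarrow> real) \<Rightarrow> real \<times> real \<times> real \<Rightarrow> real" where
  "cls_objective n x = (\<lambda>(a, b, m). \<Sum>k = 1..int n.
     (zero_start x k - a * zero_start x (k - 1) - b * zero_start x (k - 2) - m)\<^sup>2)"

text \<open>
  The space \<open>\<real>\<^sup>n\<close> is the product of \<open>n\<close> copies of the Borel line indexed by \<open>{1..n}\<close>.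
\<close>

definition cls_estimator :: "nat \<Rightarrow> ((nat \<Rightarrow> real) \<Rightarrow> real \<times> real \<times> real) \<Rightarrow> bool" where
  "cls_estimator n \<theta> \<longleftrightarrow>
     \<theta> \<in> borel_measurable (\<Pi>\<^sub>M k\<in>{1..n}. (borel :: real measure)) \<and>
     (\<forall>x \<in> space (\<Pi>\<^sub>M k\<in>{1..n}. (borel :: real measure)).
        cls_objective n x (\<theta> x) = (INF p. cls_objective n x p))"

text \<open>
  The normal distribution in terms of its variance (the library's \<^const>\<open>normal_density\<close> takes the
  standard deviation), with variance \<open>0\<close> meaning the point mass.
\<close>

definition normal_law :: "real \<Rightarrow> real \<Rightarrow> real measure" where
  "normal_law m v =
     (if v = 0 then return borel m else density lborel (normal_density m (sqrt v)))"

text \<open>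
  The library's \<^const>\<open>weak_conv_m\<close> is convergence of distribution functions on the real line;
  the following notion also covers random vectors, and agrees with it on the line.
\<close>

definition weakly_converges ::
  "(nat \<Rightarrow> 'b::topological_space measure) \<Rightarrow> 'b measure \<Rightarrow> bool"
where
  "weakly_converges \<mu> \<nu> \<longleftrightarrow> (\<forall>f :: 'b \<Rightarrow> real. continuous_on UNIV f \<longrightarrow> bounded (range f) \<longrightarrow>
     (\<lambda>n. \<integral>x. f x \<partial>\<mu> n) \<longlonglongrightarrow> (\<integral>x. f x \<partial>\<nu>))"

lemma weakly_converges_real_iff:
  fixes \<mu> :: "nat \<Rightarrow> real measure"
  assumes "\<And>n. real_distribution (\<mu> n)" and "real_distribution \<nu>"
  shows "weakly_converges \<mu> \<nu> \<longleftrightarrow> weak_conv_m \<mu> \<nu>"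
proof
  assume *: "weakly_converges \<mu> \<nu>"
  show "weak_conv_m \<mu> \<nu>"
  proof (rule integral_bdd_continuous_conv_imp_weak_conv[OF assms])
    fix f :: "real \<Rightarrow> real"
    assume "\<And>x. isCont f x" and "\<And>x. \<bar>f x\<bar> \<le> 1"
    then have "continuous_on UNIV f" and "bounded (range f)"
      by (auto simp: continuous_at_imp_continuous_on bounded_iff)
    with * show "(\<lambda>n. integral\<^sup>L (\<mu> n) f) \<longlonglongrightarrow> integral\<^sup>L \<nu> f"
      by (simp add: weakly_converges_def)
  qed
next
  assume *: "weak_conv_m \<mu> \<nu>"
  show "weakly_converges \<mu> \<nu>"
    unfolding weakly_converges_def
  proof (intro allI impI)
    fix f :: "real \<Rightarrow> real"
    assume "continuous_on UNIV f" and "bounded (range f)"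
    then obtain B where "\<And>x. isCont f x" and "\<And>x. norm (f x) \<le> B"
      by (auto simp: continuous_on_eq_continuous_at bounded_iff)
    then show "(\<lambda>n. integral\<^sup>L (\<mu> n) f) \<longlonglongrightarrow> integral\<^sup>L \<nu> f"
      by (rule weak_conv_imp_integral_bdd_continuous_conv[OF assms *])
  qed
qed

end

theory Submission
  imports Defs
begin

text \<open>
  With autoregressive parameters \<open>(1, 0)\<close> the thinning operations are trivial and the process is a
  random walk \<open>X\<^sub>k = X\<^sub>k\<^sub>-\<^sub>1 + \<epsilon>\<^sub>k\<close> with drift \<open>\<mu>\<close> (lemma \<open>inar2_random_walk\<close>). The regressors \<open>X\<^sub>k\<^sub>-\<^sub>1\<close> and
  \<open>X\<^sub>k\<^sub>-\<^sub>2\<close> both grow like \<open>\<mu> k\<close> and become collinear, so one regresses on \<open>X\<^sub>k\<^sub>-\<^sub>1\<close>, on the centred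
  increment \<open>\<epsilon>\<^sub>k\<^sub>-\<^sub>1 - \<mu>\<close> and on \<open>1\<close> instead. The coefficients in these coordinates are
  \<open>u = \<alpha> + \<beta> - 1\<close>, \<open>c = - \<beta>\<close> and \<open>w = m - \<mu> - \<beta> \<mu>\<close>, where \<open>m\<close> is the intercept, and they
  are estimated at the rates \<open>n\<^sup>3\<^sup>/\<^sup>2\<close>, \<open>n\<^sup>1\<^sup>/\<^sup>2\<close> and \<open>n\<^sup>1\<^sup>/\<^sup>2\<close>.

  After this scaling the Gram matrix of the regressors converges in probability to the matrix
  with rows \<open>(\<mu>\<^sup>2/3, 0, \<mu>/2)\<close>, \<open>(0, \<sigma>\<^sup>2, 0)\<close> and \<open>(\<mu>/2, 0, 1)\<close>: the random part of \<open>X\<^sub>k\<close> is of smaller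
  order than the drift, and the increments are uncorrelated with the drift. The right hand sides of
  the normal equations are, up to vanishing terms, the sums of \<open>\<mu> (j/n) e\<^sub>j\<close>, \<open>e\<^sub>j\<^sub>-\<^sub>1 e\<^sub>j\<close> and
  \<open>e\<^sub>j\<close>, each divided by \<open>n\<^sup>1\<^sup>/\<^sup>2\<close>, for the centred innovations \<open>e\<^sub>j\<close>. Inverting the limit matrix shows
  that each scaled estimation error is asymptotically a sum of the form
  \<open>n\<^sup>-\<^sup>1\<^sup>/\<^sup>2 \<Sum>\<^sub>j (p + q (j/n) + r e\<^sub>j\<^sub>-\<^sub>1) e\<^sub>j\<close> (theorem \<open>regression_expansion\<close>).

  Such a sum has martingale differences as terms. Its characteristic function is compared with the
  Gaussian one by telescoping over the terms; since fourth moments are finite, each term costs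
  \<open>O(n\<^sup>-\<^sup>3\<^sup>/\<^sup>2)\<close> (lemma \<open>char_step\<close>). The conditional variance of a term is random through
  \<open>e\<^sub>j\<^sub>-\<^sub>1\<close>, but it is independent of everything before \<open>e\<^sub>j\<^sub>-\<^sub>1\<close>, which is why its fluctuation
  contributes an error of the same order only. The limit is therefore normal with variance
  \<open>\<sigma>\<^sup>2 (p\<^sup>2 + p q + q\<^sup>2/3 + r\<^sup>2 \<sigma>\<^sup>2)\<close> (lemma \<open>ramp_sum_normal_limit\<close>), and Slutsky's lemma transfers it
  to the estimators. For \<open>\<sigma>\<^sup>2 = 0\<close> the limit matrix is singular, but then the least squares fit is
  exact and the estimator of \<open>\<alpha> + \<beta>\<close> equals \<open>1\<close>.
\<close>

section \<open>Convergence to zero and boundedness in probability\<close>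

context prob_space
begin

text \<open>
  Convergence to \<open>0\<close> in probability, phrased through small exceptional events instead of the
  probabilities of \<open>{\<bar>Y\<^sub>n\<bar> > \<eta>}\<close>. In this form null sets can be absorbed into the exceptional
  event, and no measurability of \<open>Y\<^sub>n\<close> has to be carried along.
\<close>

definition vanishes_in_prob :: "(nat \<Rightarrow> 'a \<Rightarrow> 'b::real_normed_vector) \<Rightarrow> bool" where
  "vanishes_in_prob Y \<longleftrightarrow> (\<forall>\<eta>>0. \<forall>\<rho>>0. \<forall>\<^sub>F n in sequentially.
     \<exists>B\<in>events. prob B \<le> \<rho> \<and> (\<forall>\<omega>\<in>space M - B. norm (Y n \<omega>) \<le> \<eta>))"

definition bounded_in_prob :: "(nat \<Rightarrow> 'a \<Rightarrow> 'b::real_normed_vector) \<Rightarrow> bool" where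
  "bounded_in_prob Y \<longleftrightarrow> (\<forall>\<rho>>0. \<exists>K. \<forall>\<^sub>F n in sequentially.
     \<exists>B\<in>events. prob B \<le> \<rho> \<and> (\<forall>\<omega>\<in>space M - B. norm (Y n \<omega>) \<le> K))"

text \<open>
  The transfer principle behind all manipulations of \<open>o\<^sub>P(1)\<close> and \<open>O\<^sub>P(1)\<close> terms: a deterministic
  implication that bounds \<open>Y\<close> once \<open>D\<close> is small and \<open>R\<close> is bounded becomes a statement about
  convergence in probability, because off an event of small probability both premises hold.
\<close>

lemma vanishes_in_prob_by_control:
  fixes D :: "nat \<Rightarrow> 'a \<Rightarrow> 'b::real_normed_vector" and R :: "nat \<Rightarrow> 'a \<Rightarrow> 'c::real_normed_vector"
    and Y :: "nat \<Rightarrow> 'a \<Rightarrow> 'd::real_normed_vector"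
  assumes D: "vanishes_in_prob D" and R: "bounded_in_prob R"
    and control: "\<And>K \<eta>. 0 < \<eta> \<Longrightarrow> 0 < K \<Longrightarrow> \<exists>\<delta>>0. \<forall>\<^sub>F n in sequentially. AE \<omega> in M.
      norm (D n \<omega>) \<le> \<delta> \<longrightarrow> norm (R n \<omega>) \<le> K \<longrightarrow> norm (Y n \<omega>) \<le> \<eta>"
  shows "vanishes_in_prob Y"
  unfolding vanishes_in_prob_def
proof (intro allI impI)
  fix \<eta> \<rho> :: real assume pos: "0 < \<eta>" "0 < \<rho>"
  then have \<rho>2: "0 < \<rho>/2" by simp
  obtain K' where K': "\<forall>\<^sub>F n in sequentially.
     \<exists>B\<in>events. prob B \<le> \<rho>/2 \<and> (\<forall>\<omega>\<in>space M - B. norm (R n \<omega>) \<le> K')"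
    using R \<rho>2 unfolding bounded_in_prob_def by blast
  define K where "K = max K' 1"
  have K: "0 < K" "K' \<le> K" by (auto simp: K_def)
  obtain \<delta> where \<delta>: "\<delta> > 0" and ctl: "\<forall>\<^sub>F n in sequentially. AE \<omega> in M.
      norm (D n \<omega>) \<le> \<delta> \<longrightarrow> norm (R n \<omega>) \<le> K \<longrightarrow> norm (Y n \<omega>) \<le> \<eta>"
    using control[OF pos(1) K(1)] by blast
  have D': "\<forall>\<^sub>F n in sequentially.
     \<exists>B\<in>events. prob B \<le> \<rho>/2 \<and> (\<forall>\<omega>\<in>space M - B. norm (D n \<omega>) \<le> \<delta>)"
    using D \<rho>2 \<delta> unfolding vanishes_in_prob_def by blast
  show "\<forall>\<^sub>F n in sequentially. \<exists>B\<in>events. prob B \<le> \<rho> \<and> (\<forall>\<omega>\<in>space M - B. norm (Y n \<omega>) \<le> \<eta>)"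
    using D' K' ctl
  proof eventually_elim
    case (elim n)
    from elim(1) obtain A where A: "A \<in> events" "prob A \<le> \<rho>/2"
      "\<And>\<omega>. \<omega>\<in>space M - A \<Longrightarrow> norm (D n \<omega>) \<le> \<delta>" by blast
    from elim(2) obtain B where B: "B \<in> events" "prob B \<le> \<rho>/2"
      "\<And>\<omega>. \<omega>\<in>space M - B \<Longrightarrow> norm (R n \<omega>) \<le> K'" by blast
    from AE_E[OF elim(3)] obtain N where
      N0: "{\<omega> \<in> space M. \<not> (norm (D n \<omega>) \<le> \<delta> \<longrightarrow> norm (R n \<omega>) \<le> K \<longrightarrow> norm (Y n \<omega>) \<le> \<eta>)} \<subseteq> N"
      "N \<in> events" "emeasure M N = 0" by blast
    then have N: "N \<in> events" "prob N = 0"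
      "\<And>\<omega>. \<omega>\<in>space M - N \<Longrightarrow> norm (D n \<omega>) \<le> \<delta> \<Longrightarrow> norm (R n \<omega>) \<le> K \<Longrightarrow> norm (Y n \<omega>) \<le> \<eta>"
      by (auto simp: measure_def)
    have "prob (A \<union> B \<union> N) \<le> prob A + prob B + prob N"
      using measure_Un_le[of "A \<union> B" M N] measure_Un_le[of A M B] A(1) B(1) N(1) by simp
    also have "\<dots> \<le> \<rho>" using A B N by simp
    finally have "prob (A \<union> B \<union> N) \<le> \<rho>" .
    moreover have "norm (Y n \<omega>) \<le> \<eta>" if "\<omega> \<in> space M - (A \<union> B \<union> N)" for \<omega>
      using that A(3)[of \<omega>] B(3)[of \<omega>] N(3)[of \<omega>] K by auto
    ultimately show ?case using A(1) B(1) N(1) by (intro bexI[of _ "A \<union> B \<union> N"]) auto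
  qed
qed

lemma vanishes_imp_bounded_in_prob:
  assumes "vanishes_in_prob Y" shows "bounded_in_prob Y"
  using assms zero_less_one unfolding vanishes_in_prob_def bounded_in_prob_def by blast

lemma bounded_in_prob_mono:
  assumes "bounded_in_prob R" "\<And>n \<omega>. norm (Y n \<omega>) \<le> norm (R n \<omega>)"
  shows "bounded_in_prob Y"
  using assms(1) unfolding bounded_in_prob_def
proof (intro allI impI, goal_cases)
  case (1 \<rho>)
  then obtain K where "\<forall>\<^sub>F n in sequentially.
     \<exists>B\<in>events. prob B \<le> \<rho> \<and> (\<forall>\<omega>\<in>space M - B. norm (R n \<omega>) \<le> K)" by blast
  then show ?case
    by (intro exI[of _ K]) (use assms(2) in \<open>auto elim!: eventually_mono; meson order_trans\<close>)
qed

lemma bounded_in_prob_add: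
  fixes Y :: "nat \<Rightarrow> 'a \<Rightarrow> 'b::real_normed_vector"
  assumes "bounded_in_prob Y" "bounded_in_prob Z"
  shows "bounded_in_prob (\<lambda>n \<omega>. Y n \<omega> + Z n \<omega>)"
  unfolding bounded_in_prob_def
proof (intro allI impI)
  fix \<rho> :: real assume "0 < \<rho>"
  then have \<rho>2: "0 < \<rho>/2" by simp
  obtain K where K: "\<forall>\<^sub>F n in sequentially.
     \<exists>B\<in>events. prob B \<le> \<rho>/2 \<and> (\<forall>\<omega>\<in>space M - B. norm (Y n \<omega>) \<le> K)"
    using assms(1) \<rho>2 unfolding bounded_in_prob_def by blast
  obtain L where L: "\<forall>\<^sub>F n in sequentially.
     \<exists>B\<in>events. prob B \<le> \<rho>/2 \<and> (\<forall>\<omega>\<in>space M - B. norm (Z n \<omega>) \<le> L)"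
    using assms(2) \<rho>2 unfolding bounded_in_prob_def by blast
  have "\<forall>\<^sub>F n in sequentially.
     \<exists>B\<in>events. prob B \<le> \<rho> \<and> (\<forall>\<omega>\<in>space M - B. norm (Y n \<omega> + Z n \<omega>) \<le> K + L)"
    using K L
  proof eventually_elim
    case (elim n)
    from elim(1) obtain A where A: "A \<in> events" "prob A \<le> \<rho>/2"
      "\<And>\<omega>. \<omega>\<in>space M - A \<Longrightarrow> norm (Y n \<omega>) \<le> K" by blast
    from elim(2) obtain B where B: "B \<in> events" "prob B \<le> \<rho>/2"
      "\<And>\<omega>. \<omega>\<in>space M - B \<Longrightarrow> norm (Z n \<omega>) \<le> L" by blast
    have "norm (Y n \<omega> + Z n \<omega>) \<le> K + L" if "\<omega> \<in> space M - (A \<union> B)" for \<omega>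
      using that A(3)[of \<omega>] B(3)[of \<omega>] norm_triangle_ineq[of "Y n \<omega>" "Z n \<omega>"] by auto
    moreover have "prob (A \<union> B) \<le> \<rho>"
      using measure_Un_le[of A M B] A B by simp
    ultimately show ?case using A(1) B(1) by (intro bexI[of _ "A \<union> B"]) auto
  qed
  then show "\<exists>K. \<forall>\<^sub>F n in sequentially.
     \<exists>B\<in>events. prob B \<le> \<rho> \<and> (\<forall>\<omega>\<in>space M - B. norm (Y n \<omega> + Z n \<omega>) \<le> K)" by blast
qed

lemma vanishes_in_prob_add:
  fixes Y :: "nat \<Rightarrow> 'a \<Rightarrow> 'b::real_normed_vector"
  assumes "vanishes_in_prob Y" "vanishes_in_prob Z"
  shows "vanishes_in_prob (\<lambda>n \<omega>. Y n \<omega> + Z n \<omega>)"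
  unfolding vanishes_in_prob_def
proof (intro allI impI)
  fix \<eta> \<rho> :: real assume "0 < \<eta>" "0 < \<rho>"
  then have 2: "0 < \<eta>/2" "0 < \<rho>/2" by simp_all
  have K: "\<forall>\<^sub>F n in sequentially.
     \<exists>B\<in>events. prob B \<le> \<rho>/2 \<and> (\<forall>\<omega>\<in>space M - B. norm (Y n \<omega>) \<le> \<eta>/2)"
    using assms(1) 2 unfolding vanishes_in_prob_def by blast
  have L: "\<forall>\<^sub>F n in sequentially.
     \<exists>B\<in>events. prob B \<le> \<rho>/2 \<and> (\<forall>\<omega>\<in>space M - B. norm (Z n \<omega>) \<le> \<eta>/2)"
    using assms(2) 2 unfolding vanishes_in_prob_def by blast
  show "\<forall>\<^sub>F n in sequentially.
     \<exists>B\<in>events. prob B \<le> \<rho> \<and> (\<forall>\<omega>\<in>space M - B. norm (Y n \<omega> + Z n \<omega>) \<le> \<eta>)"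
    using K L
  proof eventually_elim
    case (elim n)
    from elim(1) obtain A where A: "A \<in> events" "prob A \<le> \<rho>/2"
      "\<And>\<omega>. \<omega>\<in>space M - A \<Longrightarrow> norm (Y n \<omega>) \<le> \<eta>/2" by blast
    from elim(2) obtain B where B: "B \<in> events" "prob B \<le> \<rho>/2"
      "\<And>\<omega>. \<omega>\<in>space M - B \<Longrightarrow> norm (Z n \<omega>) \<le> \<eta>/2" by blast
    have "norm (Y n \<omega> + Z n \<omega>) \<le> \<eta>" if "\<omega> \<in> space M - (A \<union> B)" for \<omega>
      using that A(3)[of \<omega>] B(3)[of \<omega>] norm_triangle_ineq[of "Y n \<omega>" "Z n \<omega>"] by auto
    moreover have "prob (A \<union> B) \<le> \<rho>"
      using measure_Un_le[of A M B] A B by simp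
    ultimately show ?case using A(1) B(1) by (intro bexI[of _ "A \<union> B"]) auto
  qed
qed

lemma vanishes_in_prob_const:
  assumes "c \<longlonglongrightarrow> 0" shows "vanishes_in_prob (\<lambda>n \<omega>. c n)"
  unfolding vanishes_in_prob_def
proof (intro allI impI)
  fix \<eta> \<rho> :: real assume "0 < \<eta>" "0 < \<rho>"
  have "\<forall>\<^sub>F n in sequentially. norm (c n) < \<eta>"
    using tendstoD[OF assms \<open>0 < \<eta>\<close>] by (simp add: dist_norm)
  then show "\<forall>\<^sub>F n in sequentially. \<exists>B\<in>events. prob B \<le> \<rho> \<and> (\<forall>\<omega>\<in>space M - B. norm (c n) \<le> \<eta>)"
    by eventually_elim (use \<open>0 < \<rho>\<close> in \<open>auto intro!: bexI[of _ "{}"]\<close>)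
qed

lemma bounded_in_prob_const: "bounded_in_prob (\<lambda>n \<omega>. c)"
  unfolding bounded_in_prob_def
  by (intro allI impI exI[of _ "norm c"] always_eventually bexI[of _ "{}"]) auto

lemma vanishes_in_prob_mono:
  assumes "vanishes_in_prob D" "\<And>n. AE \<omega> in M. norm (Y n \<omega>) \<le> norm (D n \<omega>)"
  shows "vanishes_in_prob Y"
proof (rule vanishes_in_prob_by_control[OF assms(1) bounded_in_prob_const[of "0::real"]])
  fix K \<eta> :: real assume "0 < \<eta>" "0 < K"
  show "\<exists>\<delta>>0. \<forall>\<^sub>F n in sequentially. AE \<omega> in M.
      norm (D n \<omega>) \<le> \<delta> \<longrightarrow> norm (0::real) \<le> K \<longrightarrow> norm (Y n \<omega>) \<le> \<eta>"
  proof (intro exI[of _ \<eta>] conjI eventually_sequentiallyI[of 0])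
    fix n show "AE \<omega> in M. norm (D n \<omega>) \<le> \<eta> \<longrightarrow> norm (0::real) \<le> K \<longrightarrow> norm (Y n \<omega>) \<le> \<eta>"
      using assms(2)[of n] by eventually_elim auto
  qed (rule \<open>0 < \<eta>\<close>)
qed

lemma vanishes_in_prob_mult_bounded:
  fixes D R :: "nat \<Rightarrow> 'a \<Rightarrow> real"
  assumes "vanishes_in_prob D" "bounded_in_prob R"
  shows "vanishes_in_prob (\<lambda>n \<omega>. D n \<omega> * R n \<omega>)"
proof (rule vanishes_in_prob_by_control[OF assms])
  fix K \<eta> :: real assume *: "0 < \<eta>" "0 < K"
  have "norm (d * r) \<le> \<eta>" if "norm d \<le> \<eta>/K" "norm r \<le> K" for d r :: real
  proof -
    have "norm (d * r) \<le> (\<eta>/K) * K"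
      unfolding norm_mult using that * by (intro mult_mono) auto
    then show ?thesis using * by simp
  qed
  then show "\<exists>\<delta>>0. \<forall>\<^sub>F n in sequentially. AE \<omega> in M.
      norm (D n \<omega>) \<le> \<delta> \<longrightarrow> norm (R n \<omega>) \<le> K \<longrightarrow> norm (D n \<omega> * R n \<omega>) \<le> \<eta>"
    using * by (intro exI[of _ "\<eta>/K"]) auto
qed

lemma vanishes_in_prob_cmult:
  fixes D :: "nat \<Rightarrow> 'a \<Rightarrow> real"
  assumes "vanishes_in_prob D" shows "vanishes_in_prob (\<lambda>n \<omega>. c * D n \<omega>)"
  using vanishes_in_prob_mult_bounded[OF assms bounded_in_prob_const[of c]] by (simp add: mult.commute)

lemma Markov_prob:
  fixes Y :: "'a \<Rightarrow> real"
  assumes "integrable M Y" "0 < c" "expectation (\<lambda>\<omega>. \<bar>Y \<omega>\<bar>) \<le> \<rho> * c"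
  shows "\<exists>B\<in>events. prob B \<le> \<rho> \<and> (\<forall>\<omega>\<in>space M - B. norm (Y \<omega>) \<le> c)"
proof -
  have "prob {\<omega> \<in> space M. c \<le> \<bar>Y \<omega>\<bar>} \<le> expectation (\<lambda>\<omega>. \<bar>Y \<omega>\<bar>) / c"
    by (rule integral_Markov_inequality_measure[where A = "space M"]) (use assms in auto)
  also have "\<dots> \<le> \<rho>" using assms by (simp add: field_simps)
  finally show ?thesis
    using assms(1) by (intro bexI[of _ "{\<omega> \<in> space M. c \<le> \<bar>Y \<omega>\<bar>}"]) auto
qed

lemma vanishes_in_prob_L1:
  fixes Y :: "nat \<Rightarrow> 'a \<Rightarrow> real"
  assumes "\<And>n. integrable M (Y n)" "c \<longlonglongrightarrow> 0"
    "\<forall>\<^sub>F n in sequentially. expectation (\<lambda>\<omega>. \<bar>Y n \<omega>\<bar>) \<le> c n"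
  shows "vanishes_in_prob Y"
  unfolding vanishes_in_prob_def
proof (intro allI impI)
  fix \<eta> \<rho> :: real assume *: "0 < \<eta>" "0 < \<rho>"
  then have "\<forall>\<^sub>F n in sequentially. norm (c n) < \<rho> * \<eta>"
    using tendstoD[OF assms(2), of "\<rho> * \<eta>"] by (simp add: dist_norm)
  then show "\<forall>\<^sub>F n in sequentially. \<exists>B\<in>events. prob B \<le> \<rho> \<and> (\<forall>\<omega>\<in>space M - B. norm (Y n \<omega>) \<le> \<eta>)"
    using assms(3)
  proof eventually_elim
    case (elim n)
    then show ?case using Markov_prob[OF assms(1)[of n], of \<eta> \<rho>] * by simp
  qed
qed

lemma bounded_in_prob_L1:
  fixes Y :: "nat \<Rightarrow> 'a \<Rightarrow> real"
  assumes "\<And>n. integrable M (Y n)" "\<And>n. expectation (\<lambda>\<omega>. \<bar>Y n \<omega>\<bar>) \<le> C"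
  shows "bounded_in_prob Y"
  unfolding bounded_in_prob_def
proof (intro allI impI)
  fix \<rho> :: real assume *: "0 < \<rho>"
  have "\<rho> * ((\<bar>C\<bar> + 1) / \<rho>) = \<bar>C\<bar> + 1" using * by simp
  then have "expectation (\<lambda>\<omega>. \<bar>Y n \<omega>\<bar>) \<le> \<rho> * ((\<bar>C\<bar> + 1) / \<rho>)" for n
    using assms(2)[of n] by linarith
  then show "\<exists>K. \<forall>\<^sub>F n in sequentially. \<exists>B\<in>events. prob B \<le> \<rho> \<and> (\<forall>\<omega>\<in>space M - B. norm (Y n \<omega>) \<le> K)"
    using assms(1) * by (intro exI[of _ "(\<bar>C\<bar>+1)/\<rho>"] always_eventually allI Markov_prob) auto
qed

lemma vanishes_in_prob_L2:
  fixes Y :: "nat \<Rightarrow> 'a \<Rightarrow> real"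
  assumes "\<And>n. integrable M (\<lambda>\<omega>. (Y n \<omega>)\<^sup>2)" "c \<longlonglongrightarrow> 0"
    "\<forall>\<^sub>F n in sequentially. expectation (\<lambda>\<omega>. (Y n \<omega>)\<^sup>2) \<le> c n"
  shows "vanishes_in_prob Y"
proof (rule vanishes_in_prob_by_control[OF _ bounded_in_prob_const[of "0::real"]])
  show "vanishes_in_prob (\<lambda>n \<omega>. (Y n \<omega>)\<^sup>2)"
    using vanishes_in_prob_L1[of "\<lambda>n \<omega>. (Y n \<omega>)\<^sup>2"] assms by simp
  fix \<eta> K :: real assume "0 < \<eta>" "0 < K"
  then show "\<exists>\<delta>>0. \<forall>\<^sub>F n in sequentially. AE \<omega> in M.
      norm ((Y n \<omega>)\<^sup>2) \<le> \<delta> \<longrightarrow> norm (0::real) \<le> K \<longrightarrow> norm (Y n \<omega>) \<le> \<eta>"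
    by (intro exI[of _ "\<eta>\<^sup>2"]) (auto simp: abs_le_square_iff[symmetric])
qed

lemma bounded_in_prob_L2:
  fixes Y :: "nat \<Rightarrow> 'a \<Rightarrow> real"
  assumes "\<And>n. integrable M (\<lambda>\<omega>. (Y n \<omega>)\<^sup>2)" "\<And>n. expectation (\<lambda>\<omega>. (Y n \<omega>)\<^sup>2) \<le> C"
  shows "bounded_in_prob Y"
proof (rule bounded_in_prob_mono)
  show "bounded_in_prob (\<lambda>n \<omega>. 1 + (Y n \<omega>)\<^sup>2)"
    using assms by (intro bounded_in_prob_add bounded_in_prob_const bounded_in_prob_L1) auto
  show "norm (Y n \<omega>) \<le> norm (1 + (Y n \<omega>)\<^sup>2)" for n \<omega>
  proof -
    have "0 \<le> (\<bar>Y n \<omega>\<bar> - 1)\<^sup>2" by simp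
    then show ?thesis by (simp add: power2_eq_square algebra_simps)
  qed
qed

text \<open>
  Tightness keeps \<open>W\<^sub>n\<close>, and hence \<open>V\<^sub>n\<close>, inside a ball on which the continuous \<open>f\<close> is uniformly
  continuous, so \<open>f V\<^sub>n - f W\<^sub>n\<close> vanishes in probability; boundedness of \<open>f\<close> turns this into
  convergence of expectations. Measurability is asked of \<open>V\<^sub>n\<close> for positive \<open>n\<close>,
  because a CLS estimator is specified for samples of positive size only.
\<close>

lemma bounded_continuous_Slutsky:
  fixes V W :: "nat \<Rightarrow> 'a \<Rightarrow> 'b::euclidean_space" and f :: "'b \<Rightarrow> real"
  assumes V: "\<And>n. 0 < n \<Longrightarrow> V n \<in> borel_measurable M"
    and W: "\<And>n. W n \<in> borel_measurable M"
    and close: "vanishes_in_prob (\<lambda>n \<omega>. V n \<omega> - W n \<omega>)"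
    and tight: "bounded_in_prob W"
    and f: "continuous_on UNIV f" "bounded (range f)"
  shows "(\<lambda>n. expectation (\<lambda>\<omega>. f (V n \<omega>)) - expectation (\<lambda>\<omega>. f (W n \<omega>))) \<longlonglongrightarrow> 0"
proof (rule LIMSEQ_I)
  fix r :: real assume r: "0 < r"
  obtain F where F: "\<And>x. \<bar>f x\<bar> \<le> F" and F0: "0 < F"
    using f(2) by (auto simp: bounded_pos)
  have [measurable]: "f \<in> borel_measurable borel" using f(1) by (rule borel_measurable_continuous_onI)
  have vf: "vanishes_in_prob (\<lambda>n \<omega>. f (V n \<omega>) - f (W n \<omega>))"
  proof (rule vanishes_in_prob_by_control[OF close tight])
    fix \<eta> K :: real assume *: "0 < \<eta>" "0 < K"
    have "uniformly_continuous_on (cball 0 (K + 1)) f"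
      using f(1) by (intro compact_uniformly_continuous) (auto intro: continuous_on_subset)
    then obtain \<delta> where \<delta>: "0 < \<delta>" "\<And>x y. x \<in> cball 0 (K+1) \<Longrightarrow> y \<in> cball 0 (K+1) \<Longrightarrow> dist y x < \<delta> \<Longrightarrow>
        dist (f y) (f x) < \<eta>"
      using *(1) unfolding uniformly_continuous_on_def by metis
    have "norm (f x - f y) \<le> \<eta>" if "norm (x - y) \<le> min 1 (\<delta>/2)" "norm y \<le> K" for x y
    proof -
      have "norm x \<le> K + 1" using that norm_triangle_ineq[of "x - y" y] by auto
      then show ?thesis using \<delta>(2)[of y x] that \<delta>(1) by (auto simp: dist_norm)
    qed
    then show "\<exists>\<delta>>0. \<forall>\<^sub>F n in sequentially. AE \<omega> in M. norm (V n \<omega> - W n \<omega>) \<le> \<delta> \<longrightarrow>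
        norm (W n \<omega>) \<le> K \<longrightarrow> norm (f (V n \<omega>) - f (W n \<omega>)) \<le> \<eta>"
      using \<delta>(1) by (intro exI[of _ "min 1 (\<delta>/2)"]) auto
  qed
  \<comment> \<open>the exceptional event contributes at most \<open>2 F \<rho> = r / 4\<close>\<close>
  define \<rho> where "\<rho> = r / (8 * F)"
  have \<rho>: "0 < \<rho>" using r F0 by (simp add: \<rho>_def)
  have "\<forall>\<^sub>F n in sequentially. \<exists>B\<in>events. prob B \<le> \<rho> \<and>
      (\<forall>\<omega>\<in>space M - B. norm (f (V n \<omega>) - f (W n \<omega>)) \<le> r/2)"
    using vf \<rho> half_gt_zero[OF r] unfolding vanishes_in_prob_def by blast
  then have "\<forall>\<^sub>F n in sequentially.
    norm (expectation (\<lambda>\<omega>. f (V n \<omega>)) - expectation (\<lambda>\<omega>. f (W n \<omega>)) - 0) < r"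
    using eventually_gt_at_top[of 0]
  proof eventually_elim
    case (elim n)
    then obtain B where B[measurable]: "B \<in> events" and pB: "prob B \<le> \<rho>"
      and near: "\<And>\<omega>. \<omega>\<in>space M - B \<Longrightarrow> norm (f (V n \<omega>) - f (W n \<omega>)) \<le> r/2" by blast
    note [measurable] = V[OF elim(2)] W[of n]
    have iV: "integrable M (\<lambda>\<omega>. f (V n \<omega>))" and iW: "integrable M (\<lambda>\<omega>. f (W n \<omega>))"
      using F by (auto intro!: integrable_const_bound[of _ F])
    have "norm (expectation (\<lambda>\<omega>. f (V n \<omega>)) - expectation (\<lambda>\<omega>. f (W n \<omega>)))
        = norm (expectation (\<lambda>\<omega>. f (V n \<omega>) - f (W n \<omega>)))" using iV iW by simp
    also have "\<dots> \<le> expectation (\<lambda>\<omega>. norm (f (V n \<omega>) - f (W n \<omega>)))"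
      by (rule integral_norm_bound)
    also have "\<dots> \<le> expectation (\<lambda>\<omega>. r/2 + 2 * F * indicator B \<omega>)"
    proof (rule integral_mono)
      show "norm (f (V n \<omega>) - f (W n \<omega>)) \<le> r/2 + 2 * F * indicator B \<omega>" if "\<omega> \<in> space M" for \<omega>
        using near[of \<omega>] F[of "V n \<omega>"] F[of "W n \<omega>"] that r by (cases "\<omega> \<in> B") auto
      show "integrable M (\<lambda>\<omega>. r/2 + 2 * F * indicator B \<omega>)"
        using r F0 by (intro integrable_const_bound[of _ "r/2 + 2 * F"]) (auto simp: indicator_def)
    qed (use iV iW in auto)
    also have "\<dots> = r/2 + 2 * F * prob B"
    proof -
      have "integrable M (indicator B :: 'a \<Rightarrow> real)"
        by (intro integrable_const_bound[of _ 1]) auto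
      then show ?thesis
        by (subst Bochner_Integration.integral_add) (auto simp: prob_space)
    qed
    also have "\<dots> \<le> r/2 + 2 * F * \<rho>" using pB F0 by simp
    also have "\<dots> < r" using r F0 by (simp add: \<rho>_def)
    finally show ?case by simp
  qed
  then show "\<exists>no. \<forall>n\<ge>no. norm (expectation (\<lambda>\<omega>. f (V n \<omega>)) - expectation (\<lambda>\<omega>. f (W n \<omega>)) - 0) < r"
    by (simp add: eventually_sequentially)
qed

lemma weak_conv_m_Slutsky:
  fixes V W :: "nat \<Rightarrow> 'a \<Rightarrow> real"
  assumes V: "\<And>n. 0 < n \<Longrightarrow> V n \<in> borel_measurable M"
    and W: "\<And>n. W n \<in> borel_measurable M"
    and close: "vanishes_in_prob (\<lambda>n \<omega>. V n \<omega> - W n \<omega>)"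
    and tight: "bounded_in_prob W"
    and lim: "weak_conv_m (\<lambda>n. distr M borel (W n)) \<nu>" and \<nu>: "real_distribution \<nu>"
  shows "weak_conv_m (\<lambda>n. distr M borel (V n)) \<nu>"
proof -
  define V' where "V' n = (if n = 0 then W 0 else V n)" for n
  have V'[measurable]: "V' n \<in> borel_measurable M" for n using V W by (auto simp: V'_def)
  have rd: "real_distribution (distr M borel (V' n))" "real_distribution (distr M borel (W n))" for n
    using W by (auto intro!: real_distribution_distr)
  have "weak_conv_m (\<lambda>n. distr M borel (V' n)) \<nu>"
    unfolding weakly_converges_real_iff[OF rd(1) \<nu>, symmetric] weakly_converges_def
  proof (intro allI impI)
    fix f :: "real \<Rightarrow> real" assume f: "continuous_on UNIV f" "bounded (range f)"
    note [measurable] = borel_measurable_continuous_onI[OF f(1)] W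
    have "(\<lambda>n. \<integral>x. f x \<partial>distr M borel (W n)) \<longlonglongrightarrow> \<integral>x. f x \<partial>\<nu>"
      using lim f unfolding weakly_converges_real_iff[OF rd(2) \<nu>, symmetric] weakly_converges_def by blast
    moreover have "vanishes_in_prob (\<lambda>n \<omega>. V' n \<omega> - W n \<omega>)"
      by (rule vanishes_in_prob_mono[OF close]) (auto simp: V'_def)
    ultimately show "(\<lambda>n. \<integral>x. f x \<partial>distr M borel (V' n)) \<longlonglongrightarrow> \<integral>x. f x \<partial>\<nu>"
      using bounded_continuous_Slutsky[of V' W, OF V' W _ tight f]
      by (auto simp: integral_distr intro: Lim_transform)
  qed
  then show ?thesis
    unfolding weak_conv_m_def weak_conv_def
    by (auto simp: V'_def elim!: Lim_transform_eventually
        intro!: eventually_mono[OF eventually_gt_at_top[of "0::nat"]])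
qed

end

section \<open>Martingale transforms of a centred noise\<close>

lemma cmod_iexp_quadratic: "cmod (iexp x - (1 + \<i> * x - x\<^sup>2 / 2)) \<le> \<bar>x\<bar> ^ 3 / 6"
proof -
  have *: "(\<Sum>k\<le>2. (\<i> * complex_of_real x) ^ k / fact k) = 1 + \<i> * x - x\<^sup>2 / 2"
    unfolding numeral_2_eq_2 atMost_Suc by (simp add: numeral_2_eq_2[symmetric] power_mult_distrib)
  have "Suc 2 = 3" "fact 3 = (6::real)" by (simp_all add: fact_numeral)
  then show ?thesis using iexp_approx1[of x 2] unfolding * by simp
qed

lemma cmod_iexp_minus_one: "cmod (iexp x - 1) \<le> \<bar>x\<bar>"
  using iexp_approx1[of x 0] by simp

lemma abs_exp_minus_linear:
  fixes x :: real assumes "0 \<le> x" shows "\<bar>(1 - x) - exp (- x)\<bar> \<le> x\<^sup>2 / 2"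
proof -
  have "(1 + x + x\<^sup>2/2) * (1 - x + x\<^sup>2/2) = 1 + (x\<^sup>2)\<^sup>2 / 4"
    by (simp add: power2_eq_square algebra_simps)
  moreover have "0 \<le> 1 - x + x\<^sup>2/2"
    using zero_le_power2[of "x - 1"] by (simp add: power2_eq_square algebra_simps)
  ultimately have "1 \<le> exp x * (1 - x + x\<^sup>2/2)"
    using mult_right_mono[OF exp_lower_Taylor_quadratic[OF assms], of "1 - x + x\<^sup>2/2"]
      zero_le_power2[of "x\<^sup>2"] by linarith
  then have "exp (- x) \<le> 1 - x + x\<^sup>2/2"
    by (simp add: exp_minus field_simps)
  moreover have "1 - x \<le> exp (- x)" using exp_ge_add_one_self[of "- x"] by simp
  ultimately show ?thesis by (simp add: abs_if)
qed

definition prev :: "(nat \<Rightarrow> real) \<Rightarrow> nat \<Rightarrow> real" where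
  "prev x j = (if j = 0 then 0 else x (j - 1))"

definition coef :: "(nat \<Rightarrow> real) \<Rightarrow> (nat \<Rightarrow> real) \<Rightarrow> nat \<Rightarrow> (nat \<Rightarrow> real) \<Rightarrow> real" where
  "coef a b j x = a j + b j * prev x j"

text \<open>
  The sums \<open>\<Sum>\<^sub>j (a\<^sub>j + b\<^sub>j x\<^sub>j\<^sub>-\<^sub>1) x\<^sub>j\<close>. Evaluated at a centred independent noise they are martingale
  transforms, and every leading term of the CLS estimator has this form. They are defined as functionals
  of a sequence, so that dependence on the first \<open>k\<close> noise variables only becomes invariance under
  restriction to \<open>{..<k}\<close>.
\<close>

definition martingale_transform :: "(nat \<Rightarrow> real) \<Rightarrow> (nat \<Rightarrow> real) \<Rightarrow> nat \<Rightarrow> (nat \<Rightarrow> real) \<Rightarrow> real" where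
  "martingale_transform a b n x = (\<Sum>j<n. coef a b j x * x j)"

lemma prev_measurable: "j \<le> k \<Longrightarrow> (\<lambda>x. prev x j) \<in> borel_measurable (PiM {..<k} (\<lambda>_. borel))"
  by (cases j) (auto simp: prev_def intro!: measurable_component_singleton)

lemma prev_restrict: "j \<le> k \<Longrightarrow> prev (restrict x {..<k}) j = prev x j"
  by (cases j) (auto simp: prev_def)

lemma coef_measurable: "j \<le> k \<Longrightarrow> coef a b j \<in> borel_measurable (PiM {..<k} (\<lambda>_. borel))"
  unfolding coef_def[abs_def]
  by (intro borel_measurable_add borel_measurable_times prev_measurable borel_measurable_const)

lemma coef_restrict: "j \<le> k \<Longrightarrow> coef a b j (restrict x {..<k}) = coef a b j x"
  by (simp add: coef_def prev_restrict)

lemma transform_measurable: "j \<le> k \<Longrightarrow> martingale_transform a b j \<in> borel_measurable (PiM {..<k} (\<lambda>_. borel))"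
  unfolding martingale_transform_def[abs_def]
  by (intro borel_measurable_sum borel_measurable_times coef_measurable)
     (auto intro!: measurable_component_singleton)

lemma transform_restrict: "j \<le> k \<Longrightarrow> martingale_transform a b j (restrict x {..<k}) = martingale_transform a b j x"
  by (auto simp: martingale_transform_def coef_restrict intro!: sum.cong)

lemma transform_Suc: "martingale_transform a b (Suc n) x = martingale_transform a b n x + coef a b n x * x n"
  by (simp add: martingale_transform_def)

lemma abs_power_le_one_plus:
  fixes x :: real assumes "i \<le> 4" shows "\<bar>x\<bar> ^ i \<le> 1 + x ^ 4"
proof (cases "\<bar>x\<bar> \<le> 1")
  case True
  then have "\<bar>x\<bar> ^ i \<le> 1" by (simp add: power_le_one)
  moreover have "0 \<le> x ^ 4" by simp
  ultimately show ?thesis by linarith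
next
  case False
  then have "\<bar>x\<bar> ^ i \<le> \<bar>x\<bar> ^ 4" using assms by (intro power_increasing) auto
  then show ?thesis by (simp add: power_even_abs)
qed

locale centred_noise = prob_space M for M :: "'a measure" +
  fixes e :: "nat \<Rightarrow> 'a \<Rightarrow> real" and v \<kappa> :: real
  assumes indep: "indep_vars (\<lambda>_. borel) e UNIV"
    and mean_zero: "\<And>k. expectation (e k) = 0"
    and second_moment: "\<And>k. expectation (\<lambda>\<omega>. (e k \<omega>)\<^sup>2) = v"
    and integrable_fourth: "\<And>k. integrable M (\<lambda>\<omega>. e k \<omega> ^ 4)"
    and fourth_moment: "\<And>k. expectation (\<lambda>\<omega>. e k \<omega> ^ 4) \<le> \<kappa>"
begin

abbreviation noise_path :: "'a \<Rightarrow> nat \<Rightarrow> real" where "noise_path \<omega> \<equiv> \<lambda>j. e j \<omega>"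

lemma e_measurable[measurable]: "e k \<in> borel_measurable M"
  using indep by (auto simp: indep_vars_def)

lemma integrable_abs_power: "i \<le> 4 \<Longrightarrow> integrable M (\<lambda>\<omega>. \<bar>e k \<omega>\<bar> ^ i)"
  by (rule Bochner_Integration.integrable_bound[of M "\<lambda>\<omega>. 1 + e k \<omega> ^ 4"])
     (use integrable_fourth abs_power_le_one_plus in \<open>auto intro!: AE_I2 simp: abs_of_nonneg\<close>)

lemma integrable_power: "i \<le> 4 \<Longrightarrow> integrable M (\<lambda>\<omega>. e k \<omega> ^ i)"
  using integrable_abs_power[of i k] integrable_norm_iff[of "\<lambda>\<omega>. e k \<omega> ^ i" M]
  by (simp add: power_abs)

lemma integrable_e: "integrable M (e k)"
  using integrable_power[of 1 k] by simp

lemma integrable_e_square: "integrable M (\<lambda>\<omega>. (e k \<omega>)\<^sup>2)"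
  by (rule integrable_power) simp

lemma v_nonneg: "0 \<le> v"
proof -
  have "0 \<le> expectation (\<lambda>\<omega>. (e 0 \<omega>)\<^sup>2)" by (rule integral_nonneg_AE) simp
  then show ?thesis by (simp add: second_moment)
qed

lemma kappa_nonneg: "0 \<le> \<kappa>"
proof -
  have "0 \<le> expectation (\<lambda>\<omega>. e 0 \<omega> ^ 4)" by (rule integral_nonneg_AE) simp
  then show ?thesis using fourth_moment[of 0] by linarith
qed

text \<open>
  Independence of the present from the past: \<open>g\<close> reads the noise before time \<open>k\<close> only. This single
  factorisation replaces conditional expectations in all that follows.
\<close>

lemma past_independent:
  fixes g :: "(nat \<Rightarrow> real) \<Rightarrow> 'b::{real_normed_field, banach, second_countable_topology}"
    and f :: "real \<Rightarrow> 'b"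
  assumes g: "g \<in> borel_measurable (PiM {..<k} (\<lambda>_. borel))"
    and g_past: "\<And>x. g (restrict x {..<k}) = g x"
    and f: "f \<in> borel_measurable borel"
    and ig: "integrable M (\<lambda>\<omega>. g (noise_path \<omega>))" and if': "integrable M (\<lambda>\<omega>. f (e k \<omega>))"
  shows expectation_past_mult: "(\<integral>\<omega>. g (noise_path \<omega>) * f (e k \<omega>) \<partial>M) = (\<integral>\<omega>. g (noise_path \<omega>) \<partial>M) * (\<integral>\<omega>. f (e k \<omega>) \<partial>M)"
    and integrable_past_mult: "integrable M (\<lambda>\<omega>. g (noise_path \<omega>) * f (e k \<omega>))"
proof -
  have "indep_var (PiM {..<k} (\<lambda>_. borel)) (\<lambda>\<omega>. restrict (\<lambda>i. e i \<omega>) {..<k})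
      (PiM {k} (\<lambda>_. borel)) (\<lambda>\<omega>. restrict (\<lambda>i. e i \<omega>) {k})"
    by (rule indep_var_restrict[OF indep]) auto
  moreover have "(\<lambda>x. f (x k)) \<in> borel_measurable (PiM {k} (\<lambda>_. borel))"
    by (rule measurable_compose[OF _ f]) (simp add: measurable_component_singleton)
  ultimately have "indep_var borel (g \<circ> (\<lambda>\<omega>. restrict (\<lambda>i. e i \<omega>) {..<k}))
      borel ((\<lambda>x. f (x k)) \<circ> (\<lambda>\<omega>. restrict (\<lambda>i. e i \<omega>) {k}))"
    using g by (intro indep_var_compose)
  then have "indep_var borel (\<lambda>\<omega>. g (noise_path \<omega>)) borel (\<lambda>\<omega>. f (e k \<omega>))"
    by (simp add: comp_def g_past)
  from indep_var_lebesgue_integral[OF this ig if'] indep_var_integrable[OF this ig if']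
  show "(\<integral>\<omega>. g (noise_path \<omega>) * f (e k \<omega>) \<partial>M) = (\<integral>\<omega>. g (noise_path \<omega>) \<partial>M) * (\<integral>\<omega>. f (e k \<omega>) \<partial>M)"
    "integrable M (\<lambda>\<omega>. g (noise_path \<omega>) * f (e k \<omega>))" .
qed

lemma prev_path_measurable[measurable]: "(\<lambda>\<omega>. prev (noise_path \<omega>) j) \<in> borel_measurable M"
  by (cases j) (simp_all add: prev_def)

lemma coef_path_measurable[measurable]: "(\<lambda>\<omega>. coef a b j (noise_path \<omega>)) \<in> borel_measurable M"
  unfolding coef_def by measurable

lemma transform_path_measurable[measurable]: "(\<lambda>\<omega>. martingale_transform a b n (noise_path \<omega>)) \<in> borel_measurable M"
  unfolding martingale_transform_def by measurable

lemma integrable_prev_power: "i \<le> 4 \<Longrightarrow> integrable M (\<lambda>\<omega>. prev (noise_path \<omega>) k ^ i)"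
  by (cases k) (simp_all add: prev_def integrable_power)

lemma integrable_prev: "integrable M (\<lambda>\<omega>. prev (noise_path \<omega>) k)"
  using integrable_prev_power[of 1 k] by simp

lemma expectation_prev: "expectation (\<lambda>\<omega>. prev (noise_path \<omega>) k) = 0"
  by (cases k) (simp_all add: prev_def mean_zero)

lemma expectation_prev_square: "expectation (\<lambda>\<omega>. (prev (noise_path \<omega>) k)\<^sup>2) = (if k = 0 then 0 else v)"
  by (cases k) (simp_all add: prev_def second_moment)

lemma expectation_prev_fourth: "expectation (\<lambda>\<omega>. prev (noise_path \<omega>) k ^ 4) \<le> \<kappa>"
  by (cases k) (simp_all add: prev_def fourth_moment kappa_nonneg)

lemma coef_square: "(coef a b k x)\<^sup>2 = (a k)\<^sup>2 + 2 * a k * b k * prev x k + (b k)\<^sup>2 * (prev x k)\<^sup>2"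
  by (simp add: coef_def power2_eq_square algebra_simps)

lemma integrable_coef: "integrable M (\<lambda>\<omega>. coef a b k (noise_path \<omega>))"
  unfolding coef_def using integrable_prev by auto

lemma integrable_coef_square: "integrable M (\<lambda>\<omega>. (coef a b k (noise_path \<omega>))\<^sup>2)"
  unfolding coef_square using integrable_prev integrable_prev_power[of 2] by auto

lemma expectation_coef_square:
  assumes "b 0 = 0"
  shows "expectation (\<lambda>\<omega>. (coef a b k (noise_path \<omega>))\<^sup>2) = (a k)\<^sup>2 + (b k)\<^sup>2 * v"
  unfolding coef_square using integrable_prev integrable_prev_power[of 2 k] assms
  by (cases "k = 0") (auto simp: expectation_prev expectation_prev_square prob_space)

lemma second_moment_increment:
  assumes "b 0 = 0"
  shows "integrable M (\<lambda>\<omega>. (coef a b k (noise_path \<omega>) * e k \<omega>)\<^sup>2)"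
    and "expectation (\<lambda>\<omega>. (coef a b k (noise_path \<omega>) * e k \<omega>)\<^sup>2) = v * ((a k)\<^sup>2 + (b k)\<^sup>2 * v)"
proof -
  note p = past_independent[of "\<lambda>x. (coef a b k x)\<^sup>2" k "\<lambda>x. x\<^sup>2"]
  have *: "(\<lambda>x. (coef a b k x)\<^sup>2) \<in> borel_measurable (PiM {..<k} (\<lambda>_. borel))"
    by (intro borel_measurable_power coef_measurable) simp
  show "integrable M (\<lambda>\<omega>. (coef a b k (noise_path \<omega>) * e k \<omega>)\<^sup>2)"
    unfolding power_mult_distrib
    by (rule p(2)[OF *]) (auto simp: coef_restrict integrable_coef_square integrable_e_square)
  show "expectation (\<lambda>\<omega>. (coef a b k (noise_path \<omega>) * e k \<omega>)\<^sup>2) = v * ((a k)\<^sup>2 + (b k)\<^sup>2 * v)"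
    unfolding power_mult_distrib
    by (subst p(1)[OF *]) (auto simp: coef_restrict integrable_coef_square integrable_e_square
       expectation_coef_square[of b] second_moment assms)
qed

text \<open>
  Orthogonality of martingale increments: the cross term of the past sum and the next increment
  contains the factor \<open>E e\<^sub>n = 0\<close>.
\<close>

lemma second_moment_transform:
  assumes "b 0 = 0"
  shows "integrable M (\<lambda>\<omega>. (martingale_transform a b n (noise_path \<omega>))\<^sup>2) \<and>
    expectation (\<lambda>\<omega>. (martingale_transform a b n (noise_path \<omega>))\<^sup>2) = v * (\<Sum>j<n. (a j)\<^sup>2 + (b j)\<^sup>2 * v)"
proof (induction n)
  case 0 then show ?case by (simp add: martingale_transform_def)
next
  case (Suc n)
  define g where "g x = martingale_transform a b n x * coef a b n x" for x
  have g: "g \<in> borel_measurable (PiM {..<n} (\<lambda>_. borel))"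
    unfolding g_def[abs_def] by (intro borel_measurable_times coef_measurable transform_measurable) auto
  have gr: "g (restrict x {..<n}) = g x" for x
    by (simp add: g_def coef_restrict transform_restrict)
  have ig: "integrable M (\<lambda>\<omega>. g (noise_path \<omega>))"
    unfolding g_def
  proof (rule Bochner_Integration.integrable_bound)
    show "integrable M (\<lambda>\<omega>. (martingale_transform a b n (noise_path \<omega>))\<^sup>2 + (coef a b n (noise_path \<omega>))\<^sup>2)"
      using Suc integrable_coef_square by auto
    show "AE \<omega> in M. norm (martingale_transform a b n (noise_path \<omega>) * coef a b n (noise_path \<omega>))
        \<le> norm ((martingale_transform a b n (noise_path \<omega>))\<^sup>2 + (coef a b n (noise_path \<omega>))\<^sup>2)"
    proof (rule AE_I2)
      fix \<omega>
      have "2 * \<bar>x * y\<bar> \<le> x\<^sup>2 + y\<^sup>2" for x y :: real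
        using sum_squares_bound[of "\<bar>x\<bar>" "\<bar>y\<bar>"] by (simp add: abs_mult)
      from this[of "martingale_transform a b n (noise_path \<omega>)" "coef a b n (noise_path \<omega>)"]
      show "norm (martingale_transform a b n (noise_path \<omega>) * coef a b n (noise_path \<omega>))
        \<le> norm ((martingale_transform a b n (noise_path \<omega>))\<^sup>2 + (coef a b n (noise_path \<omega>))\<^sup>2)" by simp
    qed
  qed measurable
  note cross = past_independent[OF g gr measurable_ident[unfolded id_def] ig integrable_e[of n], unfolded mean_zero]
  have eq: "(martingale_transform a b (Suc n) x)\<^sup>2 = (martingale_transform a b n x)\<^sup>2 + 2 * (g x * x n) + (coef a b n x * x n)\<^sup>2" for x
    by (simp add: transform_Suc g_def power2_eq_square algebra_simps)
  show ?case
    unfolding eq using Suc cross second_moment_increment[where b = b and a = a and k = n, OF assms]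
    by (simp add: algebra_simps)
qed

end

section \<open>A central limit theorem for martingale transforms\<close>

lemma real_distribution_normal_law: "0 \<le> w \<Longrightarrow> real_distribution (normal_law m w)"
  by (auto simp: normal_law_def real_distribution_def real_distribution_axioms_def
      intro!: prob_space_return prob_space_normal_density)

lemma char_normal_law:
  assumes "0 \<le> w"
  shows "char (normal_law 0 w) t = exp (- (t\<^sup>2 * w / 2))"
proof (cases "w = 0")
  case True
  then show ?thesis by (simp add: normal_law_def char_def integral_return)
next
  case False
  with assms have w: "0 < w" by simp
  interpret std: prob_space std_normal_distribution by (rule prob_space_normal_density) simp
  have "distributed std_normal_distribution lborel (\<lambda>x. x) std_normal_density"
    by (auto simp: distributed_def distr_id2)
  from std.normal_density_affine[OF this, of "sqrt w" 0]
  have "distributed std_normal_distribution lborel (\<lambda>x. sqrt w * x) (normal_density 0 (sqrt w))"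
    using w by simp
  then have *: "normal_law 0 w = distr std_normal_distribution borel (\<lambda>x. sqrt w * x)"
    using w distr_cong[of std_normal_distribution std_normal_distribution lborel borel "\<lambda>x. sqrt w * x"]
    by (simp add: normal_law_def distributed_def)
  have "char (normal_law 0 w) t = char std_normal_distribution (t * sqrt w)"
    unfolding * char_def by (subst integral_distr) (auto simp: algebra_simps)
  then show ?thesis using w by (simp add: char_std_normal_distribution power_mult_distrib)
qed

context centred_noise
begin

text \<open>
  All increments \<open>(a\<^sub>k + b\<^sub>k e\<^sub>k\<^sub>-\<^sub>1) e\<^sub>k\<close> with weights at most \<open>h\<close> are dominated by \<open>h y\<^sub>k\<close>, and the fourth
  moment of \<open>y\<^sub>k\<close> factorises by independence of consecutive noise variables.
\<close>

lemma fourth_power_increment: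
  defines "y \<equiv> \<lambda>k \<omega>. (1 + \<bar>prev (noise_path \<omega>) k\<bar>) * \<bar>e k \<omega>\<bar>"
  shows "integrable M (\<lambda>\<omega>. y k \<omega> ^ 4)" and "expectation (\<lambda>\<omega>. y k \<omega> ^ 4) \<le> 8 * (1 + \<kappa>) * \<kappa>"
proof -
  let ?g = "\<lambda>x. (1 + \<bar>prev x k\<bar>) ^ 4"
  have g: "?g \<in> borel_measurable (PiM {..<k} (\<lambda>_. borel))"
    by (intro borel_measurable_power borel_measurable_add borel_measurable_abs prev_measurable) auto
  have gr: "?g (restrict x {..<k}) = ?g x" for x by (simp add: prev_restrict)
  have le: "(1 + \<bar>r\<bar>) ^ 4 \<le> 8 * (1 + r ^ 4)" for r :: real
  proof -
    have "(1 + \<bar>r\<bar>)\<^sup>2 \<le> 2 * (1 + r\<^sup>2)"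
      using zero_le_power2[of "1 - \<bar>r\<bar>"] by (simp add: power2_eq_square algebra_simps)
    then have "((1 + \<bar>r\<bar>)\<^sup>2)\<^sup>2 \<le> (2 * (1 + r\<^sup>2))\<^sup>2"
      by (intro power_mono) auto
    also have "\<dots> \<le> 8 * (1 + (r\<^sup>2)\<^sup>2)"
      using zero_le_power2[of "1 - r\<^sup>2"] by (simp add: power2_eq_square algebra_simps)
    finally show ?thesis by (simp add: power_mult[symmetric])
  qed
  have i4: "integrable M (\<lambda>\<omega>. 8 * (1 + prev (noise_path \<omega>) k ^ 4))"
    using integrable_prev_power[of 4 k] by simp
  have ig: "integrable M (\<lambda>\<omega>. ?g (noise_path \<omega>))"
    by (rule Bochner_Integration.integrable_bound[OF i4])
       (use le in \<open>auto intro!: AE_I2 simp: abs_of_nonneg\<close>)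
  have ile: "expectation (\<lambda>\<omega>. ?g (noise_path \<omega>)) \<le> 8 * (1 + \<kappa>)"
  proof -
    have "expectation (\<lambda>\<omega>. ?g (noise_path \<omega>)) \<le> expectation (\<lambda>\<omega>. 8 * (1 + prev (noise_path \<omega>) k ^ 4))"
      by (rule integral_mono[OF ig i4 le])
    also have "\<dots> = 8 * (1 + expectation (\<lambda>\<omega>. prev (noise_path \<omega>) k ^ 4))"
      using integrable_prev_power[of 4 k] by (simp add: prob_space)
    finally show ?thesis using expectation_prev_fourth[of k] by simp
  qed
  have eq: "y k \<omega> ^ 4 = ?g (noise_path \<omega>) * e k \<omega> ^ 4" for \<omega>
    by (simp add: y_def power_mult_distrib power_even_abs)
  have p1: "expectation (\<lambda>\<omega>. ?g (noise_path \<omega>) * e k \<omega> ^ 4) = expectation (\<lambda>\<omega>. ?g (noise_path \<omega>)) * expectation (\<lambda>\<omega>. e k \<omega> ^ 4)"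
    by (rule past_independent(1)[where f="\<lambda>x. x^4", OF g gr _ ig integrable_fourth]) simp
  show "integrable M (\<lambda>\<omega>. y k \<omega> ^ 4)"
    unfolding eq by (rule past_independent(2)[where f="\<lambda>x. x^4", OF g gr _ ig integrable_fourth]) simp
  have "expectation (\<lambda>\<omega>. y k \<omega> ^ 4) = expectation (\<lambda>\<omega>. ?g (noise_path \<omega>)) * expectation (\<lambda>\<omega>. e k \<omega> ^ 4)"
    unfolding eq by (rule p1)
  also have "\<dots> \<le> (8 * (1 + \<kappa>)) * \<kappa>"
    by (intro mult_mono ile fourth_moment integral_nonneg_AE) (use kappa_nonneg in auto)
  finally show "expectation (\<lambda>\<omega>. y k \<omega> ^ 4) \<le> 8 * (1 + \<kappa>) * \<kappa>" .
qed

definition cubic_const :: real where "cubic_const = 1 + 8 * (1 + \<kappa>) * \<kappa>"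
definition excess_const :: real where "excess_const = cubic_const + 12 + 15 * \<kappa> + 3 * v\<^sup>2"

lemma abs_coef_le:
  assumes "\<bar>a k\<bar> \<le> h" "\<bar>b k\<bar> \<le> h"
  shows "\<bar>coef a b k x\<bar> \<le> h * (1 + \<bar>prev x k\<bar>)"
proof -
  have "\<bar>coef a b k x\<bar> \<le> \<bar>a k\<bar> + \<bar>b k\<bar> * \<bar>prev x k\<bar>"
    unfolding coef_def by (metis abs_mult abs_triangle_ineq)
  also have "\<dots> \<le> h + h * \<bar>prev x k\<bar>" using assms by (intro add_mono mult_right_mono) auto
  finally show ?thesis by (simp add: algebra_simps)
qed

lemma third_moment_increment:
  assumes "\<bar>a k\<bar> \<le> h" "\<bar>b k\<bar> \<le> h"
  shows "integrable M (\<lambda>\<omega>. \<bar>coef a b k (noise_path \<omega>) * e k \<omega>\<bar> ^ 3)"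
    and "expectation (\<lambda>\<omega>. \<bar>coef a b k (noise_path \<omega>) * e k \<omega>\<bar> ^ 3) \<le> h ^ 3 * cubic_const"
proof -
  define y where "y \<omega> = (1 + \<bar>prev (noise_path \<omega>) k\<bar>) * \<bar>e k \<omega>\<bar>" for \<omega>
  have h: "0 \<le> h" using assms by linarith
  have y: "integrable M (\<lambda>\<omega>. y \<omega> ^ 4)" "expectation (\<lambda>\<omega>. y \<omega> ^ 4) \<le> 8 * (1 + \<kappa>) * \<kappa>"
    using fourth_power_increment[of k] by (simp_all add: y_def)
  have i: "integrable M (\<lambda>\<omega>. h ^ 3 * (1 + y \<omega> ^ 4))" using y by simp
  have le: "\<bar>coef a b k (noise_path \<omega>) * e k \<omega>\<bar> ^ 3 \<le> h ^ 3 * (1 + y \<omega> ^ 4)" for \<omega>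
  proof -
    have "\<bar>coef a b k (noise_path \<omega>) * e k \<omega>\<bar> \<le> h * y \<omega>"
      unfolding abs_mult y_def mult.assoc[symmetric]
      by (intro mult_right_mono abs_coef_le assms) auto
    then have "\<bar>coef a b k (noise_path \<omega>) * e k \<omega>\<bar> ^ 3 \<le> h ^ 3 * y \<omega> ^ 3"
      unfolding power_mult_distrib[symmetric] by (intro power_mono) auto
    also have "\<dots> \<le> h ^ 3 * (1 + y \<omega> ^ 4)"
      using abs_power_le_one_plus[of 3 "y \<omega>"] h
      by (intro mult_left_mono) (auto simp: y_def abs_of_nonneg)
    finally show ?thesis .
  qed
  show int: "integrable M (\<lambda>\<omega>. \<bar>coef a b k (noise_path \<omega>) * e k \<omega>\<bar> ^ 3)"
    by (rule Bochner_Integration.integrable_bound[OF i])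
       (use le in \<open>auto intro!: AE_I2 intro: order_trans[OF le abs_ge_self]\<close>)
  have "expectation (\<lambda>\<omega>. \<bar>coef a b k (noise_path \<omega>) * e k \<omega>\<bar> ^ 3) \<le> expectation (\<lambda>\<omega>. h ^ 3 * (1 + y \<omega> ^ 4))"
    by (rule integral_mono[OF int i le])
  also have "\<dots> = h ^ 3 * (1 + expectation (\<lambda>\<omega>. y \<omega> ^ 4))" using y by (simp add: prob_space)
  also have "\<dots> \<le> h ^ 3 * cubic_const" using y h by (intro mult_left_mono) (auto simp: cubic_const_def)
  finally show "expectation (\<lambda>\<omega>. \<bar>coef a b k (noise_path \<omega>) * e k \<omega>\<bar> ^ 3) \<le> h ^ 3 * cubic_const" .
qed

text \<open>
  By how much the conditional variance factor \<open>(a\<^sub>k + b\<^sub>k r)\<^sup>2\<close> of the next increment, given that the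
  preceding noise variable equals \<open>r\<close>, exceeds its mean \<open>a\<^sub>k\<^sup>2 + b\<^sub>k\<^sup>2 v\<close>.
\<close>

definition excess :: "(nat \<Rightarrow> real) \<Rightarrow> (nat \<Rightarrow> real) \<Rightarrow> nat \<Rightarrow> real \<Rightarrow> real" where
  "excess a b k r = 2 * a k * b k * r + (b k)\<^sup>2 * (r\<^sup>2 - v)"

lemma excess_moments:
  assumes "\<bar>a (Suc m)\<bar> \<le> h" "\<bar>b (Suc m)\<bar> \<le> h" "\<bar>a m\<bar> \<le> h" "\<bar>b m\<bar> \<le> h"
  shows "integrable M (\<lambda>\<omega>. excess a b (Suc m) (e m \<omega>))"
    and "expectation (\<lambda>\<omega>. excess a b (Suc m) (e m \<omega>)) = 0"
    and "integrable M (\<lambda>\<omega>. \<bar>coef a b m (noise_path \<omega>) * e m \<omega>\<bar> * \<bar>excess a b (Suc m) (e m \<omega>)\<bar>)"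
    and "expectation (\<lambda>\<omega>. \<bar>coef a b m (noise_path \<omega>) * e m \<omega>\<bar> * \<bar>excess a b (Suc m) (e m \<omega>)\<bar>) \<le> h ^ 3 * excess_const"
proof -
  define y where "y \<omega> = (1 + \<bar>prev (noise_path \<omega>) m\<bar>) * \<bar>e m \<omega>\<bar>" for \<omega>
  define q where "q = excess a b (Suc m)"
  have [measurable]: "q \<in> borel_measurable borel" by (simp add: q_def excess_def[abs_def])
  have h: "0 \<le> h" using assms by linarith
  show "integrable M (\<lambda>\<omega>. excess a b (Suc m) (e m \<omega>))"
    unfolding excess_def using integrable_e integrable_e_square by auto
  show "expectation (\<lambda>\<omega>. excess a b (Suc m) (e m \<omega>)) = 0"
    unfolding excess_def using integrable_e[of m] integrable_e_square[of m]
    by (simp add: mean_zero second_moment prob_space)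
  have y: "integrable M (\<lambda>\<omega>. y \<omega> ^ 4)" "expectation (\<lambda>\<omega>. y \<omega> ^ 4) \<le> 8 * (1 + \<kappa>) * \<kappa>"
    using fourth_power_increment[of m] by (simp_all add: y_def)
  let ?B = "\<lambda>\<omega>. h ^ 3 * ((1 + y \<omega> ^ 4) + (12 + 15 * e m \<omega> ^ 4 + 3 * v\<^sup>2))"
  have i: "integrable M ?B" using y integrable_fourth[of m] by simp
  have le: "\<bar>coef a b m (noise_path \<omega>) * e m \<omega>\<bar> * \<bar>q (e m \<omega>)\<bar> \<le> ?B \<omega>" for \<omega>
  proof -
    define r where "r = \<bar>e m \<omega>\<bar>"
    define z where "z = 2 * r + r\<^sup>2 + v"
    have z0: "0 \<le> z" using v_nonneg by (simp add: z_def r_def)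
    have y0: "0 \<le> y \<omega>" by (simp add: y_def)
    have 1: "\<bar>coef a b m (noise_path \<omega>) * e m \<omega>\<bar> \<le> h * y \<omega>"
      unfolding abs_mult y_def mult.assoc[symmetric]
      by (intro mult_right_mono abs_coef_le assms) auto
    have ab: "\<bar>a (Suc m) * b (Suc m)\<bar> \<le> h\<^sup>2"
      using assms h unfolding abs_mult power2_eq_square by (intro mult_mono) auto
    have bb: "(b (Suc m))\<^sup>2 \<le> h\<^sup>2" using assms(2) by (simp add: abs_le_square_iff[symmetric] h)
    have "\<bar>q (e m \<omega>)\<bar> \<le> \<bar>2 * a (Suc m) * b (Suc m) * e m \<omega>\<bar> + \<bar>(b (Suc m))\<^sup>2 * ((e m \<omega>)\<^sup>2 - v)\<bar>"
      unfolding q_def excess_def by (rule abs_triangle_ineq)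
    also have "\<dots> = \<bar>a (Suc m) * b (Suc m)\<bar> * (2 * r) + (b (Suc m))\<^sup>2 * \<bar>(e m \<omega>)\<^sup>2 - v\<bar>"
      by (simp add: abs_mult r_def)
    also have "\<dots> \<le> h\<^sup>2 * (2 * r) + h\<^sup>2 * (r\<^sup>2 + v)"
      using v_nonneg zero_le_power2[of "e m \<omega>"]
      by (intro add_mono mult_mono ab bb) (auto simp: r_def abs_if)
    also have "\<dots> = h\<^sup>2 * z" by (simp add: z_def algebra_simps)
    finally have 2: "\<bar>q (e m \<omega>)\<bar> \<le> h\<^sup>2 * z" .
    have 3: "z\<^sup>2 \<le> 12 + 15 * e m \<omega> ^ 4 + 3 * v\<^sup>2"
    proof -
      have "z\<^sup>2 \<le> 3 * ((2 * r)\<^sup>2 + (r\<^sup>2)\<^sup>2 + v\<^sup>2)"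
      proof -
        have "0 \<le> (2 * r - r\<^sup>2)\<^sup>2 + (2 * r - v)\<^sup>2 + (r\<^sup>2 - v)\<^sup>2" by simp
        also have "\<dots> = 3 * ((2 * r)\<^sup>2 + (r\<^sup>2)\<^sup>2 + v\<^sup>2) - z\<^sup>2"
          by (simp add: z_def power2_eq_square algebra_simps)
        finally show ?thesis by simp
      qed
      moreover have "(r\<^sup>2)\<^sup>2 = e m \<omega> ^ 4" by (simp add: r_def power_mult[symmetric] power_even_abs)
      moreover have "r\<^sup>2 \<le> 1 + e m \<omega> ^ 4" using abs_power_le_one_plus[of 2 "e m \<omega>"] by (simp add: r_def)
      ultimately show ?thesis by (simp add: power_mult_distrib)
    qed
    have "\<bar>coef a b m (noise_path \<omega>) * e m \<omega>\<bar> * \<bar>q (e m \<omega>)\<bar> \<le> (h * y \<omega>) * (h\<^sup>2 * z)"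
      using 1 2 y0 h by (intro mult_mono) auto
    also have "\<dots> = h ^ 3 * (y \<omega> * z)" by (simp add: power2_eq_square power3_eq_cube)
    also have "\<dots> \<le> h ^ 3 * ((y \<omega>)\<^sup>2 + z\<^sup>2)"
    proof (intro mult_left_mono)
      show "y \<omega> * z \<le> (y \<omega>)\<^sup>2 + z\<^sup>2"
        using sum_squares_bound[of "y \<omega>" z] mult_nonneg_nonneg[OF y0 z0] by linarith
    qed (use h in simp)
    also have "\<dots> \<le> ?B \<omega>"
    proof (intro mult_left_mono add_mono 3)
      show "(y \<omega>)\<^sup>2 \<le> 1 + y \<omega> ^ 4" using abs_power_le_one_plus[of 2 "y \<omega>"] by simp
    qed (use h in simp)
    finally show ?thesis .
  qed
  show int: "integrable M (\<lambda>\<omega>. \<bar>coef a b m (noise_path \<omega>) * e m \<omega>\<bar> * \<bar>excess a b (Suc m) (e m \<omega>)\<bar>)"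
    unfolding q_def[symmetric]
  proof (rule Bochner_Integration.integrable_bound[OF i])
    show "AE \<omega> in M. norm (\<bar>coef a b m (noise_path \<omega>) * e m \<omega>\<bar> * \<bar>q (e m \<omega>)\<bar>) \<le> norm (?B \<omega>)"
      unfolding real_norm_def abs_mult abs_idempotent
      by (rule AE_I2) (rule order_trans[OF le[unfolded abs_mult] abs_ge_self, unfolded abs_mult])
  qed measurable
  have "expectation (\<lambda>\<omega>. \<bar>coef a b m (noise_path \<omega>) * e m \<omega>\<bar> * \<bar>q (e m \<omega>)\<bar>) \<le> expectation ?B"
    by (rule integral_mono[OF int[folded q_def] i le])
  also have "\<dots> = h ^ 3 * (1 + expectation (\<lambda>\<omega>. y \<omega> ^ 4) + (12 + 15 * expectation (\<lambda>\<omega>. e m \<omega> ^ 4) + 3 * v\<^sup>2))"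
    using y integrable_fourth[of m] by (simp add: prob_space)
  also have "\<dots> \<le> h ^ 3 * excess_const"
    using y fourth_moment[of m] h by (intro mult_left_mono) (auto simp: cubic_const_def excess_const_def)
  finally show "expectation (\<lambda>\<omega>. \<bar>coef a b m (noise_path \<omega>) * e m \<omega>\<bar> * \<bar>excess a b (Suc m) (e m \<omega>)\<bar>) \<le> h ^ 3 * excess_const"
    unfolding q_def .
qed

lemma transform_exp_measurable:
  "(\<lambda>x. iexp (t * martingale_transform a b k x)) \<in> borel_measurable (PiM {..<k} (\<lambda>_. borel))"
  using transform_measurable[of k k a b] by measurable

definition char_step_const :: "real \<Rightarrow> real" where
  "char_step_const t = \<bar>t\<bar> ^ 3 * cubic_const / 6 + \<bar>t\<bar> ^ 3 * v * excess_const / 2 + t ^ 4 * v\<^sup>2 * (1 + v)\<^sup>2 / 8"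

text \<open>
  The random conditional variances average out in the central limit theorem. The excess at time
  \<open>m + 1\<close> depends on \<open>e\<^sub>m\<close> alone and has mean \<open>0\<close>, hence is uncorrelated with functions of the sum of
  the terms before time \<open>m\<close>. Adding the term at time \<open>m\<close> changes the exponential of the sum by at most
  \<open>\<bar>t\<bar>\<close> times that term, which makes the correlation of third order in \<open>h\<close>.
\<close>

lemma excess_correlation:
  assumes "\<And>j. j \<le> Suc m \<Longrightarrow> \<bar>a j\<bar> \<le> h" "\<And>j. j \<le> Suc m \<Longrightarrow> \<bar>b j\<bar> \<le> h"
  shows "cmod (CLINT \<omega>|M. iexp (t * martingale_transform a b (Suc m) (noise_path \<omega>)) *
      complex_of_real (excess a b (Suc m) (e m \<omega>))) \<le> \<bar>t\<bar> * (h ^ 3 * excess_const)"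
proof -
  define q where "q = excess a b (Suc m)"
  have qm[measurable]: "q \<in> borel_measurable borel" by (simp add: q_def excess_def[abs_def])
  define d where "d \<omega> = coef a b m (noise_path \<omega>) * e m \<omega>" for \<omega>
  have [measurable]: "d \<in> borel_measurable M" unfolding d_def[abs_def] by measurable
  define U where "U j \<omega> = iexp (t * martingale_transform a b j (noise_path \<omega>))" for j \<omega>
  have [measurable]: "U j \<in> borel_measurable M" for j unfolding U_def[abs_def] by measurable
  have U1: "cmod (U j \<omega>) = 1" for j \<omega> by (simp add: U_def)
  note x = excess_moments[of a m h b, folded q_def d_def, OF assms(1) assms(2) assms(1) assms(2), simplified]
  have iUm: "integrable M (\<lambda>\<omega>. U m \<omega> * complex_of_real (q (e m \<omega>)))"
    and iU: "integrable M (\<lambda>\<omega>. U (Suc m) \<omega> * complex_of_real (q (e m \<omega>)))"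
    by (rule Bochner_Integration.integrable_bound[OF x(1)]; use U1 in \<open>auto simp: norm_mult\<close>)+
  have zero: "(CLINT \<omega>|M. U m \<omega> * complex_of_real (q (e m \<omega>))) = 0"
    unfolding U_def
    by (subst past_independent(1)[OF transform_exp_measurable, of t a b m "\<lambda>r. complex_of_real (q r)"])
       (auto simp: transform_restrict x(1,2) intro!: integrable_const_bound[of _ 1])
  have "(CLINT \<omega>|M. U (Suc m) \<omega> * complex_of_real (q (e m \<omega>)))
      = (CLINT \<omega>|M. U (Suc m) \<omega> * complex_of_real (q (e m \<omega>)) - U m \<omega> * complex_of_real (q (e m \<omega>)))"
    using iU iUm zero by simp
  also have "cmod \<dots> \<le> (LINT \<omega>|M. cmod (U (Suc m) \<omega> * complex_of_real (q (e m \<omega>)) - U m \<omega> * complex_of_real (q (e m \<omega>))))"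
    by (rule integral_norm_bound)
  also have "\<dots> \<le> (LINT \<omega>|M. \<bar>t\<bar> * (\<bar>d \<omega>\<bar> * \<bar>q (e m \<omega>)\<bar>))"
  proof (rule integral_mono)
    fix \<omega>
    have "U (Suc m) \<omega> * complex_of_real (q (e m \<omega>)) - U m \<omega> * complex_of_real (q (e m \<omega>))
        = U m \<omega> * (iexp (t * d \<omega>) - 1) * complex_of_real (q (e m \<omega>))"
      by (simp add: U_def d_def transform_Suc distrib_left exp_add algebra_simps)
    then have "cmod (U (Suc m) \<omega> * complex_of_real (q (e m \<omega>)) - U m \<omega> * complex_of_real (q (e m \<omega>)))
        = cmod (iexp (t * d \<omega>) - 1) * \<bar>q (e m \<omega>)\<bar>"
      by (simp add: norm_mult U1)
    also have "\<dots> \<le> \<bar>t * d \<omega>\<bar> * \<bar>q (e m \<omega>)\<bar>"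
      by (intro mult_right_mono cmod_iexp_minus_one) auto
    finally show "cmod (U (Suc m) \<omega> * complex_of_real (q (e m \<omega>)) - U m \<omega> * complex_of_real (q (e m \<omega>)))
        \<le> \<bar>t\<bar> * (\<bar>d \<omega>\<bar> * \<bar>q (e m \<omega>)\<bar>)" by (simp add: abs_mult)
  qed (use iU iUm x(3) in auto)
  also have "\<dots> \<le> \<bar>t\<bar> * (h ^ 3 * excess_const)"
    using x(4) by (simp add: mult_left_mono)
  finally show ?thesis by (simp add: q_def U_def)
qed

text \<open>
  One step of the telescoping argument: adding the increment at time \<open>k\<close> multiplies the
  characteristic function by the Gaussian factor of the same variance, up to an error of third order
  in the size \<open>h\<close> of the weights. The error has three sources: the Taylor remainder of the
  increment, the replacement of \<open>1 - x\<close> by \<open>exp (- x)\<close>, and the excess of the conditional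
  variance.
\<close>

lemma char_step:
  assumes b0: "b 0 = 0" and h: "h \<le> 1"
    and ab: "\<And>j. j \<le> k \<Longrightarrow> \<bar>a j\<bar> \<le> h" "\<And>j. j \<le> k \<Longrightarrow> \<bar>b j\<bar> \<le> h"
  shows "cmod ((CLINT \<omega>|M. iexp (t * martingale_transform a b (Suc k) (noise_path \<omega>)))
      - exp (- (t\<^sup>2 * (v * ((a k)\<^sup>2 + (b k)\<^sup>2 * v)) / 2)) * (CLINT \<omega>|M. iexp (t * martingale_transform a b k (noise_path \<omega>))))
    \<le> h ^ 3 * char_step_const t"
proof -
  have h0: "0 \<le> h" using ab(1)[of k] by linarith
  define c where "c \<omega> = coef a b k (noise_path \<omega>)" for \<omega>
  define U where "U \<omega> = iexp (t * martingale_transform a b k (noise_path \<omega>))" for \<omega>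
  define s where "s = (a k)\<^sup>2 + (b k)\<^sup>2 * v"
  have cm[measurable]: "c \<in> borel_measurable M" unfolding c_def[abs_def] by measurable
  have Um[measurable]: "U \<in> borel_measurable M" unfolding U_def[abs_def] by measurable
  have U1: "cmod (U \<omega>) = 1" for \<omega> by (simp add: U_def)
  define \<psi> where "\<psi> = (CLINT \<omega>|M. U \<omega>)"
  have iU: "integrable M U" by (rule integrable_const_bound[of _ 1]) (auto simp: U1)
  have \<psi>1: "cmod \<psi> \<le> 1"
  proof -
    have "cmod \<psi> \<le> (LINT \<omega>|M. cmod (U \<omega>))" unfolding \<psi>_def by (rule integral_norm_bound)
    then show ?thesis by (simp add: U1 prob_space)
  qed
  have iUc: "integrable M (\<lambda>\<omega>. U \<omega> * complex_of_real (c \<omega>))"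
    by (rule Bochner_Integration.integrable_bound[OF integrable_coef[of a b k]])
       (auto simp: norm_mult U1 c_def)
  have iUc2: "integrable M (\<lambda>\<omega>. U \<omega> * complex_of_real ((c \<omega>)\<^sup>2))"
    by (rule Bochner_Integration.integrable_bound[OF integrable_coef_square[of a b k]])
       (auto simp: norm_mult U1 c_def norm_power)
  have gm: "(\<lambda>x. iexp (t * martingale_transform a b k x) * complex_of_real (coef a b k x)) \<in> borel_measurable (PiM {..<k} (\<lambda>_. borel))"
    "(\<lambda>x. iexp (t * martingale_transform a b k x) * complex_of_real ((coef a b k x)\<^sup>2)) \<in> borel_measurable (PiM {..<k} (\<lambda>_. borel))"
    using transform_exp_measurable[of t a b k] coef_measurable[of k k a b] by measurable
  note p1 = past_independent[OF gm(1), of "\<lambda>r. complex_of_real r"]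
  note p2 = past_independent[OF gm(2), of "\<lambda>r. complex_of_real (r\<^sup>2)"]
  have I1: "(CLINT \<omega>|M. U \<omega> * complex_of_real (c \<omega>) * complex_of_real (e k \<omega>)) = 0"
    "integrable M (\<lambda>\<omega>. U \<omega> * complex_of_real (c \<omega>) * complex_of_real (e k \<omega>))"
    unfolding U_def c_def
    subgoal by (subst p1(1)) (use iUc integrable_e in \<open>auto simp: transform_restrict coef_restrict mean_zero U_def c_def\<close>)
    subgoal by (rule p1(2)) (use iUc integrable_e in \<open>auto simp: transform_restrict coef_restrict mean_zero U_def c_def\<close>)
    done
  have ie2: "integrable M (\<lambda>\<omega>. complex_of_real ((e k \<omega>)\<^sup>2))"
    using integrable_e_square[of k] by (rule integrable_of_real)
  have me2: "(CLINT \<omega>|M. complex_of_real ((e k \<omega>)\<^sup>2)) = of_real v"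
    by (simp only: integral_complex_of_real second_moment)
  have I2: "(CLINT \<omega>|M. U \<omega> * complex_of_real ((c \<omega>)\<^sup>2) * complex_of_real ((e k \<omega>)\<^sup>2))
      = (CLINT \<omega>|M. U \<omega> * complex_of_real ((c \<omega>)\<^sup>2)) * of_real v"
    "integrable M (\<lambda>\<omega>. U \<omega> * complex_of_real ((c \<omega>)\<^sup>2) * complex_of_real ((e k \<omega>)\<^sup>2))"
    unfolding U_def c_def
    subgoal
      apply (subst p2(1))
      using iUc2[unfolded U_def c_def] ie2 me2
      by (simp_all add: transform_restrict coef_restrict del: of_real_power)
    subgoal
      apply (rule p2(2))
      using iUc2[unfolded U_def c_def] ie2
      by (simp_all add: transform_restrict coef_restrict del: of_real_power)
    done
  define Q where "Q = (CLINT \<omega>|M. U \<omega> * complex_of_real ((c \<omega>)\<^sup>2)) - of_real s * \<psi>"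
  have Q: "cmod Q \<le> \<bar>t\<bar> * (h ^ 3 * excess_const)"
  proof (cases k)
    case 0
    then have "c \<omega> = a 0" for \<omega> by (simp add: c_def coef_def b0)
    then have "Q = 0" using 0 b0 by (simp add: Q_def s_def \<psi>_def mult.commute)
    moreover have "0 \<le> excess_const" using kappa_nonneg by (simp add: cubic_const_def excess_const_def)
    ultimately show ?thesis using h0 by simp
  next
    case (Suc m)
    define q where "q \<omega> = excess a b (Suc m) (e m \<omega>)" for \<omega>
    have [measurable]: "q \<in> borel_measurable M" unfolding q_def[abs_def] excess_def by measurable
    have "(c \<omega>)\<^sup>2 = s + q \<omega>" for \<omega>
      unfolding c_def coef_square using Suc by (simp add: s_def q_def excess_def prev_def algebra_simps)
    then have "U \<omega> * complex_of_real ((c \<omega>)\<^sup>2) = of_real s * U \<omega> + U \<omega> * complex_of_real (q \<omega>)" for \<omega>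
      by (simp add: algebra_simps)
    moreover have "integrable M (\<lambda>\<omega>. U \<omega> * complex_of_real (q \<omega>))"
    proof (rule Bochner_Integration.integrable_bound)
      show "integrable M q"
        using excess_moments(1)[of a m h b] ab Suc by (simp add: q_def[abs_def])
    qed (auto simp: norm_mult U1)
    ultimately have "Q = (CLINT \<omega>|M. U \<omega> * complex_of_real (q \<omega>))"
      using iU by (simp add: Q_def \<psi>_def)
    then show ?thesis using excess_correlation[of m a h b t] ab Suc by (simp add: U_def q_def)
  qed
  define P where "P \<omega> = 1 + \<i> * complex_of_real (t * (c \<omega> * e k \<omega>)) - (complex_of_real (t * (c \<omega> * e k \<omega>)))\<^sup>2 / 2" for \<omega>
  have UP: "U \<omega> * P \<omega> = U \<omega> + \<i> * t * (U \<omega> * complex_of_real (c \<omega>) * complex_of_real (e k \<omega>))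
      - of_real (t\<^sup>2 / 2) * (U \<omega> * complex_of_real ((c \<omega>)\<^sup>2) * complex_of_real ((e k \<omega>)\<^sup>2))" for \<omega>
    by (simp add: P_def algebra_simps power_mult_distrib)
  have iUP: "integrable M (\<lambda>\<omega>. U \<omega> * P \<omega>)"
    unfolding UP
    by (intro Bochner_Integration.integrable_diff Bochner_Integration.integrable_add integrable_mult_right iU I1 I2)
  have eUP: "(CLINT \<omega>|M. U \<omega> * P \<omega>) = \<psi> - of_real (t\<^sup>2 / 2) * ((Q + of_real s * \<psi>) * of_real v)"
  proof -
    have "(CLINT \<omega>|M. U \<omega> * P \<omega>) = (CLINT \<omega>|M. U \<omega>)
        + \<i> * t * (CLINT \<omega>|M. U \<omega> * complex_of_real (c \<omega>) * complex_of_real (e k \<omega>))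
        - of_real (t\<^sup>2 / 2) * (CLINT \<omega>|M. U \<omega> * complex_of_real ((c \<omega>)\<^sup>2) * complex_of_real ((e k \<omega>)\<^sup>2))"
      unfolding UP
      by (subst Bochner_Integration.integral_diff Bochner_Integration.integral_add integral_mult_right_zero;
          (intro Bochner_Integration.integrable_diff Bochner_Integration.integrable_add integrable_mult_right iU I1 I2)?)+
        (rule refl)
    then show ?thesis unfolding I1 I2(1) by (simp add: Q_def \<psi>_def)
  qed
  define \<psi>' where "\<psi>' = (CLINT \<omega>|M. iexp (t * martingale_transform a b (Suc k) (noise_path \<omega>)))"
  have Ue: "iexp (t * martingale_transform a b (Suc k) (noise_path \<omega>)) = U \<omega> * iexp (t * (c \<omega> * e k \<omega>))" for \<omega>
    by (simp add: U_def c_def transform_Suc distrib_left exp_add)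
  have iUe: "integrable M (\<lambda>\<omega>. U \<omega> * iexp (t * (c \<omega> * e k \<omega>)))"
    by (rule integrable_const_bound[of _ 1]) (auto simp: norm_mult U1)
  note t3 = third_moment_increment[of a k h b, OF ab(1)[OF order_refl] ab(2)[OF order_refl], folded c_def]
  \<comment> \<open>the Taylor remainder of the exponential of the increment\<close>
  have E1: "cmod (\<psi>' - (CLINT \<omega>|M. U \<omega> * P \<omega>)) \<le> \<bar>t\<bar> ^ 3 / 6 * (h ^ 3 * cubic_const)"
  proof -
    have "cmod (\<psi>' - (CLINT \<omega>|M. U \<omega> * P \<omega>)) = cmod (CLINT \<omega>|M. U \<omega> * iexp (t * (c \<omega> * e k \<omega>)) - U \<omega> * P \<omega>)"
      unfolding \<psi>'_def Ue by (subst Bochner_Integration.integral_diff[OF iUe iUP]) (rule refl)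
    also have "\<dots> \<le> (LINT \<omega>|M. cmod (U \<omega> * iexp (t * (c \<omega> * e k \<omega>)) - U \<omega> * P \<omega>))"
      by (rule integral_norm_bound)
    also have "\<dots> \<le> (LINT \<omega>|M. \<bar>t\<bar> ^ 3 / 6 * \<bar>c \<omega> * e k \<omega>\<bar> ^ 3)"
    proof (rule integral_mono)
      fix \<omega>
      have "cmod (U \<omega> * iexp (t * (c \<omega> * e k \<omega>)) - U \<omega> * P \<omega>) = cmod (iexp (t * (c \<omega> * e k \<omega>)) - P \<omega>)"
        unfolding right_diff_distrib[symmetric] norm_mult U1 by simp
      also have "\<dots> \<le> \<bar>t * (c \<omega> * e k \<omega>)\<bar> ^ 3 / 6"
        using cmod_iexp_quadratic[of "t * (c \<omega> * e k \<omega>)"] by (simp add: P_def)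
      also have "\<dots> = \<bar>t\<bar> ^ 3 / 6 * \<bar>c \<omega> * e k \<omega>\<bar> ^ 3"
        by (subst abs_mult, subst power_mult_distrib) simp
      finally show "cmod (U \<omega> * iexp (t * (c \<omega> * e k \<omega>)) - U \<omega> * P \<omega>) \<le> \<bar>t\<bar> ^ 3 / 6 * \<bar>c \<omega> * e k \<omega>\<bar> ^ 3" .
    qed (use iUe iUP t3(1) in \<open>auto intro!: integrable_norm Bochner_Integration.integrable_diff\<close>)
    also have "\<dots> = \<bar>t\<bar> ^ 3 / 6 * expectation (\<lambda>\<omega>. \<bar>c \<omega> * e k \<omega>\<bar> ^ 3)"
      by (rule integral_mult_right_zero)
    also have "\<dots> \<le> \<bar>t\<bar> ^ 3 / 6 * (h ^ 3 * cubic_const)" by (intro mult_left_mono t3(2)) simp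
    finally show ?thesis .
  qed
  define x where "x = t\<^sup>2 * (v * s) / 2"
  have s0: "0 \<le> s" using v_nonneg by (simp add: s_def)
  have x0: "0 \<le> x" using v_nonneg s0 by (simp add: x_def)
  \<comment> \<open>the Gaussian factor against its linearisation\<close>
  have E2: "cmod (of_real ((1 - x) - exp (- x)) * \<psi>) \<le> h ^ 3 * (t ^ 4 * v\<^sup>2 * (1 + v)\<^sup>2 / 8)"
  proof -
    have "s \<le> h\<^sup>2 + h\<^sup>2 * v"
      using ab[of k] v_nonneg h0 unfolding s_def
      by (intro add_mono mult_right_mono) (auto simp: abs_le_square_iff[symmetric])
    then have "s\<^sup>2 \<le> (h\<^sup>2 * (1 + v))\<^sup>2"
      using s0 by (intro power_mono) (auto simp: algebra_simps)
    also have "\<dots> = h ^ 4 * (1 + v)\<^sup>2" by (simp add: power_mult_distrib power_mult[symmetric])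
    also have "\<dots> \<le> h ^ 3 * (1 + v)\<^sup>2"
      using h h0 by (intro mult_right_mono power_decreasing) auto
    finally have s2: "s\<^sup>2 \<le> h ^ 3 * (1 + v)\<^sup>2" .
    have "cmod (of_real ((1 - x) - exp (- x)) * \<psi>) \<le> \<bar>(1 - x) - exp (- x)\<bar> * 1"
      unfolding norm_mult norm_of_real by (intro mult_left_mono \<psi>1) simp
    also have "\<dots> \<le> x\<^sup>2 / 2" using abs_exp_minus_linear[OF x0] by simp
    also have "\<dots> = t ^ 4 * v\<^sup>2 * s\<^sup>2 / 8"
      by (simp add: x_def power_mult_distrib power_divide power_mult[symmetric])
    also have "\<dots> \<le> t ^ 4 * v\<^sup>2 * (h ^ 3 * (1 + v)\<^sup>2) / 8"
      using s2 by (intro divide_right_mono mult_left_mono) auto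
    finally show ?thesis by (simp add: algebra_simps)
  qed
  \<comment> \<open>the fluctuation of the conditional variance\<close>
  have E3: "cmod (of_real (t\<^sup>2 * v / 2) * Q) \<le> h ^ 3 * (\<bar>t\<bar> ^ 3 * v * excess_const / 2)"
  proof -
    have "cmod (of_real (t\<^sup>2 * v / 2) * Q) = (t\<^sup>2 * v / 2) * cmod Q"
      using v_nonneg by (simp add: norm_mult del: of_real_mult of_real_divide of_real_power)
    also have "\<dots> \<le> (t\<^sup>2 * v / 2) * (\<bar>t\<bar> * (h ^ 3 * excess_const))"
      using v_nonneg by (intro mult_left_mono Q) auto
    also have "\<dots> = h ^ 3 * (\<bar>t\<bar> ^ 3 * v * excess_const / 2)"
      by (simp add: power3_eq_cube power2_eq_square)
    finally show ?thesis .
  qed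
  have "\<psi>' - exp (- x) * \<psi> = (\<psi>' - (CLINT \<omega>|M. U \<omega> * P \<omega>)) + of_real ((1 - x) - exp (- x)) * \<psi>
      - of_real (t\<^sup>2 * v / 2) * Q"
    unfolding eUP by (simp add: x_def algebra_simps)
  also have "cmod \<dots> \<le> cmod (\<psi>' - (CLINT \<omega>|M. U \<omega> * P \<omega>)) + cmod (of_real ((1 - x) - exp (- x)) * \<psi>)
      + cmod (of_real (t\<^sup>2 * v / 2) * Q)"
    by (rule order_trans[OF norm_triangle_ineq4 add_right_mono[OF norm_triangle_ineq]])
  also have "\<dots> \<le> h ^ 3 * char_step_const t"
    using E1 E2 E3 by (simp add: char_step_const_def algebra_simps)
  finally show ?thesis by (simp add: \<psi>'_def x_def s_def \<psi>_def U_def)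
qed

end

context centred_noise
begin

lemma char_transform_close:
  assumes b0: "b 0 = 0" and h: "h \<le> 1"
    and ab: "\<And>j. j < n \<Longrightarrow> \<bar>a j\<bar> \<le> h" "\<And>j. j < n \<Longrightarrow> \<bar>b j\<bar> \<le> h"
  shows "cmod ((CLINT \<omega>|M. iexp (t * martingale_transform a b n (noise_path \<omega>)))
      - exp (- (t\<^sup>2 * (v * (\<Sum>j<n. (a j)\<^sup>2 + (b j)\<^sup>2 * v)) / 2))) \<le> real n * (h ^ 3 * char_step_const t)"
  using ab
proof (induction n)
  case 0
  then show ?case by (simp add: martingale_transform_def prob_space)
next
  case (Suc n)
  define \<psi> where "\<psi> m = (CLINT \<omega>|M. iexp (t * martingale_transform a b m (noise_path \<omega>)))" for m
  define z where "z m = t\<^sup>2 * (v * (\<Sum>j<m. (a j)\<^sup>2 + (b j)\<^sup>2 * v)) / 2" for m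
  define y where "y = t\<^sup>2 * (v * ((a n)\<^sup>2 + (b n)\<^sup>2 * v)) / 2"
  have z: "z (Suc n) = y + z n" by (simp add: z_def y_def field_simps)
  have "0 \<le> y" using v_nonneg by (simp add: y_def)
  have IH: "cmod (\<psi> n - exp (- z n)) \<le> real n * (h ^ 3 * char_step_const t)"
    using Suc by (simp add: \<psi>_def z_def)
  have step: "cmod (\<psi> (Suc n) - exp (- y) * \<psi> n) \<le> h ^ 3 * char_step_const t"
    using char_step[of b h n a t, OF b0 h] Suc.prems unfolding \<psi>_def y_def by auto
  have ez: "exp (- z (Suc n)) = exp (- y) * exp (- z n)"
    unfolding z by (simp add: exp_add[symmetric])
  have "\<psi> (Suc n) - exp (- z (Suc n)) = (\<psi> (Suc n) - exp (- y) * \<psi> n) + exp (- y) * (\<psi> n - exp (- z n))"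
    unfolding ez by (simp add: algebra_simps)
  also have "cmod \<dots> \<le> cmod (\<psi> (Suc n) - exp (- y) * \<psi> n) + cmod (exp (- y) * (\<psi> n - exp (- z n)))"
    by (rule norm_triangle_ineq)
  also have "cmod (exp (- y) * (\<psi> n - exp (- z n))) \<le> 1 * cmod (\<psi> n - exp (- z n))"
    unfolding norm_mult using \<open>0 \<le> y\<close> by (intro mult_right_mono) auto
  finally show ?case using IH step by (simp add: \<psi>_def z_def algebra_simps)
qed

text \<open>
  A martingale central limit theorem without truncation: with weights of order \<open>n\<^sup>-\<^sup>1\<^sup>/\<^sup>2\<close> each of the \<open>n\<close>
  steps costs \<open>O(n\<^sup>-\<^sup>3\<^sup>/\<^sup>2)\<close>, so the characteristic function is within \<open>O(n\<^sup>-\<^sup>1\<^sup>/\<^sup>2)\<close> of that of the normal law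
  with the same variance, and Levy's continuity theorem applies.
\<close>

theorem normal_limit_transform:
  fixes a b :: "nat \<Rightarrow> nat \<Rightarrow> real"
  assumes b0: "\<And>n. b n 0 = 0"
    and ab: "\<And>n j. j < n \<Longrightarrow> \<bar>a n j\<bar> \<le> C / sqrt n" "\<And>n j. j < n \<Longrightarrow> \<bar>b n j\<bar> \<le> C / sqrt n"
    and lim: "(\<lambda>n. v * (\<Sum>j<n. (a n j)\<^sup>2 + (b n j)\<^sup>2 * v)) \<longlonglongrightarrow> w"
  shows "weak_conv_m (\<lambda>n. distr M borel (\<lambda>\<omega>. martingale_transform (a n) (b n) n (noise_path \<omega>))) (normal_law 0 w)"
proof (rule levy_continuity)
  have w: "0 \<le> w"
    by (rule LIMSEQ_le_const[OF lim]) (use v_nonneg in \<open>auto intro!: exI[of _ 0] mult_nonneg_nonneg sum_nonneg\<close>)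
  then show "real_distribution (normal_law 0 w)" by (rule real_distribution_normal_law)
  show "real_distribution (distr M borel (\<lambda>\<omega>. martingale_transform (a n) (b n) n (noise_path \<omega>)))" for n
    by (intro real_distribution_distr) measurable
  fix t
  define \<psi> where "\<psi> n = (CLINT \<omega>|M. iexp (t * martingale_transform (a n) (b n) n (noise_path \<omega>)))" for n
  define \<phi> where "\<phi> n = complex_of_real (exp (- (t\<^sup>2 * (v * (\<Sum>j<n. (a n j)\<^sup>2 + (b n j)\<^sup>2 * v)) / 2)))" for n
  have \<psi>: "char (distr M borel (\<lambda>\<omega>. martingale_transform (a n) (b n) n (noise_path \<omega>))) t = \<psi> n" for n
    unfolding char_def \<psi>_def by (subst integral_distr) auto
  have \<phi>: "\<phi> \<longlonglongrightarrow> char (normal_law 0 w) t"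
    unfolding \<phi>_def char_normal_law[OF w] by (intro tendsto_intros lim) simp
  have "\<forall>\<^sub>F n in sequentially. C / sqrt (real n) \<le> 1"
  proof -
    have "(\<lambda>n. C / sqrt (real n)) \<longlonglongrightarrow> 0" by real_asymp
    then show ?thesis by (rule eventually_mono[OF order_tendstoD(2), of _ _ _ 1]) auto
  qed
  then have "\<forall>\<^sub>F n in sequentially. norm (\<psi> n - \<phi> n) \<le> C ^ 3 * char_step_const t / sqrt n"
    using eventually_gt_at_top[of 0]
  proof eventually_elim
    case (elim n)
    have "norm (\<psi> n - \<phi> n) \<le> real n * ((C / sqrt n) ^ 3 * char_step_const t)"
      unfolding \<psi>_def \<phi>_def using char_transform_close[of "b n" "C / sqrt n" n "a n" t] b0 ab elim by simp
    also have "\<dots> = C ^ 3 * char_step_const t / sqrt n"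
      using elim by (simp add: power3_eq_cube field_simps)
    finally show ?case .
  qed
  moreover have "(\<lambda>n. C ^ 3 * char_step_const t / sqrt (real n)) \<longlonglongrightarrow> 0" by real_asymp
  ultimately have "(\<lambda>n. \<psi> n - \<phi> n) \<longlonglongrightarrow> 0" by (rule Lim_null_comparison)
  from tendsto_add[OF this \<phi>] show "(\<lambda>n. char (distr M borel (\<lambda>\<omega>. martingale_transform (a n) (b n) n (noise_path \<omega>))) t)
      \<longlonglongrightarrow> char (normal_law 0 w) t"
    by (simp add: \<psi>)
qed

lemma bounded_in_prob_transform:
  fixes a b :: "nat \<Rightarrow> nat \<Rightarrow> real"
  assumes b0: "\<And>n. b n 0 = 0" and lim: "(\<lambda>n. v * (\<Sum>j<n. (a n j)\<^sup>2 + (b n j)\<^sup>2 * v)) \<longlonglongrightarrow> w"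
  shows "bounded_in_prob (\<lambda>n \<omega>. martingale_transform (a n) (b n) n (noise_path \<omega>))"
proof -
  from lim have "Bseq (\<lambda>n. v * (\<Sum>j<n. (a n j)\<^sup>2 + (b n j)\<^sup>2 * v))"
    by (intro convergent_imp_Bseq convergentI)
  then obtain B where B: "\<And>n. \<bar>v * (\<Sum>j<n. (a n j)\<^sup>2 + (b n j)\<^sup>2 * v)\<bar> \<le> B" by (auto simp: Bseq_def)
  show ?thesis
    using second_moment_transform[of "b n" "a n" n for n, OF b0] B by (intro bounded_in_prob_L2[of _ B]) (auto intro: order_trans[OF abs_ge_self])
qed

section \<open>Limits of the regression sums\<close>

definition walk :: "nat \<Rightarrow> (nat \<Rightarrow> real) \<Rightarrow> real" where
  "walk j x = (\<Sum>i<j. x i)"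

lemma walk_eq_transform: "walk j x = martingale_transform (\<lambda>_. 1) (\<lambda>_. 0) j x"
  by (simp add: walk_def martingale_transform_def coef_def)

lemma walk_measurable[measurable]: "(\<lambda>\<omega>. walk j (noise_path \<omega>)) \<in> borel_measurable M"
  unfolding walk_def by measurable

lemma integrable_walk: "integrable M (\<lambda>\<omega>. walk j (noise_path \<omega>))"
  unfolding walk_def using integrable_e by auto

lemma walk_second_moment:
  "integrable M (\<lambda>\<omega>. (walk j (noise_path \<omega>))\<^sup>2)" "expectation (\<lambda>\<omega>. (walk j (noise_path \<omega>))\<^sup>2) = v * j"
  using second_moment_transform[of "\<lambda>_. 0" "\<lambda>_. 1" j] by (simp_all add: walk_eq_transform)

text \<open>
  A square root bound by the inequality \<open>y \<le> s + y\<^sup>2 / s\<close> for \<open>s = sqrt n\<close>.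
\<close>

lemma walk_first_moment:
  assumes "j \<le> n" shows "expectation (\<lambda>\<omega>. \<bar>walk j (noise_path \<omega>)\<bar>) \<le> (1 + v) * sqrt n"
proof (cases "n = 0")
  case True then show ?thesis using assms by (simp add: walk_def)
next
  case False
  then have n: "0 < sqrt n" by simp
  have "expectation (\<lambda>\<omega>. \<bar>walk j (noise_path \<omega>)\<bar>) \<le> expectation (\<lambda>\<omega>. sqrt n + (walk j (noise_path \<omega>))\<^sup>2 / sqrt n)"
  proof (rule integral_mono)
    fix \<omega>
    define y where "y = \<bar>walk j (noise_path \<omega>)\<bar>"
    have "y * sqrt n \<le> (sqrt n)\<^sup>2 + y\<^sup>2"
    proof -
      have "0 \<le> y * sqrt n" by (simp add: y_def)
      then show ?thesis using sum_squares_bound[of y "sqrt n"] by linarith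
    qed
    then have "y \<le> sqrt n + y\<^sup>2 / sqrt n" using n by (simp add: field_simps power2_eq_square)
    then show "\<bar>walk j (noise_path \<omega>)\<bar> \<le> sqrt n + (walk j (noise_path \<omega>))\<^sup>2 / sqrt n" by (simp add: y_def)
  qed (use integrable_walk walk_second_moment in auto)
  also have "\<dots> = sqrt n + v * j / sqrt n" using walk_second_moment by (simp add: prob_space)
  also have "\<dots> \<le> sqrt n + v * n / sqrt n"
    using assms v_nonneg n by (intro add_left_mono divide_right_mono mult_left_mono) auto
  also have "\<dots> = (1 + v) * sqrt n" using n by (simp add: field_simps)
  finally show ?thesis .
qed

text \<open>
  Summation by parts: \<open>(walk n)\<^sup>2\<close> is the sum of its increments \<open>2 walk\<^sub>j x\<^sub>j + x\<^sub>j\<^sup>2\<close>. It turns sums of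
  products into squares, whose expectations are known.
\<close>

lemma sum_walk_increments: "(\<Sum>j<n. walk j x * x j) = ((walk n x)\<^sup>2 - (\<Sum>j<n. (x j)\<^sup>2)) / 2"
  by (induction n) (simp_all add: walk_def power2_eq_square algebra_simps add_divide_distrib diff_divide_distrib)

lemma sum_prev_shift: "(\<Sum>j<Suc m. f j * prev x j) = (\<Sum>i<m. f (Suc i) * x i)"
  by (subst sum.lessThan_Suc_shift) (simp add: prev_def)

text \<open>
  The centred squares are orthogonal for the same reason as the terms of a martingale transform.
\<close>

lemma sum_squares_second_moment:
  "integrable M (\<lambda>\<omega>. (\<Sum>i<m. (e i \<omega>)\<^sup>2 - v)\<^sup>2) \<and> expectation (\<lambda>\<omega>. (\<Sum>i<m. (e i \<omega>)\<^sup>2 - v)\<^sup>2) \<le> \<kappa> * m"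
proof (induction m)
  case 0 then show ?case by simp
next
  case (Suc m)
  define g where "g x = (\<Sum>i<m. (x i)\<^sup>2 - v)" for x :: "nat \<Rightarrow> real"
  have gm: "g \<in> borel_measurable (PiM {..<m} (\<lambda>_. borel))"
    unfolding g_def[abs_def]
    by (intro borel_measurable_sum borel_measurable_diff borel_measurable_power borel_measurable_const measurable_component_singleton) simp
  have gr: "g (restrict x {..<m}) = g x" for x by (simp add: g_def)
  have ig: "integrable M (\<lambda>\<omega>. g (noise_path \<omega>))" unfolding g_def using integrable_e_square by auto
  have il: "integrable M (\<lambda>\<omega>. (e m \<omega>)\<^sup>2 - v)" using integrable_e_square by simp
  have el: "expectation (\<lambda>\<omega>. (e m \<omega>)\<^sup>2 - v) = 0" using integrable_e_square[of m] by (simp add: second_moment prob_space)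
  have cross: "integrable M (\<lambda>\<omega>. g (noise_path \<omega>) * ((e m \<omega>)\<^sup>2 - v))"
    "expectation (\<lambda>\<omega>. g (noise_path \<omega>) * ((e m \<omega>)\<^sup>2 - v)) = 0"
    using past_independent[OF gm gr _ ig il] el by auto
  have sq: "((e m \<omega>)\<^sup>2 - v)\<^sup>2 = e m \<omega> ^ 4 - 2 * v * (e m \<omega>)\<^sup>2 + v\<^sup>2" for \<omega>
    by (simp add: power2_diff power_mult[symmetric])
  have isq: "integrable M (\<lambda>\<omega>. ((e m \<omega>)\<^sup>2 - v)\<^sup>2)"
    unfolding sq using integrable_fourth integrable_e_square by auto
  have esq: "expectation (\<lambda>\<omega>. ((e m \<omega>)\<^sup>2 - v)\<^sup>2) \<le> \<kappa>"
  proof -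
    have "expectation (\<lambda>\<omega>. ((e m \<omega>)\<^sup>2 - v)\<^sup>2) = expectation (\<lambda>\<omega>. e m \<omega> ^ 4) - 2 * v * v + v\<^sup>2"
      unfolding sq using integrable_fourth[of m] integrable_e_square[of m]
      by (simp add: second_moment prob_space)
    moreover have "2 * v * v = 2 * v\<^sup>2" by (simp add: power2_eq_square)
    ultimately show ?thesis using fourth_moment[of m] zero_le_power2[of v] by linarith
  qed
  have eq: "(\<Sum>i<Suc m. (e i \<omega>)\<^sup>2 - v)\<^sup>2 = (\<Sum>i<m. (e i \<omega>)\<^sup>2 - v)\<^sup>2
      + 2 * (g (noise_path \<omega>) * ((e m \<omega>)\<^sup>2 - v)) + ((e m \<omega>)\<^sup>2 - v)\<^sup>2" for \<omega>
    by (simp add: g_def power2_eq_square algebra_simps)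
  show ?case
    unfolding eq of_nat_Suc distrib_left using Suc cross isq esq by simp
qed

end

lemma sum_lessThan_real: "(\<Sum>j<n. real j) = real n * (real n - 1) / 2"
  by (induction n) (simp_all add: field_simps)

lemma sum_squares_lessThan_real: "(\<Sum>j<n. (real j)\<^sup>2) = real n * (real n - 1) * (2 * real n - 1) / 6"
  by (induction n) (simp_all add: power2_eq_square field_simps)

context centred_noise
begin

text \<open>
  The value of the random walk with drift \<open>\<mu>\<close> at time \<open>j\<close> in terms of its centred increments \<open>x\<close>.
\<close>

definition level :: "real \<Rightarrow> nat \<Rightarrow> (nat \<Rightarrow> real) \<Rightarrow> real" where
  "level \<mu> j x = \<mu> * j + walk j x"

text \<open>
  The centred increment of the level just before time \<open>j\<close>. The level is \<open>0\<close> at time \<open>-1\<close> as well as at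
  time \<open>0\<close>, so the increment ending at time \<open>0\<close> is \<open>0\<close> and its centred version is \<open>- \<mu>\<close>.
\<close>

definition lag :: "real \<Rightarrow> nat \<Rightarrow> (nat \<Rightarrow> real) \<Rightarrow> real" where
  "lag \<mu> j x = (if j = 0 then - \<mu> else x (j - 1))"

lemma sum_walk_vanishes: "vanishes_in_prob (\<lambda>n \<omega>. (\<Sum>j<n. walk j (noise_path \<omega>)) / real n ^ 2)"
proof (rule vanishes_in_prob_L1[where c="\<lambda>n. (1 + v) / sqrt n"])
  show "(\<lambda>n. (1 + v) / sqrt (real n)) \<longlonglongrightarrow> 0" by real_asymp
  show "integrable M (\<lambda>\<omega>. (\<Sum>j<n. walk j (noise_path \<omega>)) / real n ^ 2)" for n
    using integrable_walk by auto
  have "expectation (\<lambda>\<omega>. \<bar>(\<Sum>j<n. walk j (noise_path \<omega>)) / real n ^ 2\<bar>) \<le> (1 + v) / sqrt n" if "0 < n" for n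
  proof -
    have "expectation (\<lambda>\<omega>. \<bar>(\<Sum>j<n. walk j (noise_path \<omega>)) / real n ^ 2\<bar>)
        \<le> expectation (\<lambda>\<omega>. (\<Sum>j<n. \<bar>walk j (noise_path \<omega>)\<bar>) / real n ^ 2)"
      using integrable_walk by (intro integral_mono) (auto intro!: divide_right_mono sum_abs)
    also have "\<dots> = (\<Sum>j<n. expectation (\<lambda>\<omega>. \<bar>walk j (noise_path \<omega>)\<bar>)) / real n ^ 2"
      using integrable_walk by simp
    also have "\<dots> \<le> (\<Sum>j<n. (1 + v) * sqrt n) / real n ^ 2"
      by (intro divide_right_mono sum_mono walk_first_moment) auto
    also have "\<dots> = (1 + v) / sqrt n"
      using that by (simp add: field_simps power2_eq_square)
    finally show ?thesis .
  qed
  then show "\<forall>\<^sub>F n in sequentially. expectation (\<lambda>\<omega>. \<bar>(\<Sum>j<n. walk j (noise_path \<omega>)) / real n ^ 2\<bar>) \<le> (1 + v) / sqrt n"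
    by (intro eventually_mono[OF eventually_gt_at_top[of 0]])
qed

lemma sum_weighted_walk_vanishes: "vanishes_in_prob (\<lambda>n \<omega>. (\<Sum>j<n. real j * walk j (noise_path \<omega>)) / real n ^ 3)"
proof (rule vanishes_in_prob_L1[where c="\<lambda>n. (1 + v) / sqrt n"])
  show "(\<lambda>n. (1 + v) / sqrt (real n)) \<longlonglongrightarrow> 0" by real_asymp
  show "integrable M (\<lambda>\<omega>. (\<Sum>j<n. real j * walk j (noise_path \<omega>)) / real n ^ 3)" for n
    using integrable_walk by auto
  have "expectation (\<lambda>\<omega>. \<bar>(\<Sum>j<n. real j * walk j (noise_path \<omega>)) / real n ^ 3\<bar>) \<le> (1 + v) / sqrt n" if "0 < n" for n
  proof -
    have "expectation (\<lambda>\<omega>. \<bar>(\<Sum>j<n. real j * walk j (noise_path \<omega>)) / real n ^ 3\<bar>)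
        \<le> expectation (\<lambda>\<omega>. (\<Sum>j<n. real j * \<bar>walk j (noise_path \<omega>)\<bar>) / real n ^ 3)"
    proof (rule integral_mono)
      fix \<omega>
      show "\<bar>(\<Sum>j<n. real j * walk j (noise_path \<omega>)) / real n ^ 3\<bar> \<le> (\<Sum>j<n. real j * \<bar>walk j (noise_path \<omega>)\<bar>) / real n ^ 3"
        using sum_abs[of "\<lambda>j. real j * walk j (noise_path \<omega>)" "{..<n}"]
        by (auto simp: abs_mult intro!: divide_right_mono)
    qed (use integrable_walk in auto)
    also have "\<dots> = (\<Sum>j<n. real j * expectation (\<lambda>\<omega>. \<bar>walk j (noise_path \<omega>)\<bar>)) / real n ^ 3"
      using integrable_walk by simp
    also have "\<dots> \<le> (\<Sum>j<n. real n * ((1 + v) * sqrt n)) / real n ^ 3"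
      using v_nonneg by (intro divide_right_mono sum_mono mult_mono walk_first_moment) auto
    also have "\<dots> = (1 + v) / sqrt n"
      using that by (simp add: field_simps power3_eq_cube)
    finally show ?thesis .
  qed
  then show "\<forall>\<^sub>F n in sequentially. expectation (\<lambda>\<omega>. \<bar>(\<Sum>j<n. real j * walk j (noise_path \<omega>)) / real n ^ 3\<bar>) \<le> (1 + v) / sqrt n"
    by (intro eventually_mono[OF eventually_gt_at_top[of 0]])
qed

lemma sum_walk_square_vanishes: "vanishes_in_prob (\<lambda>n \<omega>. (\<Sum>j<n. (walk j (noise_path \<omega>))\<^sup>2) / real n ^ 3)"
proof (rule vanishes_in_prob_L1[where c="\<lambda>n. v / n"])
  show "(\<lambda>n. v / real n) \<longlonglongrightarrow> 0" by real_asymp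
  show "integrable M (\<lambda>\<omega>. (\<Sum>j<n. (walk j (noise_path \<omega>))\<^sup>2) / real n ^ 3)" for n
    using walk_second_moment by auto
  have "expectation (\<lambda>\<omega>. \<bar>(\<Sum>j<n. (walk j (noise_path \<omega>))\<^sup>2) / real n ^ 3\<bar>) \<le> v / n" if "0 < n" for n
  proof -
    have "expectation (\<lambda>\<omega>. \<bar>(\<Sum>j<n. (walk j (noise_path \<omega>))\<^sup>2) / real n ^ 3\<bar>)
        = (\<Sum>j<n. v * j) / real n ^ 3"
      using walk_second_moment by (simp add: sum_nonneg)
    also have "\<dots> \<le> (\<Sum>j<n. v * n) / real n ^ 3"
      using v_nonneg by (intro divide_right_mono sum_mono mult_left_mono) auto
    also have "\<dots> = v / n"
      using that by (simp add: field_simps power3_eq_cube)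
    finally show ?thesis .
  qed
  then show "\<forall>\<^sub>F n in sequentially. expectation (\<lambda>\<omega>. \<bar>(\<Sum>j<n. (walk j (noise_path \<omega>))\<^sup>2) / real n ^ 3\<bar>) \<le> v / n"
    by (intro eventually_mono[OF eventually_gt_at_top[of 0]])
qed

lemma expectation_sum_squares:
  "integrable M (\<lambda>\<omega>. \<Sum>i<m. (e i \<omega>)\<^sup>2)" "expectation (\<lambda>\<omega>. \<Sum>i<m. (e i \<omega>)\<^sup>2) = v * m"
  using integrable_e_square by (auto simp: second_moment)

lemma sum_walk_increments_vanishes:
  "vanishes_in_prob (\<lambda>n \<omega>. (\<Sum>j<n. walk j (noise_path \<omega>) * e j \<omega>) / (n * sqrt n))"
proof (rule vanishes_in_prob_L1[where c="\<lambda>n. v / sqrt n"])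
  show "(\<lambda>n. v / sqrt (real n)) \<longlonglongrightarrow> 0" by real_asymp
  note ints = walk_second_moment expectation_sum_squares
  show "integrable M (\<lambda>\<omega>. (\<Sum>j<n. walk j (noise_path \<omega>) * e j \<omega>) / (n * sqrt n))" for n
    unfolding sum_walk_increments using ints by auto
  have "expectation (\<lambda>\<omega>. \<bar>(\<Sum>j<n. walk j (noise_path \<omega>) * e j \<omega>) / (n * sqrt n)\<bar>) \<le> v / sqrt n" if "0 < n" for n
  proof -
    have "expectation (\<lambda>\<omega>. \<bar>(\<Sum>j<n. walk j (noise_path \<omega>) * e j \<omega>) / (n * sqrt n)\<bar>)
      \<le> expectation (\<lambda>\<omega>. ((walk n (noise_path \<omega>))\<^sup>2 + (\<Sum>j<n. (e j \<omega>)\<^sup>2)) / 2 / (n * sqrt n))"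
    proof (rule integral_mono)
      fix \<omega>
      have ab: "\<bar>(A - B) / 2\<bar> \<le> (A + B) / 2" if "0 \<le> A" "0 \<le> B" for A B :: real
        using that by (simp add: abs_if field_simps)
      have "0 \<le> (\<Sum>j<n. (e j \<omega>)\<^sup>2)" by (simp add: sum_nonneg)
      then have "\<bar>(\<Sum>j<n. walk j (noise_path \<omega>) * e j \<omega>)\<bar> \<le> ((walk n (noise_path \<omega>))\<^sup>2 + (\<Sum>j<n. (e j \<omega>)\<^sup>2)) / 2"
        unfolding sum_walk_increments by (intro ab) auto
      then show "\<bar>(\<Sum>j<n. walk j (noise_path \<omega>) * e j \<omega>) / (n * sqrt n)\<bar>
          \<le> ((walk n (noise_path \<omega>))\<^sup>2 + (\<Sum>j<n. (e j \<omega>)\<^sup>2)) / 2 / (n * sqrt n)"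
        by (simp add: abs_divide abs_mult divide_right_mono del: divide_divide_eq_left)
    qed (use ints in \<open>auto simp: sum_walk_increments\<close>)
    also have "\<dots> = v * n / (n * sqrt n)" using ints[of n] ints(3,4)[of n] by simp
    also have "\<dots> = v / sqrt n" using that by simp
    finally show ?thesis .
  qed
  then show "\<forall>\<^sub>F n in sequentially. expectation (\<lambda>\<omega>. \<bar>(\<Sum>j<n. walk j (noise_path \<omega>) * e j \<omega>) / (n * sqrt n)\<bar>) \<le> v / sqrt n"
    by (intro eventually_mono[OF eventually_gt_at_top[of 0]])
qed

lemma sum_walk_prev: "(\<Sum>j<Suc m. walk j x * prev x j) = ((walk m x)\<^sup>2 + (\<Sum>j<m. (x j)\<^sup>2)) / 2"
proof -
  have "(\<Sum>j<Suc m. walk j x * prev x j) = (\<Sum>i<m. walk i x * x i) + (\<Sum>i<m. (x i)\<^sup>2)"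
    unfolding sum_prev_shift sum.distrib[symmetric]
    by (simp add: walk_def algebra_simps power2_eq_square)
  then show ?thesis unfolding sum_walk_increments by (simp add: field_simps del: sum.lessThan_Suc)
qed

lemma sum_walk_prev_vanishes: "vanishes_in_prob (\<lambda>n \<omega>. (\<Sum>j<n. walk j (noise_path \<omega>) * prev (noise_path \<omega>) j) / real n ^ 2)"
proof (rule vanishes_in_prob_L1[where c="\<lambda>n. v / n"])
  show "(\<lambda>n. v / real n) \<longlonglongrightarrow> 0" by real_asymp
  note ints = walk_second_moment expectation_sum_squares
  have *: "integrable M (\<lambda>\<omega>. (\<Sum>j<n. walk j (noise_path \<omega>) * prev (noise_path \<omega>) j) / real n ^ 2) \<and>
    expectation (\<lambda>\<omega>. \<bar>(\<Sum>j<n. walk j (noise_path \<omega>) * prev (noise_path \<omega>) j) / real n ^ 2\<bar>) \<le> v / n" for n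
  proof (cases n)
    case (Suc m)
    have nn: "0 \<le> (walk m (noise_path \<omega>))\<^sup>2 + (\<Sum>j<m. (e j \<omega>)\<^sup>2)" for \<omega> by (simp add: sum_nonneg)
    have "expectation (\<lambda>\<omega>. \<bar>(\<Sum>j<n. walk j (noise_path \<omega>) * prev (noise_path \<omega>) j) / real n ^ 2\<bar>)
       = expectation (\<lambda>\<omega>. ((walk m (noise_path \<omega>))\<^sup>2 + (\<Sum>j<m. (e j \<omega>)\<^sup>2)) / 2 / real n ^ 2)"
      unfolding Suc sum_walk_prev by (subst abs_of_nonneg) (use nn in auto)
    also have "\<dots> = v * m / real n ^ 2" using ints[of m] ints(3,4)[of m] by simp
    also have "\<dots> \<le> v * n / real n ^ 2" using Suc v_nonneg by (intro divide_right_mono mult_left_mono) auto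
    also have "\<dots> = v / n" by (simp add: power2_eq_square)
    finally have "expectation (\<lambda>\<omega>. \<bar>(\<Sum>j<n. walk j (noise_path \<omega>) * prev (noise_path \<omega>) j) / real n ^ 2\<bar>) \<le> v / n" .
    moreover have "integrable M (\<lambda>\<omega>. (\<Sum>j<n. walk j (noise_path \<omega>) * prev (noise_path \<omega>) j) / real n ^ 2)"
      unfolding Suc sum_walk_prev using ints by auto
    ultimately show ?thesis by blast
  qed simp
  then show "integrable M (\<lambda>\<omega>. (\<Sum>j<n. walk j (noise_path \<omega>) * prev (noise_path \<omega>) j) / real n ^ 2)"
    "\<forall>\<^sub>F n in sequentially. expectation (\<lambda>\<omega>. \<bar>(\<Sum>j<n. walk j (noise_path \<omega>) * prev (noise_path \<omega>) j) / real n ^ 2\<bar>) \<le> v / n" for n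
    by auto
qed

text \<open>
  Re-indexed, the sum is a martingale transform with bounded weights, so its second moment is of
  order \<open>n\<close>.
\<close>

lemma weighted_prev_vanishes:
  assumes "\<And>n j. j < n \<Longrightarrow> \<bar>f n j\<bar> \<le> (1::real)"
  shows "vanishes_in_prob (\<lambda>n \<omega>. (\<Sum>j<n. f n j * prev (noise_path \<omega>) j) / n)"
proof (rule vanishes_in_prob_L2[where c="\<lambda>n. v / n"])
  show "(\<lambda>n. v / real n) \<longlonglongrightarrow> 0" by real_asymp
  have *: "integrable M (\<lambda>\<omega>. ((\<Sum>j<n. f n j * prev (noise_path \<omega>) j) / n)\<^sup>2) \<and>
    expectation (\<lambda>\<omega>. ((\<Sum>j<n. f n j * prev (noise_path \<omega>) j) / n)\<^sup>2) \<le> v / n" for n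
  proof (cases n)
    case (Suc m)
    have eq: "(\<Sum>j<n. f n j * prev x j) = martingale_transform (\<lambda>i. f n (Suc i)) (\<lambda>_. 0) m x" for x
      by (simp add: Suc sum_prev_shift martingale_transform_def coef_def del: sum.lessThan_Suc)
    note sm = second_moment_transform[of "\<lambda>_. 0" "\<lambda>i. f n (Suc i)" m, simplified]
    have "(\<Sum>i<m. (f n (Suc i))\<^sup>2) \<le> (\<Sum>i<m. 1)"
      using assms Suc by (intro sum_mono) (auto simp: abs_square_le_1)
    also have "\<dots> \<le> n" by (simp add: Suc)
    finally have "v * (\<Sum>i<m. (f n (Suc i))\<^sup>2) / real n ^ 2 \<le> v * n / real n ^ 2"
      using v_nonneg by (intro divide_right_mono mult_left_mono) auto
    moreover have "0 < n" using Suc by simp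
    then have "v * n / real n ^ 2 = v / n" by (simp add: power2_eq_square)
    ultimately show ?thesis
      unfolding eq power_divide using sm by simp
  qed simp
  then show "integrable M (\<lambda>\<omega>. ((\<Sum>j<n. f n j * prev (noise_path \<omega>) j) / n)\<^sup>2)"
    "\<forall>\<^sub>F n in sequentially. expectation (\<lambda>\<omega>. ((\<Sum>j<n. f n j * prev (noise_path \<omega>) j) / n)\<^sup>2) \<le> v / n" for n
    by auto
qed

lemma mean_square_prev_tends: "vanishes_in_prob (\<lambda>n \<omega>. (\<Sum>j<n. (prev (noise_path \<omega>) j)\<^sup>2) / n - v)"
proof -
  have shift: "(\<Sum>j<Suc m. (prev x j)\<^sup>2) = (\<Sum>i<m. (x i)\<^sup>2)" for x m
    by (subst sum.lessThan_Suc_shift) (simp add: prev_def)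
  define T where "T n \<omega> = (\<Sum>i<n - 1. (e i \<omega>)\<^sup>2 - v) / n" for n \<omega>
  have "vanishes_in_prob T"
  proof (rule vanishes_in_prob_L2[where c="\<lambda>n. \<kappa> / n"])
    show "(\<lambda>n. \<kappa> / real n) \<longlonglongrightarrow> 0" by real_asymp
    show "integrable M (\<lambda>\<omega>. (T n \<omega>)\<^sup>2)" for n
      unfolding T_def power_divide using sum_squares_second_moment by auto
    have "expectation (\<lambda>\<omega>. (T n \<omega>)\<^sup>2) \<le> \<kappa> / n" for n
    proof (cases "n = 0")
      case False
      have "expectation (\<lambda>\<omega>. (T n \<omega>)\<^sup>2) = expectation (\<lambda>\<omega>. (\<Sum>i<n - 1. (e i \<omega>)\<^sup>2 - v)\<^sup>2) / real n ^ 2"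
        unfolding T_def power_divide by simp
      also have "\<dots> \<le> \<kappa> * real (n - 1) / real n ^ 2"
        using sum_squares_second_moment[of "n - 1"] by (intro divide_right_mono) auto
      also have "\<dots> \<le> \<kappa> * n / real n ^ 2" using kappa_nonneg by (intro divide_right_mono mult_left_mono) auto
      also have "\<dots> = \<kappa> / n" using False by (simp add: power2_eq_square)
      finally show ?thesis .
    qed (simp add: T_def)
    then show "\<forall>\<^sub>F n in sequentially. expectation (\<lambda>\<omega>. (T n \<omega>)\<^sup>2) \<le> \<kappa> / n" by simp
  qed
  moreover have "vanishes_in_prob (\<lambda>(n::nat) \<omega>. (if n = (0::nat) then - v else - v / n))"
  proof (rule vanishes_in_prob_const)
    have "(\<lambda>n. - v / real n) \<longlonglongrightarrow> 0" by real_asymp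
    then show "(\<lambda>n::nat. if n = (0::nat) then - v else - v / n) \<longlonglongrightarrow> 0"
      by (rule Lim_transform_eventually) (rule eventually_mono[OF eventually_gt_at_top[of 0]], simp)
  qed
  ultimately have "vanishes_in_prob (\<lambda>n \<omega>. T n \<omega> + (if n = (0::nat) then - v else - v / n))"
    by (rule vanishes_in_prob_add)
  then show ?thesis
  proof (rule vanishes_in_prob_mono, intro AE_I2)
    fix n \<omega>
    show "norm ((\<Sum>j<n. (prev (noise_path \<omega>) j)\<^sup>2) / n - v) \<le> norm (T n \<omega> + (if n = (0::nat) then - v else - v / n))"
    proof (cases n)
      case (Suc m)
      have "(\<Sum>j<n. (prev (noise_path \<omega>) j)\<^sup>2) / n - v = T n \<omega> - v / n"
      proof -
        have "0 < n" using Suc by simp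
        have "T n \<omega> - v / n = ((\<Sum>i<m. (e i \<omega>)\<^sup>2) - real n * v) / n"
          by (simp add: T_def Suc sum_subtractf diff_divide_distrib[symmetric] algebra_simps)
        also have "\<dots> = (\<Sum>i<m. (e i \<omega>)\<^sup>2) / n - v"
          using \<open>0 < n\<close> by (simp add: diff_divide_distrib)
        finally show ?thesis using Suc shift[of "noise_path \<omega>" m] by simp
      qed
      then show ?thesis using Suc by simp
    qed (simp add: T_def)
  qed
qed

lemma lag_eq_prev: "lag \<mu> j x = (if j = 0 then - \<mu> else 0) + prev x j"
  by (simp add: lag_def prev_def)

lemma sum_if_zero: "0 < n \<Longrightarrow> (\<Sum>j<n::nat. (if j = 0 then c j else 0)) = (c 0 :: real)"
  by (cases n) (simp_all add: sum.lessThan_Suc_shift del: sum.lessThan_Suc)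

text \<open>
  The level is \<open>\<mu> j\<close> up to a random walk of order \<open>n\<^sup>1\<^sup>/\<^sup>2\<close>, so its normalised sums are governed by the
  drift: this lemma and the following ones determine the limit of the Gram matrix of the regressors
  \<open>level\<close>, \<open>lag\<close> and \<open>1\<close>, scaled by \<open>n\<^sup>3\<^sup>/\<^sup>2\<close>, \<open>n\<^sup>1\<^sup>/\<^sup>2\<close> and \<open>n\<^sup>1\<^sup>/\<^sup>2\<close>.
\<close>

lemma gram_level_level: "vanishes_in_prob (\<lambda>n \<omega>. (\<Sum>j<n. (level \<mu> j (noise_path \<omega>))\<^sup>2) / real n ^ 3 - \<mu>\<^sup>2 / 3)"
proof -
  have eq: "(\<Sum>j<n. (level \<mu> j x)\<^sup>2) / real n ^ 3 - \<mu>\<^sup>2 / 3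
      = (\<mu>\<^sup>2 * (real n * (real n - 1) * (2 * real n - 1) / 6) / real n ^ 3 - \<mu>\<^sup>2 / 3)
        + (2 * \<mu> * ((\<Sum>j<n. real j * walk j x) / real n ^ 3) + (\<Sum>j<n. (walk j x)\<^sup>2) / real n ^ 3)" for n x
  proof -
    have "(level \<mu> j x)\<^sup>2 = \<mu>\<^sup>2 * (real j)\<^sup>2 + 2 * \<mu> * (real j * walk j x) + (walk j x)\<^sup>2" for j
      by (simp add: level_def power2_eq_square algebra_simps)
    then have "(\<Sum>j<n. (level \<mu> j x)\<^sup>2) = \<mu>\<^sup>2 * (\<Sum>j<n. (real j)\<^sup>2)
        + 2 * \<mu> * (\<Sum>j<n. real j * walk j x) + (\<Sum>j<n. (walk j x)\<^sup>2)"
      by (simp add: sum.distrib sum_distrib_left)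
    then show ?thesis unfolding sum_squares_lessThan_real by (simp add: add_divide_distrib)
  qed
  have "(\<lambda>n. \<mu>\<^sup>2 * (real n * (real n - 1) * (2 * real n - 1) / 6) / real n ^ 3 - \<mu>\<^sup>2 / 3) \<longlonglongrightarrow> 0"
    by real_asymp
  then show ?thesis
    unfolding eq by (intro vanishes_in_prob_add vanishes_in_prob_cmult vanishes_in_prob_const
        sum_weighted_walk_vanishes sum_walk_square_vanishes)
qed

lemma gram_level_one: "vanishes_in_prob (\<lambda>n \<omega>. (\<Sum>j<n. level \<mu> j (noise_path \<omega>)) / real n ^ 2 - \<mu> / 2)"
proof -
  have eq: "(\<Sum>j<n. level \<mu> j x) / real n ^ 2 - \<mu> / 2
      = (\<mu> * (real n * (real n - 1) / 2) / real n ^ 2 - \<mu> / 2) + (\<Sum>j<n. walk j x) / real n ^ 2" for n x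
    unfolding sum_lessThan_real[symmetric] by (simp add: level_def sum.distrib sum_distrib_left add_divide_distrib)
  have "(\<lambda>n. \<mu> * (real n * (real n - 1) / 2) / real n ^ 2 - \<mu> / 2) \<longlonglongrightarrow> 0" by real_asymp
  then show ?thesis
    unfolding eq by (intro vanishes_in_prob_add vanishes_in_prob_const sum_walk_vanishes)
qed

lemma gram_level_lag: "vanishes_in_prob (\<lambda>n \<omega>. (\<Sum>j<n. level \<mu> j (noise_path \<omega>) * lag \<mu> j (noise_path \<omega>)) / real n ^ 2)"
proof -
  have eq: "(\<Sum>j<n. level \<mu> j x * lag \<mu> j x) / real n ^ 2
      = \<mu> * ((\<Sum>j<n. (real j / n) * prev x j) / n) + (\<Sum>j<n. walk j x * prev x j) / real n ^ 2" for n x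
  proof -
    have "level \<mu> j x * lag \<mu> j x = \<mu> * (real j * prev x j) + walk j x * prev x j" for j
      by (cases j) (simp_all add: level_def lag_eq_prev walk_def algebra_simps)
    then have "(\<Sum>j<n. level \<mu> j x * lag \<mu> j x) = \<mu> * (\<Sum>j<n. real j * prev x j) + (\<Sum>j<n. walk j x * prev x j)"
      by (simp add: sum.distrib sum_distrib_left)
    moreover have "(\<Sum>j<n. (real j / n) * prev x j) / n = (\<Sum>j<n. real j * prev x j) / real n ^ 2"
      by (simp add: sum_divide_distrib power2_eq_square)
    ultimately show ?thesis by (simp add: add_divide_distrib)
  qed
  show ?thesis
    unfolding eq
    by (intro vanishes_in_prob_add vanishes_in_prob_cmult weighted_prev_vanishes sum_walk_prev_vanishes) auto
qed

lemma gram_lag_one: "vanishes_in_prob (\<lambda>n \<omega>. (\<Sum>j<n. lag \<mu> j (noise_path \<omega>)) / n)"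
proof -
  have eq: "(\<Sum>j<n. lag \<mu> j x) / n = - \<mu> / n + (\<Sum>j<n. 1 * prev x j) / n" for n x
    by (cases "n = 0") (auto simp: lag_eq_prev sum.distrib sum_if_zero add_divide_distrib diff_divide_distrib)
  have "(\<lambda>n. - \<mu> / real n) \<longlonglongrightarrow> 0" by real_asymp
  then show ?thesis
    unfolding eq by (intro vanishes_in_prob_add vanishes_in_prob_const weighted_prev_vanishes) auto
qed

lemma gram_lag_lag: "vanishes_in_prob (\<lambda>n \<omega>. (\<Sum>j<n. (lag \<mu> j (noise_path \<omega>))\<^sup>2) / n - v)"
proof -
  have eq: "(\<Sum>j<n. (lag \<mu> j x)\<^sup>2) / n - v = \<mu>\<^sup>2 / n + ((\<Sum>j<n. (prev x j)\<^sup>2) / n - v)" for n x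
  proof -
    have "(lag \<mu> j x)\<^sup>2 = (if j = 0 then \<mu>\<^sup>2 else 0) + (prev x j)\<^sup>2" for j
      by (simp add: lag_def prev_def)
    then show ?thesis
      by (cases "n = 0") (auto simp: sum.distrib sum_if_zero add_divide_distrib diff_divide_distrib)
  qed
  have "(\<lambda>n. \<mu>\<^sup>2 / real n) \<longlonglongrightarrow> 0" by real_asymp
  then show ?thesis
    unfolding eq by (intro vanishes_in_prob_add vanishes_in_prob_const mean_square_prev_tends)
qed

text \<open>
  Replacing the level by its drift makes the weights of the score deterministic.
\<close>

lemma score_level:
  "vanishes_in_prob (\<lambda>n \<omega>. (\<Sum>j<n. level \<mu> j (noise_path \<omega>) * e j \<omega>) / (n * sqrt n)
      - martingale_transform (\<lambda>j. \<mu> * (j / n) / sqrt n) (\<lambda>_. 0) n (noise_path \<omega>))"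
proof -
  have eq: "(\<Sum>j<n. level \<mu> j x * x j) / (n * sqrt n) - martingale_transform (\<lambda>j. \<mu> * (j / n) / sqrt n) (\<lambda>_. 0) n x
      = (\<Sum>j<n. walk j x * x j) / (n * sqrt n)" for n x
    by (simp add: level_def martingale_transform_def coef_def distrib_right sum.distrib add_divide_distrib sum_divide_distrib)
  show ?thesis unfolding eq by (rule sum_walk_increments_vanishes)
qed

lemma score_lag:
  "vanishes_in_prob (\<lambda>n \<omega>. (\<Sum>j<n. lag \<mu> j (noise_path \<omega>) * e j \<omega>) / sqrt n
      - martingale_transform (\<lambda>_. 0) (\<lambda>j. if j = 0 then 0 else 1 / sqrt n) n (noise_path \<omega>))"
proof -
  have eq: "(\<Sum>j<n. lag \<mu> j x * x j) / sqrt n - martingale_transform (\<lambda>_. 0) (\<lambda>j. if j = 0 then 0 else 1 / sqrt n) n x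
      = (- \<mu> / sqrt n) * x 0" for n x
  proof (cases n)
    case (Suc m)
    then show ?thesis
      by (simp add: lag_def prev_def martingale_transform_def coef_def sum.lessThan_Suc_shift add_divide_distrib diff_divide_distrib sum_divide_distrib del: sum.lessThan_Suc)
  qed (simp add: martingale_transform_def)
  have "(\<lambda>n. - \<mu> / sqrt (real n)) \<longlonglongrightarrow> 0" by real_asymp
  moreover have "bounded_in_prob (\<lambda>n. e 0)"
    by (rule bounded_in_prob_L1[of _ "expectation (\<lambda>\<omega>. \<bar>e 0 \<omega>\<bar>)"]) (auto intro: integrable_e)
  ultimately show ?thesis
    unfolding eq by (intro vanishes_in_prob_mult_bounded vanishes_in_prob_const)
qed

end

section \<open>The normal equations\<close>

text \<open>
  The limiting Gram matrix has the rows \<open>(\<mu>\<^sup>2/3, 0, \<mu>/2)\<close>, \<open>(0, v, 0)\<close>, \<open>(\<mu>/2, 0, 1)\<close>. It is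
  invertible, and \<open>(u0, c0, w0)\<close> solves the limiting system. A perturbation of size \<open>\<delta>\<close> of matrix and
  right hand side moves the solution by at most a multiple of \<open>\<delta>\<close> times its own size; for \<open>K \<delta> \<le> 1/2\<close>
  the perturbed solution is itself controlled by the limiting one.
\<close>

lemma perturbed_normal_equations:
  fixes \<mu> v :: real
  assumes \<mu>: "0 < \<mu>" and v: "0 < v"
  obtains K where "0 < K" "\<And>\<delta> g11 g12 g13 g22 g23 s1 s2 s3 u c w u0 c0 w0.
    \<bar>g11 - \<mu>\<^sup>2 / 3\<bar> \<le> \<delta> \<Longrightarrow> \<bar>g12\<bar> \<le> \<delta> \<Longrightarrow> \<bar>g13 - \<mu> / 2\<bar> \<le> \<delta> \<Longrightarrow> \<bar>g22 - v\<bar> \<le> \<delta> \<Longrightarrow> \<bar>g23\<bar> \<le> \<delta> \<Longrightarrow>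
    \<bar>(g11 * u + g12 * c + g13 * w) - s1\<bar> \<le> \<delta> \<Longrightarrow> \<bar>(g12 * u + g22 * c + g23 * w) - s2\<bar> \<le> \<delta> \<Longrightarrow>
    g13 * u + g23 * c + w = s3 \<Longrightarrow>
    u0 = 12 / \<mu>\<^sup>2 * (s1 - \<mu> / 2 * s3) \<Longrightarrow> c0 = s2 / v \<Longrightarrow> w0 = s3 - \<mu> / 2 * u0 \<Longrightarrow> K * \<delta> \<le> 1 / 2 \<Longrightarrow>
    \<bar>u - u0\<bar> + \<bar>c - c0\<bar> + \<bar>w - w0\<bar> \<le> 2 * K * \<delta> * (1 + (\<bar>u0\<bar> + \<bar>c0\<bar> + \<bar>w0\<bar>))"
proof
  \<comment> \<open>\<open>\<alpha>\<close> is the amplification of the defects in the first unknown; \<open>K\<close> sums those of all three\<close>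
  define \<alpha> where "\<alpha> = 12 / \<mu>\<^sup>2 * (1 + \<mu> / 2)"
  define K where "K = \<alpha> + 1 / v + (1 + \<mu> / 2 * \<alpha>)"
  have \<alpha>: "0 < \<alpha>" using \<mu> by (simp add: \<alpha>_def)
  show "0 < K" unfolding K_def using \<alpha> \<mu> v by (intro add_pos_pos mult_pos_pos) auto
  fix \<delta> g11 g12 g13 g22 g23 s1 s2 s3 u c w u0 c0 w0 :: real
  assume g: "\<bar>g11 - \<mu>\<^sup>2 / 3\<bar> \<le> \<delta>" "\<bar>g12\<bar> \<le> \<delta>" "\<bar>g13 - \<mu> / 2\<bar> \<le> \<delta>" "\<bar>g22 - v\<bar> \<le> \<delta>" "\<bar>g23\<bar> \<le> \<delta>"
    and s: "\<bar>(g11 * u + g12 * c + g13 * w) - s1\<bar> \<le> \<delta>" "\<bar>(g12 * u + g22 * c + g23 * w) - s2\<bar> \<le> \<delta>"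
      "g13 * u + g23 * c + w = s3"
    and u0: "u0 = 12 / \<mu>\<^sup>2 * (s1 - \<mu> / 2 * s3)" and c0: "c0 = s2 / v" and w0: "w0 = s3 - \<mu> / 2 * u0"
    and K\<delta>: "K * \<delta> \<le> 1 / 2"
  define N where "N = \<bar>u\<bar> + \<bar>c\<bar> + \<bar>w\<bar>"
  define B where "B = \<delta> * (1 + N)"
  have mult: "\<bar>x * y\<bar> \<le> \<delta> * \<bar>y\<bar>" if "\<bar>x\<bar> \<le> \<delta>" for x y
    unfolding abs_mult using that by (intro mult_right_mono) auto
  define d1 where "d1 = s1 - (\<mu>\<^sup>2 / 3 * u + \<mu> / 2 * w)"
  define d2 where "d2 = s2 - v * c"
  define d3 where "d3 = s3 - (\<mu> / 2 * u + w)"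
  have d1: "\<bar>d1\<bar> \<le> B"
  proof -
    have "d1 = (g11 - \<mu>\<^sup>2 / 3) * u + g12 * c + (g13 - \<mu> / 2) * w - ((g11 * u + g12 * c + g13 * w) - s1)"
      by (simp add: d1_def algebra_simps)
    then show ?thesis using mult[OF g(1), of u] mult[OF g(2), of c] mult[OF g(3), of w] s(1)
      unfolding B_def N_def distrib_left by linarith
  qed
  have d2: "\<bar>d2\<bar> \<le> B"
  proof -
    have "d2 = g12 * u + (g22 - v) * c + g23 * w - ((g12 * u + g22 * c + g23 * w) - s2)"
      by (simp add: d2_def algebra_simps)
    then show ?thesis using mult[OF g(2), of u] mult[OF g(4), of c] mult[OF g(5), of w] s(2)
      unfolding B_def N_def distrib_left by linarith
  qed
  have d0: "0 \<le> \<delta>" using g(2) by linarith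
  have d3: "\<bar>d3\<bar> \<le> B"
  proof -
    have "d3 = (g13 - \<mu> / 2) * u + g23 * c"
      by (simp add: d3_def s(3)[symmetric] algebra_simps)
    moreover have "0 \<le> \<delta> * \<bar>w\<bar>" using d0 by simp
    ultimately show ?thesis using mult[OF g(3), of u] mult[OF g(5), of c] d0
      unfolding B_def N_def distrib_left by linarith
  qed
  have u: "\<bar>u - u0\<bar> \<le> \<alpha> * B"
  proof -
    have "u0 - u = 12 / \<mu>\<^sup>2 * (d1 - \<mu> / 2 * d3)"
      using \<mu> by (simp add: u0 d1_def d3_def field_simps power2_eq_square)
    moreover have "\<bar>12 / \<mu>\<^sup>2\<bar> = 12 / \<mu>\<^sup>2" by simp
    ultimately have "\<bar>u - u0\<bar> = 12 / \<mu>\<^sup>2 * \<bar>d1 - \<mu> / 2 * d3\<bar>"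
      by (metis abs_minus_commute abs_mult)
    also have "\<bar>d1 - \<mu> / 2 * d3\<bar> \<le> \<bar>d1\<bar> + \<mu> / 2 * \<bar>d3\<bar>"
      using \<mu> abs_triangle_ineq4[of d1 "\<mu> / 2 * d3"] by (simp add: abs_mult)
    also have "\<dots> \<le> B + \<mu> / 2 * B" using d1 d3 \<mu> by (intro add_mono mult_left_mono) auto
    finally have "\<bar>u - u0\<bar> \<le> 12 / \<mu>\<^sup>2 * (B + \<mu> / 2 * B)" by (simp add: mult_left_mono divide_right_mono)
    also have "\<dots> = \<alpha> * B" by (simp add: \<alpha>_def algebra_simps)
    finally show ?thesis .
  qed
  have c: "\<bar>c - c0\<bar> \<le> 1 / v * B"
  proof -
    have "c0 - c = d2 / v" using v by (simp add: c0 d2_def field_simps)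
    then have "\<bar>c - c0\<bar> = \<bar>d2\<bar> / v" using v by (simp add: abs_minus_commute abs_divide)
    then show ?thesis using d2 v by (simp add: divide_right_mono)
  qed
  have w: "\<bar>w - w0\<bar> \<le> (1 + \<mu> / 2 * \<alpha>) * B"
  proof -
    have "w - w0 = \<mu> / 2 * (u0 - u) - d3" by (simp add: w0 d3_def field_simps)
    then have "\<bar>w - w0\<bar> \<le> \<mu> / 2 * \<bar>u - u0\<bar> + \<bar>d3\<bar>"
      using \<mu> abs_triangle_ineq4[of "\<mu> / 2 * (u0 - u)" d3] by (simp add: abs_mult abs_minus_commute)
    also have "\<dots> \<le> \<mu> / 2 * (\<alpha> * B) + B" using u d3 \<mu> by (intro add_mono mult_left_mono) auto
    finally show ?thesis by (simp add: algebra_simps)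
  qed
  define Err where "Err = \<bar>u - u0\<bar> + \<bar>c - c0\<bar> + \<bar>w - w0\<bar>"
  define N0 where "N0 = \<bar>u0\<bar> + \<bar>c0\<bar> + \<bar>w0\<bar>"
  have "Err \<le> K * B" unfolding Err_def K_def distrib_right using u c w by (simp add: distrib_right)
  then have E: "Err \<le> K * \<delta> * (1 + N)" by (simp add: B_def)
  have "N \<le> N0 + Err" unfolding N_def N0_def Err_def by linarith
  moreover have "K * \<delta> * (1 + N) \<le> 1 / 2 * (1 + N)" by (intro mult_right_mono K\<delta>) (simp add: N_def)
  ultimately have "1 + N \<le> 2 * (1 + N0)" using E by (simp add: field_simps)
  then have "K * \<delta> * (1 + N) \<le> K * \<delta> * (2 * (1 + N0))"
    using d0 \<open>0 < K\<close> by (intro mult_left_mono) auto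
  with E have "Err \<le> 2 * K * \<delta> * (1 + N0)" by (simp add: algebra_simps)
  then show "\<bar>u - u0\<bar> + \<bar>c - c0\<bar> + \<bar>w - w0\<bar> \<le> 2 * K * \<delta> * (1 + (\<bar>u0\<bar> + \<bar>c0\<bar> + \<bar>w0\<bar>))"
    by (simp add: Err_def N0_def)
qed

text \<open>
  First order condition: the quadratic \<open>s\<^sup>2 Q - 2 s P\<close> can only be nonnegative for all \<open>s\<close> if its linear
  coefficient vanishes, as \<open>s = P / (Q + 1)\<close> shows.
\<close>

lemma minimizer_orthogonal:
  fixes r g :: "'i \<Rightarrow> real"
  assumes "finite A" "\<And>s. (\<Sum>i\<in>A. (r i)\<^sup>2) \<le> (\<Sum>i\<in>A. (r i - s * g i)\<^sup>2)"
  shows "(\<Sum>i\<in>A. r i * g i) = 0"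
proof -
  define P where "P = (\<Sum>i\<in>A. r i * g i)"
  define Q where "Q = (\<Sum>i\<in>A. (g i)\<^sup>2)"
  have Q: "0 \<le> Q" by (simp add: Q_def sum_nonneg)
  have "(\<Sum>i\<in>A. (r i - s * g i)\<^sup>2) = (\<Sum>i\<in>A. (r i)\<^sup>2) - 2 * s * P + s\<^sup>2 * Q" for s
    by (simp add: P_def Q_def power2_diff power_mult_distrib sum.distrib sum_subtractf sum_distrib_left algebra_simps)
  then have *: "2 * s * P \<le> s\<^sup>2 * Q" for s using assms(2)[of s] by simp
  define s where "s = P / (Q + 1)"
  have "2 * P * P * (Q + 1) \<le> P * P * Q"
  proof -
    have sk: "s * (Q + 1) = P" using Q by (simp add: s_def)
    have "2 * s * P * (Q + 1)\<^sup>2 \<le> s\<^sup>2 * Q * (Q + 1)\<^sup>2"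
      by (intro mult_right_mono *) simp
    moreover have "2 * s * P * (Q + 1)\<^sup>2 = 2 * (s * (Q + 1)) * P * (Q + 1)"
      "s\<^sup>2 * Q * (Q + 1)\<^sup>2 = (s * (Q + 1)) * (s * (Q + 1)) * Q"
      by (simp_all only: power2_eq_square mult_ac)
    ultimately show ?thesis by (simp only: sk)
  qed
  then have "P * P * (Q + 2) \<le> 0" by (simp add: algebra_simps)
  moreover have "0 \<le> P * P" by simp
  ultimately have "P * P = 0" using Q by (metis add_nonneg_pos mult_le_0_iff not_le antisym zero_less_numeral)
  then show ?thesis by (simp add: P_def)
qed

text \<open>
  The martingale transforms with weights affine in \<open>j/n\<close>. They are closed under linear combination, so
  every joint statement about the three scores reduces to a one-dimensional limit theorem for this
  family. The convention \<open>b\<^sub>0 = 0\<close> removes the product with the deterministic \<open>lag\<close> at time \<open>0\<close>.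
\<close>

definition ramp_sum :: "real \<Rightarrow> real \<Rightarrow> real \<Rightarrow> nat \<Rightarrow> (nat \<Rightarrow> real) \<Rightarrow> real" where
  "ramp_sum p q r n = martingale_transform (\<lambda>j. (p + q * (j / n)) / sqrt n) (\<lambda>j. if j = 0 then 0 else r / sqrt n) n"

lemma ramp_sum_linear:
  "s * ramp_sum p q r n x + s' * ramp_sum p' q' r' n x = ramp_sum (s * p + s' * p') (s * q + s' * q') (s * r + s' * r') n x"
  unfolding ramp_sum_def martingale_transform_def sum_distrib_left sum.distrib[symmetric]
  by (rule sum.cong) (auto simp: coef_def algebra_simps add_divide_distrib)

lemma ramp_sum_scale: "s * ramp_sum p q r n x = ramp_sum (s * p) (s * q) (s * r) n x"
  using ramp_sum_linear[of s p q r n x 0] by simp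

text \<open>
  A Riemann sum for \<open>\<integral>\<^sub>0\<^sup>1 (p + q x)\<^sup>2 dx\<close>.
\<close>

lemma sum_ramp_squares: "(\<lambda>n. \<Sum>j<n. ((p + q * (real j / real n)) / sqrt (real n))\<^sup>2) \<longlonglongrightarrow> p\<^sup>2 + p * q + q\<^sup>2 / 3"
proof -
  have eq: "(\<Sum>j<n. ((p + q * (real j / real n)) / sqrt (real n))\<^sup>2)
      = p\<^sup>2 + 2 * p * q * (\<Sum>j<n. real j) / real n ^ 2 + q\<^sup>2 * (\<Sum>j<n. (real j)\<^sup>2) / real n ^ 3" if "0 < n" for n
  proof -
    have "((p + q * (real j / real n)) / sqrt (real n))\<^sup>2
        = p\<^sup>2 / real n + 2 * p * q * real j / real n ^ 2 + q\<^sup>2 * (real j)\<^sup>2 / real n ^ 3" for j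
      using that by (simp add: power_divide field_simps power2_eq_square power3_eq_cube)
    then show ?thesis using that
      by (simp add: sum.distrib sum_distrib_left sum_divide_distrib)
  qed
  have "(\<lambda>n. p\<^sup>2 + 2 * p * q * (real n * (real n - 1) / 2) / real n ^ 2
      + q\<^sup>2 * (real n * (real n - 1) * (2 * real n - 1) / 6) / real n ^ 3) \<longlonglongrightarrow> p\<^sup>2 + p * q + q\<^sup>2 / 3"
    by real_asymp
  then show ?thesis
    by (rule Lim_transform_eventually)
       (rule eventually_mono[OF eventually_gt_at_top[of 0]], simp only: eq sum_squares_lessThan_real sum_lessThan_real)
qed

context centred_noise
begin

lemma ramp_variance_limit:
  "(\<lambda>n. v * (\<Sum>j<n. ((p + q * (real j / real n)) / sqrt (real n))\<^sup>2 + (if j = 0 then 0 else r / sqrt (real n))\<^sup>2 * v))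
    \<longlonglongrightarrow> v * (p\<^sup>2 + p * q + q\<^sup>2 / 3 + r\<^sup>2 * v)"
proof -
  have "(\<Sum>j<n. (if j = 0 then 0 else r / sqrt (real n))\<^sup>2) = r\<^sup>2 * (real n - 1) / real n" if "0 < n" for n
    using that by (cases n) (simp_all add: sum.lessThan_Suc_shift power_divide del: sum.lessThan_Suc)
  then have eq: "\<forall>\<^sub>F n in sequentially. r\<^sup>2 * (real n - 1) / real n = (\<Sum>j<n. (if j = 0 then 0 else r / sqrt (real n))\<^sup>2)"
    by (intro eventually_mono[OF eventually_gt_at_top[of 0]]) simp
  have "(\<lambda>n. r\<^sup>2 * (real n - 1) / real n) \<longlonglongrightarrow> r\<^sup>2" by real_asymp
  then have "(\<lambda>n. \<Sum>j<n. (if j = 0 then 0 else r / sqrt (real n))\<^sup>2) \<longlonglongrightarrow> r\<^sup>2"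
    by (rule Lim_transform_eventually[OF _ eq])
  from tendsto_mult_left[OF tendsto_add[OF sum_ramp_squares tendsto_mult_right[OF this]]]
  show ?thesis by (simp add: sum.distrib sum_distrib_right)
qed

lemma ramp_sum_normal_limit:
  "weak_conv_m (\<lambda>n. distr M borel (\<lambda>\<omega>. ramp_sum p q r n (noise_path \<omega>)))
    (normal_law 0 (v * (p\<^sup>2 + p * q + q\<^sup>2 / 3 + r\<^sup>2 * v)))"
  unfolding ramp_sum_def
proof (rule normal_limit_transform[where C = "\<bar>p\<bar> + \<bar>q\<bar> + \<bar>r\<bar>"])
  fix n j :: nat assume j: "j < n"
  have "\<bar>p + q * (j / n)\<bar> \<le> \<bar>p\<bar> + \<bar>q\<bar> * \<bar>real j / real n\<bar>"
    using abs_triangle_ineq[of p "q * (j / n)"] by (simp add: abs_mult)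
  also have "\<dots> \<le> \<bar>p\<bar> + \<bar>q\<bar> * 1" using j by (intro add_left_mono mult_left_mono) auto
  finally show "\<bar>(p + q * (j / n)) / sqrt n\<bar> \<le> (\<bar>p\<bar> + \<bar>q\<bar> + \<bar>r\<bar>) / sqrt n"
    by (simp add: abs_divide divide_right_mono)
  show "\<bar>if j = 0 then 0 else r / sqrt n\<bar> \<le> (\<bar>p\<bar> + \<bar>q\<bar> + \<bar>r\<bar>) / sqrt n"
    by (auto simp: abs_divide divide_right_mono)
qed (simp, rule ramp_variance_limit)

lemma ramp_sum_bounded: "bounded_in_prob (\<lambda>n \<omega>. ramp_sum p q r n (noise_path \<omega>))"
  unfolding ramp_sum_def
  by (rule bounded_in_prob_transform[OF _ ramp_variance_limit]) simp

lemma ramp_sum_measurable[measurable]: "(\<lambda>\<omega>. ramp_sum p q r n (noise_path \<omega>)) \<in> borel_measurable M"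
  unfolding ramp_sum_def by measurable

lemma vanishes_in_prob_abs: "vanishes_in_prob Y \<Longrightarrow> vanishes_in_prob (\<lambda>n \<omega>. \<bar>Y n \<omega>\<bar> :: real)"
  by (erule vanishes_in_prob_mono) simp

lemma bounded_in_prob_abs: "bounded_in_prob Y \<Longrightarrow> bounded_in_prob (\<lambda>n \<omega>. \<bar>Y n \<omega>\<bar> :: real)"
  by (erule bounded_in_prob_mono) simp

text \<open>
  Multiplying the normal equations by suitable powers of \<open>n\<close> gives a perturbation of the
  limiting linear system, with the scaled coefficients as unknowns. The leading terms are the solution
  of the limiting system, with the three scores replaced by martingale transforms.
\<close>

theorem regression_expansion:
  fixes u c w :: "nat \<Rightarrow> 'a \<Rightarrow> real"
  assumes \<mu>: "0 < \<mu>" and v: "0 < v"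
    and normal: "\<And>n. 0 < n \<Longrightarrow> AE \<omega> in M.
      (\<Sum>j<n. (e j \<omega> - u n \<omega> * level \<mu> j (noise_path \<omega>) - c n \<omega> * lag \<mu> j (noise_path \<omega>) - w n \<omega>) * level \<mu> j (noise_path \<omega>)) = 0 \<and>
      (\<Sum>j<n. (e j \<omega> - u n \<omega> * level \<mu> j (noise_path \<omega>) - c n \<omega> * lag \<mu> j (noise_path \<omega>) - w n \<omega>) * lag \<mu> j (noise_path \<omega>)) = 0 \<and>
      (\<Sum>j<n. (e j \<omega> - u n \<omega> * level \<mu> j (noise_path \<omega>) - c n \<omega> * lag \<mu> j (noise_path \<omega>) - w n \<omega>)) = 0"
  shows "vanishes_in_prob (\<lambda>n \<omega>. n * sqrt n * u n \<omega> - ramp_sum (- 6 / \<mu>) (12 / \<mu>) 0 n (noise_path \<omega>))" (is "vanishes_in_prob ?U")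
    and "vanishes_in_prob (\<lambda>n \<omega>. sqrt n * c n \<omega> - ramp_sum 0 0 (1 / v) n (noise_path \<omega>))" (is "vanishes_in_prob ?C")
    and "vanishes_in_prob (\<lambda>n \<omega>. sqrt n * w n \<omega> - ramp_sum 4 (- 6) 0 n (noise_path \<omega>))" (is "vanishes_in_prob ?W")
proof -
  define g11 where "g11 n \<omega> = (\<Sum>j<n. (level \<mu> j (noise_path \<omega>))\<^sup>2) / real n ^ 3" for n \<omega>
  define g12 where "g12 n \<omega> = (\<Sum>j<n. level \<mu> j (noise_path \<omega>) * lag \<mu> j (noise_path \<omega>)) / real n ^ 2" for n \<omega>
  define g13 where "g13 n \<omega> = (\<Sum>j<n. level \<mu> j (noise_path \<omega>)) / real n ^ 2" for n \<omega>
  define g22 where "g22 n \<omega> = (\<Sum>j<n. (lag \<mu> j (noise_path \<omega>))\<^sup>2) / n" for n \<omega>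
  define g23 where "g23 n \<omega> = (\<Sum>j<n. lag \<mu> j (noise_path \<omega>)) / n" for n \<omega>
  define r1 where "r1 n \<omega> = (\<Sum>j<n. level \<mu> j (noise_path \<omega>) * e j \<omega>) / (n * sqrt n)" for n \<omega>
  define r2 where "r2 n \<omega> = (\<Sum>j<n. lag \<mu> j (noise_path \<omega>) * e j \<omega>) / sqrt n" for n \<omega>
  define s1 where "s1 n \<omega> = ramp_sum 0 \<mu> 0 n (noise_path \<omega>)" for n \<omega>
  define s2 where "s2 n \<omega> = ramp_sum 0 0 1 n (noise_path \<omega>)" for n \<omega>
  define s3 where "s3 n \<omega> = ramp_sum 1 0 0 n (noise_path \<omega>)" for n \<omega>
  define u0 where "u0 n \<omega> = ramp_sum (- 6 / \<mu>) (12 / \<mu>) 0 n (noise_path \<omega>)" for n \<omega>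
  define c0 where "c0 n \<omega> = ramp_sum 0 0 (1 / v) n (noise_path \<omega>)" for n \<omega>
  define w0 where "w0 n \<omega> = ramp_sum 4 (- 6) 0 n (noise_path \<omega>)" for n \<omega>
  have u0: "u0 n \<omega> = 12 / \<mu>\<^sup>2 * (s1 n \<omega> - \<mu> / 2 * s3 n \<omega>)" for n \<omega>
  proof -
    have "12 / \<mu>\<^sup>2 * (s1 n \<omega> - \<mu> / 2 * s3 n \<omega>) = (12 / \<mu>\<^sup>2) * s1 n \<omega> + (- 6 / \<mu>) * s3 n \<omega>"
      using \<mu> by (simp add: field_simps power2_eq_square)
    also have "\<dots> = u0 n \<omega>"
      unfolding s1_def s3_def u0_def ramp_sum_linear using \<mu> by (simp add: power2_eq_square)
    finally show ?thesis by simp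
  qed
  have c0: "c0 n \<omega> = s2 n \<omega> / v" for n \<omega>
    using ramp_sum_scale[of "1 / v" 0 0 1 n "noise_path \<omega>"] by (simp add: c0_def s2_def)
  have w0: "w0 n \<omega> = s3 n \<omega> - \<mu> / 2 * u0 n \<omega>" for n \<omega>
    using ramp_sum_linear[of 1 1 0 0 n "noise_path \<omega>" "- \<mu> / 2" "- 6 / \<mu>" "12 / \<mu>" 0] \<mu>
    by (simp add: w0_def s3_def u0_def)
  have transform_eq: "martingale_transform (\<lambda>j. \<mu> * (j / n) / sqrt n) (\<lambda>_. 0) n x = ramp_sum 0 \<mu> 0 n x"
    "martingale_transform (\<lambda>_. 0) (\<lambda>j. if j = 0 then 0 else 1 / sqrt n) n x = ramp_sum 0 0 1 n x" for n x
    by (simp_all add: ramp_sum_def cong: if_cong)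
  note lims = gram_level_level[of \<mu>, folded g11_def] gram_level_lag[of \<mu>, folded g12_def]
    gram_level_one[of \<mu>, folded g13_def] gram_lag_lag[of \<mu>, folded g22_def] gram_lag_one[of \<mu>, folded g23_def]
    score_level[of \<mu>, unfolded transform_eq, folded r1_def s1_def]
    score_lag[of \<mu>, unfolded transform_eq, folded r2_def s2_def]
  define D where "D n \<omega> = \<bar>g11 n \<omega> - \<mu>\<^sup>2 / 3\<bar> + (\<bar>g12 n \<omega>\<bar> + (\<bar>g13 n \<omega> - \<mu> / 2\<bar> + (\<bar>g22 n \<omega> - v\<bar> + (\<bar>g23 n \<omega>\<bar>
      + (\<bar>r1 n \<omega> - s1 n \<omega>\<bar> + \<bar>r2 n \<omega> - s2 n \<omega>\<bar>)))))" for n \<omega>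
  define R where "R n \<omega> = \<bar>u0 n \<omega>\<bar> + \<bar>c0 n \<omega>\<bar> + \<bar>w0 n \<omega>\<bar>" for n \<omega>
  have D: "vanishes_in_prob D"
    unfolding D_def by (intro vanishes_in_prob_add vanishes_in_prob_abs lims)
  have R: "bounded_in_prob R"
    unfolding R_def u0_def c0_def w0_def by (intro bounded_in_prob_add bounded_in_prob_abs ramp_sum_bounded)
  define Err where "Err n \<omega> = \<bar>n * sqrt n * u n \<omega> - u0 n \<omega>\<bar> + \<bar>sqrt n * c n \<omega> - c0 n \<omega>\<bar> + \<bar>sqrt n * w n \<omega> - w0 n \<omega>\<bar>" for n \<omega>
  obtain K where K: "0 < K" and solve: "\<And>\<delta> g11 g12 g13 g22 g23 s1 s2 s3 u c w u0 c0 w0.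
    \<bar>g11 - \<mu>\<^sup>2 / 3\<bar> \<le> \<delta> \<Longrightarrow> \<bar>g12\<bar> \<le> \<delta> \<Longrightarrow> \<bar>g13 - \<mu> / 2\<bar> \<le> \<delta> \<Longrightarrow> \<bar>g22 - v\<bar> \<le> \<delta> \<Longrightarrow> \<bar>g23\<bar> \<le> \<delta> \<Longrightarrow>
    \<bar>(g11 * u + g12 * c + g13 * w) - s1\<bar> \<le> \<delta> \<Longrightarrow> \<bar>(g12 * u + g22 * c + g23 * w) - s2\<bar> \<le> \<delta> \<Longrightarrow>
    g13 * u + g23 * c + w = s3 \<Longrightarrow>
    u0 = 12 / \<mu>\<^sup>2 * (s1 - \<mu> / 2 * s3) \<Longrightarrow> c0 = s2 / v \<Longrightarrow> w0 = s3 - \<mu> / 2 * u0 \<Longrightarrow> K * \<delta> \<le> 1 / 2 \<Longrightarrow>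
    \<bar>u - u0\<bar> + \<bar>c - c0\<bar> + \<bar>w - w0\<bar> \<le> 2 * K * \<delta> * (1 + (\<bar>u0\<bar> + \<bar>c0\<bar> + \<bar>w0\<bar>))"
    by (rule perturbed_normal_equations[OF \<mu> v], rule that)
  have Err: "vanishes_in_prob Err"
  proof (rule vanishes_in_prob_by_control[OF D R])
    fix L \<eta> :: real assume \<eta>: "0 < \<eta>" and L: "0 < L"
    define T where "T = 2 * K * (1 + L)"
    have T: "0 < T" using K L by (simp add: T_def)
    \<comment> \<open>small enough for the perturbation bound to apply, and to yield an error of at most \<open>\<eta>\<close>\<close>
    define \<delta> where "\<delta> = min (1 / (2 * K)) (\<eta> / T)"
    have \<delta>: "0 < \<delta>" "K * \<delta> \<le> 1 / 2" "2 * K * \<delta> * (1 + L) \<le> \<eta>"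
    proof -
      show "0 < \<delta>" using K T \<eta> by (simp add: \<delta>_def)
      have "K * \<delta> \<le> K * (1 / (2 * K))" using K by (intro mult_left_mono) (auto simp: \<delta>_def)
      then show "K * \<delta> \<le> 1 / 2" using K by simp
      have "T * \<delta> \<le> T * (\<eta> / T)"
        using T by (intro mult_left_mono) (auto simp: \<delta>_def)
      also have "\<dots> = \<eta>" using T by simp
      finally show "2 * K * \<delta> * (1 + L) \<le> \<eta>" by (simp add: T_def mult_ac)
    qed
    have "AE \<omega> in M. norm (D n \<omega>) \<le> \<delta> \<longrightarrow> norm (R n \<omega>) \<le> L \<longrightarrow> norm (Err n \<omega>) \<le> \<eta>" if n: "0 < n" for n
      using normal[OF n]
    proof eventually_elim
      case (elim \<omega>)
      show ?case
      proof (intro impI)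
        assume Dn: "norm (D n \<omega>) \<le> \<delta>" and Rn: "norm (R n \<omega>) \<le> L"
        define x where "x = noise_path \<omega>"
        define q where "q = sqrt (real n)"
        have q: "0 < q" "q * q = real n" using n by (simp_all add: q_def)
        have e1: "(\<Sum>j<n. level \<mu> j x * x j) = u n \<omega> * (\<Sum>j<n. (level \<mu> j x)\<^sup>2)
            + c n \<omega> * (\<Sum>j<n. level \<mu> j x * lag \<mu> j x) + w n \<omega> * (\<Sum>j<n. level \<mu> j x)"
          using elim by (simp add: x_def sum_subtractf sum_distrib_left power2_eq_square algebra_simps sum.distrib)
        have e2: "(\<Sum>j<n. lag \<mu> j x * x j) = u n \<omega> * (\<Sum>j<n. level \<mu> j x * lag \<mu> j x)
            + c n \<omega> * (\<Sum>j<n. (lag \<mu> j x)\<^sup>2) + w n \<omega> * (\<Sum>j<n. lag \<mu> j x)"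
          using elim by (simp add: x_def sum_subtractf sum_distrib_left power2_eq_square algebra_simps sum.distrib)
        have e3: "(\<Sum>j<n. x j) = u n \<omega> * (\<Sum>j<n. level \<mu> j x)
            + c n \<omega> * (\<Sum>j<n. lag \<mu> j x) + w n \<omega> * n"
          using elim by (simp add: x_def sum_subtractf sum_distrib_left power2_eq_square algebra_simps sum.distrib)
        have xe: "e j \<omega> = x j" for j by (simp add: x_def)
        have nq: "real n = q * q" using q by simp
        have r1: "r1 n \<omega> = g11 n \<omega> * (n * q * u n \<omega>) + g12 n \<omega> * (q * c n \<omega>) + g13 n \<omega> * (q * w n \<omega>)"
          unfolding r1_def g11_def g12_def g13_def x_def[symmetric] q_def[symmetric] xe e1 nq
          using q(1) by (simp add: field_simps power2_eq_square power3_eq_cube)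
        have r2: "r2 n \<omega> = g12 n \<omega> * (n * q * u n \<omega>) + g22 n \<omega> * (q * c n \<omega>) + g23 n \<omega> * (q * w n \<omega>)"
          unfolding r2_def g22_def g12_def g23_def x_def[symmetric] q_def[symmetric] xe e2 nq
          using q(1) by (simp add: field_simps power2_eq_square power3_eq_cube)
        have "s3 n \<omega> = (\<Sum>j<n. x j) / q"
          by (simp add: s3_def ramp_sum_def martingale_transform_def coef_def q_def x_def sum_divide_distrib cong: if_cong)
        then have s3: "g13 n \<omega> * (n * q * u n \<omega>) + g23 n \<omega> * (q * c n \<omega>) + q * w n \<omega> = s3 n \<omega>"
          unfolding g13_def g23_def x_def[symmetric] e3 nq
          using q(1) by (simp add: field_simps power2_eq_square power3_eq_cube)
        have defects: "\<bar>g11 n \<omega> - \<mu>\<^sup>2 / 3\<bar> \<le> \<delta>" "\<bar>g12 n \<omega>\<bar> \<le> \<delta>" "\<bar>g13 n \<omega> - \<mu> / 2\<bar> \<le> \<delta>"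
          "\<bar>g22 n \<omega> - v\<bar> \<le> \<delta>" "\<bar>g23 n \<omega>\<bar> \<le> \<delta>"
          "\<bar>r1 n \<omega> - s1 n \<omega>\<bar> \<le> \<delta>" "\<bar>r2 n \<omega> - s2 n \<omega>\<bar> \<le> \<delta>"
        proof -
          have part: "a1 \<le> d \<and> a2 \<le> d \<and> a3 \<le> d \<and> a4 \<le> d \<and> a5 \<le> d \<and> a6 \<le> d \<and> a7 \<le> d"
            if "0 \<le> a1" "0 \<le> a2" "0 \<le> a3" "0 \<le> a4" "0 \<le> a5" "0 \<le> a6" "0 \<le> a7"
              "a1 + (a2 + (a3 + (a4 + (a5 + (a6 + a7))))) \<le> d" for a1 a2 a3 a4 a5 a6 a7 d :: real
            using that by auto
          have "D n \<omega> \<le> \<delta>" using Dn by (simp only: real_norm_def abs_le_iff)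
          from part[OF _ _ _ _ _ _ _ this[unfolded D_def]]
          show "\<bar>g11 n \<omega> - \<mu>\<^sup>2 / 3\<bar> \<le> \<delta>" "\<bar>g12 n \<omega>\<bar> \<le> \<delta>" "\<bar>g13 n \<omega> - \<mu> / 2\<bar> \<le> \<delta>"
            "\<bar>g22 n \<omega> - v\<bar> \<le> \<delta>" "\<bar>g23 n \<omega>\<bar> \<le> \<delta>"
            "\<bar>r1 n \<omega> - s1 n \<omega>\<bar> \<le> \<delta>" "\<bar>r2 n \<omega> - s2 n \<omega>\<bar> \<le> \<delta>"
            by (simp_all only: abs_ge_zero simp_thms)
        qed
        have "Err n \<omega> \<le> 2 * K * \<delta> * (1 + R n \<omega>)"
          unfolding Err_def R_def q_def[symmetric]
          by (rule solve[OF defects(1-5) defects(6,7)[unfolded r1 r2] s3 u0 c0 w0 \<delta>(2)])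
        also have "\<dots> \<le> 2 * K * \<delta> * (1 + L)"
          using Rn K \<delta>(1) by (intro mult_left_mono) auto
        also have "\<dots> \<le> \<eta>" by (rule \<delta>(3))
        finally show "norm (Err n \<omega>) \<le> \<eta>" by (simp add: Err_def)
      qed
    qed
    then show "\<exists>\<delta>>0. \<forall>\<^sub>F n in sequentially. AE \<omega> in M.
        norm (D n \<omega>) \<le> \<delta> \<longrightarrow> norm (R n \<omega>) \<le> L \<longrightarrow> norm (Err n \<omega>) \<le> \<eta>"
      using \<delta>(1) by (intro exI[of _ \<delta>] conjI eventually_mono[OF eventually_gt_at_top[of 0]]) auto
  qed
  show "vanishes_in_prob ?U" "vanishes_in_prob ?C" "vanishes_in_prob ?W"
    by (rule vanishes_in_prob_mono[OF Err]; simp add: Err_def u0_def c0_def w0_def)+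
qed

end

section \<open>The unstable decomposable INAR(2) process as a random walk\<close>

text \<open>
  Thinning with parameter \<open>1\<close> keeps every individual and thinning with parameter \<open>0\<close> keeps none, so the
  recursion reads \<open>X\<^sub>k = X\<^sub>k\<^sub>-\<^sub>1 + \<epsilon>\<^sub>k\<close>.
\<close>

lemma inar2_random_walk:
  assumes inar: "inar2_process M 1 0 \<epsilon> \<xi> \<eta> X"
    and initial: "AE \<omega> in M. X 0 \<omega> = 0 \<and> X (- 1) \<omega> = 0"
  shows "AE \<omega> in M. \<forall>k. X (int k) \<omega> = (\<Sum>i<k. \<epsilon> (Suc i) \<omega>)"
proof -
  interpret inar2_process M 1 0 \<epsilon> \<xi> \<eta> X by (rule inar)
  have noise_measurable: "noise \<epsilon> \<xi> \<eta> i \<in> measurable M (count_space UNIV)" if "i \<in> noise_indices" for i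
    using indep_noise that by (auto simp: indep_vars_def)
  have "b" if "b \<in> set_pmf (bernoulli_pmf 1)" for b
    using that by (cases b) (auto simp: set_pmf_iff)
  then have bernoulli1: "AE x in measure_pmf (map_pmf of_bool (bernoulli_pmf 1)). x = (1::nat)"
    by (auto simp: AE_measure_pmf_iff)
  have "\<not> b" if "b \<in> set_pmf (bernoulli_pmf 0)" for b
    using that by (cases b) (auto simp: set_pmf_iff)
  then have bernoulli0: "AE x in measure_pmf (map_pmf of_bool (bernoulli_pmf 0)). x = (0::nat)"
    by (auto simp: AE_measure_pmf_iff)
  have \<xi>: "AE \<omega> in M. \<xi> k j \<omega> = 1" if "1 \<le> k" "1 \<le> j" for k j
  proof -
    have "\<xi> k j \<in> measurable M (count_space UNIV)"
      using noise_measurable[of "Thinning1 k j"] that by (auto simp: noise_indices_def)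
    moreover have "AE x in distr M (count_space UNIV) (\<xi> k j). x = 1"
      unfolding thinning1_distr[OF that] by (rule bernoulli1)
    ultimately show ?thesis by (rule AE_distrD)
  qed
  have \<eta>: "AE \<omega> in M. \<eta> k j \<omega> = 0" if "1 \<le> k" "1 \<le> j" for k j
  proof -
    have "\<eta> k j \<in> measurable M (count_space UNIV)"
      using noise_measurable[of "Thinning2 k j"] that by (auto simp: noise_indices_def)
    moreover have "AE x in distr M (count_space UNIV) (\<eta> k j). x = 0"
      unfolding thinning2_distr[OF that] by (rule bernoulli0)
    ultimately show ?thesis by (rule AE_distrD)
  qed
  have 1: "AE \<omega> in M. \<forall>k j. \<xi> (Suc k) (Suc j) \<omega> = 1" using \<xi> by (simp add: AE_all_countable)
  have 2: "AE \<omega> in M. \<forall>k j. \<eta> (Suc k) (Suc j) \<omega> = 0" using \<eta> by (simp add: AE_all_countable)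
  have 3: "AE \<omega> in M. \<forall>k. X (int (Suc k)) \<omega> = (\<Sum>j = 1..X (int (Suc k) - 1) \<omega>. \<xi> (Suc k) j \<omega>)
      + (\<Sum>j = 1..X (int (Suc k) - 2) \<omega>. \<eta> (Suc k) j \<omega>) + \<epsilon> (Suc k) \<omega>"
    unfolding AE_all_countable by (intro allI recursion) simp
  show ?thesis using 1 2 3 initial
  proof eventually_elim
    case (elim \<omega>)
    have "X (int (Suc k)) \<omega> = X (int k) \<omega> + \<epsilon> (Suc k) \<omega>" for k
    proof -
      have "(\<Sum>j = 1..N. \<xi> (Suc k) j \<omega>) = N" for N
      proof -
        have "(\<Sum>j = 1..N. \<xi> (Suc k) j \<omega>) = (\<Sum>j = 1..N. 1)"
          using elim(1) by (intro sum.cong) (auto, metis Suc_le_D One_nat_def)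
        then show ?thesis by simp
      qed
      moreover have "(\<Sum>j = 1..N. \<eta> (Suc k) j \<omega>) = 0" for N
        using elim(2) by (intro sum.neutral) (auto, metis Suc_le_D)
      ultimately show ?thesis using elim(3)[rule_format, of k] by simp
    qed
    note step = this
    show ?case
    proof
      fix k show "X (int k) \<omega> = (\<Sum>i<k. \<epsilon> (Suc i) \<omega>)"
        by (induction k) (use elim(4) step in \<open>simp_all del: of_nat_Suc\<close>)
    qed
  qed
qed

lemma inar2_centred_innovations:
  assumes inar: "inar2_process M \<alpha> \<beta> \<epsilon> \<xi> \<eta> X"
    and moment: "integrable M (\<lambda>\<omega>. real (\<epsilon> 1 \<omega>) ^ 4)"
    and mean: "\<mu> = prob_space.expectation M (\<lambda>\<omega>. real (\<epsilon> 1 \<omega>))"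
  shows "centred_noise M (\<lambda>j \<omega>. real (\<epsilon> (Suc j) \<omega>) - \<mu>) (prob_space.variance M (\<lambda>\<omega>. real (\<epsilon> 1 \<omega>)))
    (prob_space.expectation M (\<lambda>\<omega>. (real (\<epsilon> 1 \<omega>) - \<mu>) ^ 4))"
proof -
  interpret inar2_process M \<alpha> \<beta> \<epsilon> \<xi> \<eta> X by (rule inar)
  have \<epsilon>_measurable: "\<epsilon> (Suc j) \<in> measurable M (count_space UNIV)" for j
    using indep_noise by (auto simp: indep_vars_def noise_indices_def dest!: bspec[of _ _ "Innovation (Suc j)"])
  have same_integrable: "integrable M (\<lambda>\<omega>. g (\<epsilon> (Suc j) \<omega>)) \<longleftrightarrow> integrable M (\<lambda>\<omega>. g (\<epsilon> 1 \<omega>))"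
    and same_expectation: "expectation (\<lambda>\<omega>. g (\<epsilon> (Suc j) \<omega>)) = expectation (\<lambda>\<omega>. g (\<epsilon> 1 \<omega>))"
    for g :: "nat \<Rightarrow> real" and j
  proof -
    have *: "distr M (count_space UNIV) (\<epsilon> (Suc j)) = distr M (count_space UNIV) (\<epsilon> 1)"
      by (rule innovation_distr) simp
    have m1: "\<epsilon> 1 \<in> measurable M (count_space UNIV)" using \<epsilon>_measurable[of 0] by simp
    show "integrable M (\<lambda>\<omega>. g (\<epsilon> (Suc j) \<omega>)) \<longleftrightarrow> integrable M (\<lambda>\<omega>. g (\<epsilon> 1 \<omega>))"
      using integrable_distr_eq[OF \<epsilon>_measurable[of j], of g] integrable_distr_eq[OF m1, of g] * by simp
    show "expectation (\<lambda>\<omega>. g (\<epsilon> (Suc j) \<omega>)) = expectation (\<lambda>\<omega>. g (\<epsilon> 1 \<omega>))"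
      using integral_distr[OF \<epsilon>_measurable[of j], of g] integral_distr[OF m1, of g] * by simp
  qed
  have [measurable]: "\<epsilon> 1 \<in> measurable M (count_space UNIV)" using \<epsilon>_measurable[of 0] by simp
  have powers: "integrable M (\<lambda>\<omega>. real (\<epsilon> 1 \<omega>) ^ i)" if "i \<le> 4" for i
  proof (rule Bochner_Integration.integrable_bound)
    show "integrable M (\<lambda>\<omega>. 1 + real (\<epsilon> 1 \<omega>) ^ 4)" using moment by simp
    show "AE \<omega> in M. norm (real (\<epsilon> 1 \<omega>) ^ i) \<le> norm (1 + real (\<epsilon> 1 \<omega>) ^ 4)"
    proof (rule AE_I2)
      fix \<omega>
      show "norm (real (\<epsilon> 1 \<omega>) ^ i) \<le> norm (1 + real (\<epsilon> 1 \<omega>) ^ 4)"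
        using abs_power_le_one_plus[OF that, of "real (\<epsilon> 1 \<omega>)"] by simp
    qed
  qed measurable
  have i1: "integrable M (\<lambda>\<omega>. real (\<epsilon> 1 \<omega>))" using powers[of 1] by simp
  have fourth: "integrable M (\<lambda>\<omega>. (real (\<epsilon> 1 \<omega>) - \<mu>) ^ 4)"
  proof -
    have "(y - \<mu>) ^ 4 = y ^ 4 - 4 * \<mu> * y ^ 3 + 6 * \<mu>\<^sup>2 * y\<^sup>2 - 4 * \<mu> ^ 3 * y + \<mu> ^ 4" for y :: real
      by (simp add: eval_nat_numeral algebra_simps)
    then show ?thesis using powers[of 4] powers[of 3] powers[of 2] i1 by simp
  qed
  show ?thesis
  proof
    have "indep_vars (\<lambda>j. PiM {Innovation (Suc j)} (\<lambda>_. count_space UNIV))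
        (\<lambda>j \<omega>. restrict (\<lambda>i. noise \<epsilon> \<xi> \<eta> i \<omega>) {Innovation (Suc j)}) UNIV"
      by (rule indep_vars_restrict[OF indep_noise]) (auto simp: noise_indices_def disjoint_family_on_def)
    from indep_vars_compose2[OF this, of "\<lambda>j f. real (f (Innovation (Suc j))) - \<mu>" "\<lambda>_. borel"]
    show "indep_vars (\<lambda>_. borel) (\<lambda>j \<omega>. real (\<epsilon> (Suc j) \<omega>) - \<mu>) UNIV"
      by simp
    show "expectation (\<lambda>\<omega>. real (\<epsilon> (Suc k) \<omega>) - \<mu>) = 0" for k
      using same_expectation[of "\<lambda>y. real y - \<mu>" k] i1 by (simp add: mean prob_space)
    show "expectation (\<lambda>\<omega>. (real (\<epsilon> (Suc k) \<omega>) - \<mu>)\<^sup>2) = variance (\<lambda>\<omega>. real (\<epsilon> 1 \<omega>))" for k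
      using same_expectation[of "\<lambda>y. (real y - \<mu>)\<^sup>2" k] by (simp add: mean)
    show "integrable M (\<lambda>\<omega>. (real (\<epsilon> (Suc k) \<omega>) - \<mu>) ^ 4)" for k
      using same_integrable[of "\<lambda>y. (real y - \<mu>) ^ 4" k] fourth by simp
    show "expectation (\<lambda>\<omega>. (real (\<epsilon> (Suc k) \<omega>) - \<mu>) ^ 4) \<le> expectation (\<lambda>\<omega>. (real (\<epsilon> 1 \<omega>) - \<mu>) ^ 4)" for k
      using same_expectation[of "\<lambda>y. (real y - \<mu>) ^ 4" k] by simp
  qed
qed

lemma sample_measurable:
  assumes inar: "inar2_process M \<alpha> \<beta> \<epsilon> \<xi> \<eta> X"
  shows "sample X n \<in> measurable M (\<Pi>\<^sub>M k\<in>{1..n}. (borel :: real measure))"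
proof -
  interpret inar2_process M \<alpha> \<beta> \<epsilon> \<xi> \<eta> X by (rule inar)
  have [measurable]: "X (int k) \<in> measurable M (count_space UNIV)" for k
    by (rule random_variable_X) simp
  show ?thesis unfolding sample_def[abs_def] by (intro measurable_restrict) measurable
qed

context centred_noise
begin

text \<open>
  The least squares objective in coordinates adapted to the limit. Substituting the lagged value
  \<open>X\<^sub>k\<^sub>-\<^sub>2 = X\<^sub>k\<^sub>-\<^sub>1 - \<mu> - lag\<close> turns the parameters \<open>(a, b, m)\<close> into \<open>u = a + b - 1\<close>, \<open>c = - b\<close> and
  \<open>w = m - \<mu> - b \<mu>\<close>, which all vanish at the true values and whose regressors are asymptotically
  non-degenerate after scaling, whereas \<open>X\<^sub>k\<^sub>-\<^sub>1\<close> and \<open>X\<^sub>k\<^sub>-\<^sub>2\<close> are asymptotically collinear.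
\<close>

definition residual_sum :: "real \<Rightarrow> nat \<Rightarrow> (nat \<Rightarrow> real) \<Rightarrow> real \<Rightarrow> real \<Rightarrow> real \<Rightarrow> real" where
  "residual_sum \<mu> n x u c w = (\<Sum>j<n. (x j - u * level \<mu> j x - c * lag \<mu> j x - w)\<^sup>2)"

lemma residual_sum_normal_equations:
  assumes min: "\<And>u' c' w'. residual_sum \<mu> n x u c w \<le> residual_sum \<mu> n x u' c' w'"
  shows "(\<Sum>j<n. (x j - u * level \<mu> j x - c * lag \<mu> j x - w) * level \<mu> j x) = 0"
    and "(\<Sum>j<n. (x j - u * level \<mu> j x - c * lag \<mu> j x - w) * lag \<mu> j x) = 0"
    and "(\<Sum>j<n. (x j - u * level \<mu> j x - c * lag \<mu> j x - w)) = 0"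
proof -
  let ?r = "\<lambda>j. x j - u * level \<mu> j x - c * lag \<mu> j x - w"
  show "(\<Sum>j<n. ?r j * level \<mu> j x) = 0"
    by (rule minimizer_orthogonal)
       (use min[of "u + s" c w for s] in \<open>simp_all add: residual_sum_def algebra_simps\<close>)
  show "(\<Sum>j<n. ?r j * lag \<mu> j x) = 0"
    by (rule minimizer_orthogonal)
       (use min[of u "c + s" w for s] in \<open>simp_all add: residual_sum_def algebra_simps\<close>)
  have "(\<Sum>j<n. ?r j * 1) = 0"
    by (rule minimizer_orthogonal)
       (use min[of u c "w + s" for s] in \<open>simp_all add: residual_sum_def algebra_simps\<close>)
  then show "(\<Sum>j<n. ?r j) = 0" by simp
qed

text \<open>
  The conventions \<open>x\<^sub>-\<^sub>1 = x\<^sub>0 = 0\<close> of the objective correspond to \<open>level = 0\<close> and \<open>lag = - \<mu>\<close> at time \<open>0\<close>.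
\<close>

lemma cls_objective_eq_residual_sum:
  assumes X: "\<And>k. real (X (int k) \<omega>) = level \<mu> k x"
  shows "cls_objective n (sample X n \<omega>) (a, b, m) = residual_sum \<mu> n x (a + b - 1) (- b) (m - \<mu> - b * \<mu>)"
proof -
  let ?z = "zero_start (sample X n \<omega>)"
  have z: "?z (int k) = level \<mu> k x" if "k \<le> n" for k
    using that X[of k] by (cases "k = 0") (auto simp: zero_start_def sample_def level_def walk_def)
  have z1: "?z (int j - 1) = level \<mu> j x - lag \<mu> j x - \<mu>" if "j < n" for j
  proof (cases j)
    case 0 then show ?thesis by (simp add: zero_start_def level_def walk_def lag_def)
  next
    case (Suc i)
    then show ?thesis using z[of i] that by (simp add: level_def walk_def lag_def algebra_simps)
  qed
  have "cls_objective n (sample X n \<omega>) (a, b, m)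
      = (\<Sum>k = 1..int n. (?z k - a * ?z (k - 1) - b * ?z (k - 2) - m)\<^sup>2)"
    by (simp add: cls_objective_def)
  also have "\<dots> = (\<Sum>j<n. (?z (int (Suc j)) - a * ?z (int j) - b * ?z (int j - 1) - m)\<^sup>2)"
    by (rule sum.reindex_bij_witness[of _ "\<lambda>j. int (Suc j)" "\<lambda>k. nat (k - 1)"]) auto
  also have "\<dots> = (\<Sum>j<n. (x j - (a + b - 1) * level \<mu> j x - (- b) * lag \<mu> j x - (m - \<mu> - b * \<mu>))\<^sup>2)"
  proof (rule sum.cong[OF refl])
    fix j assume "j \<in> {..<n}"
    then have j: "j < n" by simp
    have "?z (int (Suc j)) = level \<mu> j x + \<mu> + x j"
      using z[of "Suc j"] j by (simp add: level_def walk_def algebra_simps)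
    note zs = this z[of j, OF less_imp_le[OF j]] z1[OF j]
    show "(?z (int (Suc j)) - a * ?z (int j) - b * ?z (int j - 1) - m)\<^sup>2
        = (x j - (a + b - 1) * level \<mu> j x - (- b) * lag \<mu> j x - (m - \<mu> - b * \<mu>))\<^sup>2"
      unfolding zs by (rule arg_cong[of _ _ "\<lambda>y. y\<^sup>2"]) (simp add: algebra_simps)
  qed
  finally show ?thesis by (simp add: residual_sum_def)
qed

lemma cls_estimator_minimizes:
  assumes X: "\<And>k. real (X (int k) \<omega>) = level \<mu> k x"
    and cls: "cls_estimator n (\<lambda>x. (A x, B x, D x))"
  defines "y \<equiv> sample X n \<omega>"
  shows "residual_sum \<mu> n x (A y + B y - 1) (- B y) (D y - \<mu> - B y * \<mu>) \<le> residual_sum \<mu> n x u' c' w'"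
proof -
  have "y \<in> space (\<Pi>\<^sub>M k\<in>{1..n}. (borel :: real measure))"
    by (simp add: y_def sample_def space_PiM)
  then have "cls_objective n y (A y, B y, D y) = (INF p. cls_objective n y p)"
    using cls by (simp add: cls_estimator_def)
  also have "\<dots> \<le> cls_objective n y (u' + 1 + c', - c', w' + \<mu> - c' * \<mu>)"
    by (rule cINF_lower) (auto intro!: bdd_belowI[of _ 0] sum_nonneg simp: cls_objective_def)
  finally show ?thesis
    unfolding y_def cls_objective_eq_residual_sum[of X, OF X] by simp
qed

end

section \<open>The limit distributions\<close>

context centred_noise
begin

lemma degenerate_noise: "v = 0 \<Longrightarrow> AE \<omega> in M. \<forall>j. e j \<omega> = 0"
proof -
  assume "v = 0"
  then have "AE \<omega> in M. (e j \<omega>)\<^sup>2 = 0" for j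
    using integral_nonneg_eq_0_iff_AE[OF integrable_e_square[of j]] second_moment[of j] by simp
  then show ?thesis by (simp add: AE_all_countable)
qed

text \<open>
  Without noise the true parameters fit perfectly, so the minimizer has zero residuals; the
  rows \<open>1\<close> and \<open>2\<close> then force a vanishing slope \<open>u\<close>, which explains the bound \<open>3 \<le> n\<close>.
\<close>

lemma degenerate_minimizer:
  assumes \<mu>: "\<mu> \<noteq> 0" and x: "\<And>j. x j = 0" and n: "3 \<le> n"
    and min: "\<And>u' c' w'. residual_sum \<mu> n x u c w \<le> residual_sum \<mu> n x u' c' w'"
  shows "u = 0"
proof -
  have "residual_sum \<mu> n x u c w \<le> 0"
    using min[of 0 0 0] x by (simp add: residual_sum_def)
  then have "residual_sum \<mu> n x u c w = 0"
    by (intro antisym) (simp_all add: residual_sum_def sum_nonneg)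
  then have zero: "x j - u * level \<mu> j x - c * lag \<mu> j x - w = 0" if "j < n" for j
    using that by (simp add: residual_sum_def sum_nonneg_eq_0_iff)
  have "x 1 - u * level \<mu> 1 x - c * lag \<mu> 1 x - w = 0" "x 2 - u * level \<mu> 2 x - c * lag \<mu> 2 x - w = 0"
    using n by (intro zero; simp)+
  then have "u * \<mu> + w = 0" "2 * (u * \<mu>) + w = 0"
    using x by (simp_all add: level_def lag_def walk_def)
  then have "u * \<mu> = 0" by linarith
  with \<mu> show "u = 0" by simp
qed

end

lemma vector_2_eq_axis: "(vector [x, y] :: real ^ 2) = x *\<^sub>R axis 1 1 + y *\<^sub>R axis 2 1"
  by (simp add: vec_eq_iff forall_2 axis_def)

lemma norm_vector_2_le: "norm (vector [x, y] :: real ^ 2) \<le> \<bar>x\<bar> + \<bar>y\<bar>"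
  using norm_le_l1_cart[of "vector [x, y] :: real ^ 2"] by (simp add: sum_2)

text \<open>
  In the adapted coordinates the estimation errors of \<open>\<alpha> + \<beta>\<close>, \<open>\<beta>\<close> and the mean are
  \<open>u\<close>, \<open>- c\<close> and \<open>w - \<mu> c\<close>. Their leading terms are ramp sums with variances
  \<open>\<sigma>\<^sup>2 (36 - 72 + 48) / \<mu>\<^sup>2 = 12 \<sigma>\<^sup>2 / \<mu>\<^sup>2\<close>, \<open>\<sigma>\<^sup>4 / \<sigma>\<^sup>4 = 1\<close> and
  \<open>\<sigma>\<^sup>2 (16 - 24 + 12 + \<mu>\<^sup>2 / \<sigma>\<^sup>2) = 4 \<sigma>\<^sup>2 + \<mu>\<^sup>2\<close>. Since \<open>u\<close> is of order \<open>n\<^sup>-\<^sup>3\<^sup>/\<^sup>2\<close>, on the scale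
  \<open>n\<^sup>1\<^sup>/\<^sup>2\<close> the vector of the errors of \<open>\<alpha>\<close> and \<open>\<beta>\<close> is \<open>- c\<close> times the direction \<open>(-1, 1)\<close>.
\<close>

theorem theorem2p2:
  fixes M :: "'a measure"
    and \<epsilon> :: "nat \<Rightarrow> 'a \<Rightarrow> nat"
    and \<xi> \<eta> :: "nat \<Rightarrow> nat \<Rightarrow> 'a \<Rightarrow> nat"
    and X :: "int \<Rightarrow> 'a \<Rightarrow> nat"
    and \<mu> \<sigma> :: real
    and alpha_hat beta_hat mu_hat rho_hat :: "nat \<Rightarrow> (nat \<Rightarrow> real) \<Rightarrow> real"
  assumes inar: "inar2_process M 1 0 \<epsilon> \<xi> \<eta> X"
    and initial: "AE \<omega> in M. X 0 \<omega> = 0 \<and> X (- 1) \<omega> = 0"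
    and moment: "integrable M (\<lambda>\<omega>. real (\<epsilon> 1 \<omega>) ^ 4)"
    and mean: "\<mu> = prob_space.expectation M (\<lambda>\<omega>. real (\<epsilon> 1 \<omega>))"
    and variance: "\<sigma>\<^sup>2 = prob_space.variance M (\<lambda>\<omega>. real (\<epsilon> 1 \<omega>))"
    and mean_pos: "\<mu> > 0"
    and cls: "\<And>n. 1 \<le> n \<Longrightarrow> cls_estimator n (\<lambda>x. (alpha_hat n x, beta_hat n x, mu_hat n x))"
    and rho_hat: "\<And>n x. rho_hat n x = alpha_hat n x + beta_hat n x"
  shows
    "weak_conv_m
       (\<lambda>n. distr M borel (\<lambda>\<omega>. real n powr (3/2) * (rho_hat n (sample X n \<omega>) - 1)))
       (normal_law 0 (12 * \<sigma>\<^sup>2 / \<mu>\<^sup>2)) \<and>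
     (\<sigma>\<^sup>2 > 0 \<longrightarrow>
       weakly_converges
         (\<lambda>n. distr M borel (\<lambda>\<omega>. vector
            [real n powr (1/2) * (alpha_hat n (sample X n \<omega>) - 1),
             real n powr (1/2) * beta_hat n (sample X n \<omega>)] :: real ^ 2))
         (distr (normal_law 0 1) borel (\<lambda>z. z *\<^sub>R (vector [- 1, 1] :: real ^ 2))) \<and>
       weak_conv_m
         (\<lambda>n. distr M borel (\<lambda>\<omega>. real n powr (1/2) * (mu_hat n (sample X n \<omega>) - \<mu>)))
         (normal_law 0 (\<mu>\<^sup>2 + 4 * \<sigma>\<^sup>2)))"
proof -
  define e where "e j \<omega> = real (\<epsilon> (Suc j) \<omega>) - \<mu>" for j \<omega>
  define \<kappa> where "\<kappa> = prob_space.expectation M (\<lambda>\<omega>. (real (\<epsilon> 1 \<omega>) - \<mu>) ^ 4)"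
  interpret centred_noise M e "\<sigma>\<^sup>2" \<kappa>
    unfolding e_def[abs_def] \<kappa>_def variance
    by (rule inar2_centred_innovations[OF inar moment mean])
  have X: "AE \<omega> in M. \<forall>k. real (X (int k) \<omega>) = level \<mu> k (noise_path \<omega>)"
    using inar2_random_walk[OF inar initial]
    by eventually_elim (simp add: level_def walk_def e_def sum_subtractf)
  define A B D where "A n \<omega> = alpha_hat n (sample X n \<omega>)" and "B n \<omega> = beta_hat n (sample X n \<omega>)"
    and "D n \<omega> = mu_hat n (sample X n \<omega>)" for n \<omega>
  have ABD: "A n \<in> borel_measurable M" "B n \<in> borel_measurable M" "D n \<in> borel_measurable M" if "0 < n" for n
  proof -
    have "(\<lambda>x. (alpha_hat n x, beta_hat n x, mu_hat n x)) \<in> borel_measurable (\<Pi>\<^sub>M k\<in>{1..n}. (borel :: real measure))"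
      using cls[of n] that by (simp add: cls_estimator_def)
    from measurable_compose[OF sample_measurable[OF inar] this]
    have T[measurable]: "(\<lambda>\<omega>. (A n \<omega>, B n \<omega>, D n \<omega>)) \<in> borel_measurable M" by (simp add: A_def B_def D_def)
    have "(fst :: real \<times> real \<times> real \<Rightarrow> real) \<in> borel_measurable borel"
      "(\<lambda>p :: real \<times> real \<times> real. fst (snd p)) \<in> borel_measurable borel"
      "(\<lambda>p :: real \<times> real \<times> real. snd (snd p)) \<in> borel_measurable borel"
      by (intro borel_measurable_continuous_onI continuous_intros)+
    from this[THEN measurable_compose[OF T]]
    show "A n \<in> borel_measurable M" "B n \<in> borel_measurable M" "D n \<in> borel_measurable M" by simp_all
  qed
  define u c w where "u n \<omega> = A n \<omega> + B n \<omega> - 1" and "c n \<omega> = - B n \<omega>"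
    and "w n \<omega> = D n \<omega> - \<mu> - B n \<omega> * \<mu>" for n \<omega>
  have minimal: "AE \<omega> in M. \<forall>n. 0 < n \<longrightarrow> (\<forall>u' c' w'. residual_sum \<mu> n (noise_path \<omega>) (u n \<omega>) (c n \<omega>) (w n \<omega>)
      \<le> residual_sum \<mu> n (noise_path \<omega>) u' c' w')"
    using X
  proof eventually_elim
    case (elim \<omega>)
    show ?case
      using cls_estimator_minimizes[of X \<omega> \<mu> "noise_path \<omega>", OF elim[rule_format] cls]
      by (auto simp: u_def c_def w_def A_def B_def D_def)
  qed
  have powr: "real n powr (3/2) = real n * sqrt n" "real n powr (1/2) = sqrt n" for n
    using powr_add[of "real n" 1 "1/2"] by (simp_all add: powr_half_sqrt)
  have rho: "real n powr (3/2) * (rho_hat n (sample X n \<omega>) - 1) = n * sqrt n * u n \<omega>" for n \<omega>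
    by (simp add: powr rho_hat u_def A_def B_def)
  have U_measurable: "(\<lambda>\<omega>. n * sqrt n * u n \<omega>) \<in> borel_measurable M" if "0 < n" for n
    unfolding u_def using ABD[OF that] by measurable
  show ?thesis
  proof (cases "\<sigma>\<^sup>2 > 0")
    case False
    \<comment> \<open>deterministic innovations: the Gram matrix is singular in the limit, but the fit is exact\<close>
    then have v0: "\<sigma>\<^sup>2 = 0" using zero_le_power2[of \<sigma>] by linarith
    have "AE \<omega> in M. \<forall>n\<ge>3. u n \<omega> = 0"
      using minimal degenerate_noise[OF v0]
    proof eventually_elim
      case (elim \<omega>)
      show ?case
      proof (intro allI impI)
        fix n :: nat assume "3 \<le> n"
        then show "u n \<omega> = 0"
          using elim mean_pos
          by (intro degenerate_minimizer[of \<mu> "noise_path \<omega>" n "u n \<omega>" "c n \<omega>" "w n \<omega>"]) auto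
      qed
    qed
    note u0 = this
    have vanish: "vanishes_in_prob (\<lambda>n \<omega>. n * sqrt n * u n \<omega> - 0)"
    proof (rule vanishes_in_prob_by_control[OF vanishes_in_prob_const bounded_in_prob_const[of "0::real"]])
      show "(\<lambda>_. 0::real) \<longlonglongrightarrow> 0" by simp
      fix K \<eta> :: real assume "0 < \<eta>" "0 < K"
      have "AE \<omega> in M. norm (0::real) \<le> 1 \<longrightarrow> norm (0::real) \<le> K \<longrightarrow> norm (n * sqrt n * u n \<omega> - 0) \<le> \<eta>" if "3 \<le> n" for n
        using u0 by eventually_elim (use that \<open>0 < \<eta>\<close> in auto)
      then show "\<exists>\<delta>>0. \<forall>\<^sub>F n in sequentially. AE \<omega> in M.
          norm (0::real) \<le> \<delta> \<longrightarrow> norm (0::real) \<le> K \<longrightarrow> norm (n * sqrt n * u n \<omega> - 0) \<le> \<eta>"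
        by (intro exI[of _ 1] conjI eventually_mono[OF eventually_ge_at_top[of 3]]) auto
    qed
    have "weak_conv_m (\<lambda>n. distr M borel (\<lambda>\<omega>. n * sqrt n * u n \<omega>)) (normal_law 0 0)"
    proof (rule weak_conv_m_Slutsky[where W = "\<lambda>_ _. 0"])
      show "weak_conv_m (\<lambda>n. distr M borel (\<lambda>_. 0::real)) (normal_law 0 0)"
        by (simp add: normal_law_def weak_conv_m_def weak_conv_def)
    qed (use U_measurable vanish bounded_in_prob_const real_distribution_normal_law in auto)
    then show ?thesis unfolding rho using v0 by simp
  next
    case True
    then have \<sigma>: "\<sigma> \<noteq> 0" by auto
    have normal_eqs: "AE \<omega> in M.
      (\<Sum>j<n. (e j \<omega> - u n \<omega> * level \<mu> j (noise_path \<omega>) - c n \<omega> * lag \<mu> j (noise_path \<omega>) - w n \<omega>) * level \<mu> j (noise_path \<omega>)) = 0 \<and>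
      (\<Sum>j<n. (e j \<omega> - u n \<omega> * level \<mu> j (noise_path \<omega>) - c n \<omega> * lag \<mu> j (noise_path \<omega>) - w n \<omega>) * lag \<mu> j (noise_path \<omega>)) = 0 \<and>
      (\<Sum>j<n. (e j \<omega> - u n \<omega> * level \<mu> j (noise_path \<omega>) - c n \<omega> * lag \<mu> j (noise_path \<omega>) - w n \<omega>)) = 0" if "0 < n" for n
      using minimal
    proof eventually_elim
      case (elim \<omega>)
      show ?case
        using residual_sum_normal_equations[of \<mu> n "noise_path \<omega>" "u n \<omega>" "c n \<omega>" "w n \<omega>"] elim that by blast
    qed
    note expansion = regression_expansion[OF mean_pos True normal_eqs]
    have "weak_conv_m (\<lambda>n. distr M borel (\<lambda>\<omega>. n * sqrt n * u n \<omega>)) (normal_law 0 (12 * \<sigma>\<^sup>2 / \<mu>\<^sup>2))"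
    proof (rule weak_conv_m_Slutsky[OF U_measurable _ expansion(1) ramp_sum_bounded])
      have "\<sigma>\<^sup>2 * ((- 6 / \<mu>)\<^sup>2 + (- 6 / \<mu>) * (12 / \<mu>) + (12 / \<mu>)\<^sup>2 / 3 + 0\<^sup>2 * \<sigma>\<^sup>2) = 12 * \<sigma>\<^sup>2 / \<mu>\<^sup>2"
        by (simp add: power_divide field_simps power2_eq_square)
      then show "weak_conv_m (\<lambda>n. distr M borel (\<lambda>\<omega>. ramp_sum (- 6 / \<mu>) (12 / \<mu>) 0 n (noise_path \<omega>)))
          (normal_law 0 (12 * \<sigma>\<^sup>2 / \<mu>\<^sup>2))"
        using ramp_sum_normal_limit[of "- 6 / \<mu>" "12 / \<mu>" 0] by simp
    qed (use real_distribution_normal_law in auto)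
    moreover have "weak_conv_m (\<lambda>n. distr M borel (\<lambda>\<omega>. sqrt n * (D n \<omega> - \<mu>))) (normal_law 0 (\<mu>\<^sup>2 + 4 * \<sigma>\<^sup>2))"
    proof (rule weak_conv_m_Slutsky)
      have "\<sigma>\<^sup>2 * (4\<^sup>2 + 4 * (- 6) + (- 6)\<^sup>2 / 3 + (- \<mu> / \<sigma>\<^sup>2)\<^sup>2 * \<sigma>\<^sup>2) = \<mu>\<^sup>2 + 4 * \<sigma>\<^sup>2"
        using \<sigma> by (simp add: power_divide field_simps power2_eq_square)
      then show "weak_conv_m (\<lambda>n. distr M borel (\<lambda>\<omega>. ramp_sum 4 (- 6) (- \<mu> / \<sigma>\<^sup>2) n (noise_path \<omega>)))
          (normal_law 0 (\<mu>\<^sup>2 + 4 * \<sigma>\<^sup>2))"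
        using ramp_sum_normal_limit[of 4 "- 6" "- \<mu> / \<sigma>\<^sup>2"] by simp
      have eq: "sqrt n * (D n \<omega> - \<mu>) - ramp_sum 4 (- 6) (- \<mu> / \<sigma>\<^sup>2) n (noise_path \<omega>)
          = (sqrt n * w n \<omega> - ramp_sum 4 (- 6) 0 n (noise_path \<omega>))
            + (- \<mu>) * (sqrt n * c n \<omega> - ramp_sum 0 0 (1 / \<sigma>\<^sup>2) n (noise_path \<omega>))" for n \<omega>
        using ramp_sum_linear[of 1 4 "- 6" 0 n "noise_path \<omega>" "- \<mu>" 0 0 "1 / \<sigma>\<^sup>2"]
        by (simp add: w_def c_def algebra_simps)
      show "vanishes_in_prob (\<lambda>n \<omega>. sqrt n * (D n \<omega> - \<mu>) - ramp_sum 4 (- 6) (- \<mu> / \<sigma>\<^sup>2) n (noise_path \<omega>))"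
        unfolding eq by (intro vanishes_in_prob_add vanishes_in_prob_cmult expansion(2,3))
    qed (use ABD ramp_sum_bounded real_distribution_normal_law in auto)
    moreover have "weakly_converges
         (\<lambda>n. distr M borel (\<lambda>\<omega>. vector [sqrt n * (A n \<omega> - 1), sqrt n * B n \<omega>] :: real ^ 2))
         (distr (normal_law 0 1) borel (\<lambda>z. z *\<^sub>R (vector [- 1, 1] :: real ^ 2)))"
      unfolding weakly_converges_def
    proof (intro allI impI)
      fix f :: "real ^ 2 \<Rightarrow> real" assume f: "continuous_on UNIV f" "bounded (range f)"
      let ?d = "vector [- 1, 1] :: real ^ 2"
      \<comment> \<open>the leading term of \<open>sqrt n * B n\<close>\<close>
      define Z where "Z n \<omega> = ramp_sum 0 0 (- 1 / \<sigma>\<^sup>2) n (noise_path \<omega>)" for n \<omega>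
      have Z_measurable[measurable]: "Z n \<in> borel_measurable M" for n unfolding Z_def[abs_def] by measurable
      define V where "V n \<omega> = (vector [sqrt n * (A n \<omega> - 1), sqrt n * B n \<omega>] :: real ^ 2)" for n \<omega>
      have V_measurable: "V n \<in> borel_measurable M" if "0 < n" for n
        unfolding V_def[abs_def] vector_2_eq_axis using ABD[OF that] by measurable
      note [measurable] = borel_measurable_continuous_onI[OF f(1)]
      have Z_eq: "sqrt n * B n \<omega> - Z n \<omega> = - (sqrt n * c n \<omega> - ramp_sum 0 0 (1 / \<sigma>\<^sup>2) n (noise_path \<omega>))" for n \<omega>
        using ramp_sum_scale[of "- 1" 0 0 "1 / \<sigma>\<^sup>2" n "noise_path \<omega>"] by (simp add: Z_def c_def)
      have close: "vanishes_in_prob (\<lambda>n \<omega>. V n \<omega> - Z n \<omega> *\<^sub>R ?d)"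
      proof (rule vanishes_in_prob_mono)
        have "vanishes_in_prob (\<lambda>n \<omega>. sqrt n * u n \<omega>)"
        proof -
          have "bounded_in_prob (\<lambda>n \<omega>. n * sqrt n * u n \<omega>)"
            using bounded_in_prob_add[OF vanishes_imp_bounded_in_prob[OF expansion(1)] ramp_sum_bounded[of "- 6 / \<mu>" "12 / \<mu>" 0]]
            by simp
          moreover have "vanishes_in_prob (\<lambda>n \<omega>. 1 / real n)"
            by (rule vanishes_in_prob_const) real_asymp
          ultimately have "vanishes_in_prob (\<lambda>n \<omega>. 1 / real n * (n * sqrt n * u n \<omega>))"
            by (intro vanishes_in_prob_mult_bounded)
          then show ?thesis by (rule vanishes_in_prob_mono) (auto intro!: AE_I2)
        qed
        then show "vanishes_in_prob (\<lambda>n \<omega>. \<bar>sqrt n * u n \<omega>\<bar>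
            + 2 * \<bar>sqrt n * c n \<omega> - ramp_sum 0 0 (1 / \<sigma>\<^sup>2) n (noise_path \<omega>)\<bar>)"
          by (intro vanishes_in_prob_add vanishes_in_prob_cmult vanishes_in_prob_abs expansion(2))
        fix n
        have "norm (V n \<omega> - Z n \<omega> *\<^sub>R ?d) \<le> \<bar>sqrt n * u n \<omega>\<bar>
            + 2 * \<bar>sqrt n * c n \<omega> - ramp_sum 0 0 (1 / \<sigma>\<^sup>2) n (noise_path \<omega>)\<bar>" for \<omega>
        proof -
          have "V n \<omega> - Z n \<omega> *\<^sub>R ?d = vector [sqrt n * u n \<omega> - (sqrt n * B n \<omega> - Z n \<omega>), sqrt n * B n \<omega> - Z n \<omega>]"
            by (simp add: V_def u_def vec_eq_iff forall_2 algebra_simps)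
          then have "norm (V n \<omega> - Z n \<omega> *\<^sub>R ?d) \<le> \<bar>sqrt n * u n \<omega> - (sqrt n * B n \<omega> - Z n \<omega>)\<bar> + \<bar>sqrt n * B n \<omega> - Z n \<omega>\<bar>"
            using norm_vector_2_le by metis
          moreover have "\<bar>a - (- b)\<bar> + \<bar>- b\<bar> \<le> \<bar>a\<bar> + 2 * \<bar>b\<bar>" for a b :: real by linarith
          ultimately show ?thesis unfolding Z_eq by (rule order_trans)
        qed
        then show "AE \<omega> in M. norm (V n \<omega> - Z n \<omega> *\<^sub>R ?d) \<le> norm (\<bar>sqrt n * u n \<omega>\<bar>
            + 2 * \<bar>sqrt n * c n \<omega> - ramp_sum 0 0 (1 / \<sigma>\<^sup>2) n (noise_path \<omega>)\<bar>)"
          by (intro AE_I2) (simp add: order_trans[OF _ abs_ge_self])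
      qed
      have tight: "bounded_in_prob (\<lambda>n \<omega>. Z n \<omega> *\<^sub>R ?d)"
      proof (rule bounded_in_prob_mono)
        show "bounded_in_prob (\<lambda>n \<omega>. ramp_sum 0 0 (- norm ?d / \<sigma>\<^sup>2) n (noise_path \<omega>))"
          by (rule ramp_sum_bounded)
        show "norm (Z n \<omega> *\<^sub>R ?d) \<le> norm (ramp_sum 0 0 (- norm ?d / \<sigma>\<^sup>2) n (noise_path \<omega>))" for n \<omega>
          using ramp_sum_scale[of "norm ?d" 0 0 "- 1 / \<sigma>\<^sup>2" n "noise_path \<omega>", symmetric]
          by (simp add: Z_def abs_mult mult.commute)
      qed
      have slutsky: "(\<lambda>n. expectation (\<lambda>\<omega>. f (V n \<omega>)) - expectation (\<lambda>\<omega>. f (Z n \<omega> *\<^sub>R ?d))) \<longlonglongrightarrow> 0"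
        by (rule bounded_continuous_Slutsky[OF V_measurable _ close tight f]) auto
      have "\<sigma>\<^sup>2 * (0\<^sup>2 + 0 * 0 + 0\<^sup>2 / 3 + (- 1 / \<sigma>\<^sup>2)\<^sup>2 * \<sigma>\<^sup>2) = 1"
        using \<sigma> by (simp add: power_divide field_simps power2_eq_square)
      then have "weak_conv_m (\<lambda>n. distr M borel (Z n)) (normal_law 0 1)"
        using ramp_sum_normal_limit[of 0 0 "- 1 / \<sigma>\<^sup>2"] by (simp add: Z_def[abs_def])
      then have wc: "weakly_converges (\<lambda>n. distr M borel (Z n)) (normal_law 0 1)"
        by (subst weakly_converges_real_iff) (auto intro: real_distribution_normal_law)
      have "continuous_on UNIV (\<lambda>z. f (z *\<^sub>R ?d))"
        by (rule continuous_on_compose2[OF f(1)]) (auto intro!: continuous_intros)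
      moreover have "bounded (range (\<lambda>z. f (z *\<^sub>R ?d)))"
        using f(2) by (rule bounded_subset) auto
      ultimately have "(\<lambda>n. \<integral>z. f (z *\<^sub>R ?d) \<partial>distr M borel (Z n)) \<longlonglongrightarrow> (\<integral>z. f (z *\<^sub>R ?d) \<partial>normal_law 0 1)"
        using wc unfolding weakly_converges_def by blast
      moreover have "(\<integral>z. f (z *\<^sub>R ?d) \<partial>distr M borel (Z n)) = expectation (\<lambda>\<omega>. f (Z n \<omega> *\<^sub>R ?d))" for n
        by (subst integral_distr) auto
      moreover have "(\<integral>z. f (z *\<^sub>R ?d) \<partial>normal_law 0 1) = (\<integral>y. f y \<partial>distr (normal_law 0 1) borel (\<lambda>z. z *\<^sub>R ?d))"
      proof -
        have [measurable_cong]: "sets (normal_law 0 1) = sets borel" by (simp add: normal_law_def)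
        show ?thesis by (subst integral_distr) auto
      qed
      ultimately have "(\<lambda>n. expectation (\<lambda>\<omega>. f (Z n \<omega> *\<^sub>R ?d))) \<longlonglongrightarrow> (\<integral>y. f y \<partial>distr (normal_law 0 1) borel (\<lambda>z. z *\<^sub>R ?d))"
        by simp
      from tendsto_add[OF slutsky this]
      have "(\<lambda>n. expectation (\<lambda>\<omega>. f (V n \<omega>))) \<longlonglongrightarrow> (\<integral>y. f y \<partial>distr (normal_law 0 1) borel (\<lambda>z. z *\<^sub>R ?d))"
        by simp
      then have "(\<lambda>n. \<integral>y. f y \<partial>distr M borel (V n)) \<longlonglongrightarrow> (\<integral>y. f y \<partial>distr (normal_law 0 1) borel (\<lambda>z. z *\<^sub>R ?d))"
      proof (rule Lim_transform_eventually, intro eventually_mono[OF eventually_gt_at_top[of 0]])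
        show "expectation (\<lambda>\<omega>. f (V n \<omega>)) = (\<integral>y. f y \<partial>distr M borel (V n))" if "0 < n" for n
          using V_measurable[OF that] by (subst integral_distr) auto
      qed
      then show "(\<lambda>n. \<integral>y. f y \<partial>distr M borel (\<lambda>\<omega>. vector [sqrt n * (A n \<omega> - 1), sqrt n * B n \<omega>] :: real ^ 2))
          \<longlonglongrightarrow> (\<integral>y. f y \<partial>distr (normal_law 0 1) borel (\<lambda>z. z *\<^sub>R ?d))"
        by (simp add: V_def[abs_def])
    qed
    ultimately show ?thesis
      unfolding rho powr(2) A_def B_def D_def by blast
  qed
qed

end
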